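(* Let $N\geq1$ be an integer, $m>1$, $0<p<1$, $\sigma=\frac{2(1-p)}{m-1}$, and assume $m+p>2$. Then there exists a unique exponent $\alpha^*>0$ such that good profiles with interface satisfying $f(0)=1$ exist for any self-similar exponent $\alpha\in[\alpha^*,+\infty)$ and do not exist for $\alpha\in(0,\alpha^* )$. Moreover: (a) For $\alpha=\alpha^*$ there exists a unique good profile with interface $f(\xi)$ with $f(0)=1$ having the interface behavior $f(\xi)\sim C(\xi_0-\xi)_{+}^{1/(m-1)}$ as $\xi\to\xi_0$ (interface of Type I), for some constant $C>0$. (b) For any fixed $\alpha\in(\alpha^*,\infty)$ there exists a unique good profile with interface $f(\xi)$ with $f(0)=1$ having the interface behavior $f(\xi)\sim C(\xi_0-\xi)_{+}^{1/(1-p)}$ as $\xi\to\xi_0$ (interface of Type II), for some constant $C>0$.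
   Context: The profiles arise from radially symmetric self-similar solutions $u(x,t)=e^{\alpha t}f(\xi)$, $\xi=|x|e^{-\beta t}$, of $u_t=\Delta u^m+|x|^{\sigma}u^p$ in $\mathbb{R}^N$. The self-similar exponents satisfy $\alpha>0$ and $\beta=\frac{m-1}{2}\alpha$, and the profile $f\geq0$ solves $$(f^m)''(\xi)+\frac{N-1}{\xi}(f^m)'(\xi)-\alpha f(\xi)+\beta\xi f'(\xi)+\xi^{\sigma}f(\xi)^p=0.\qquad(\ast)$$ For given $\alpha>0$, a solution $f$ of $(\ast)$ is called a good profile with interface if: (i) $f(0)=A>0$ and $f'(0)=0$; (ii) there exists $\xi_0\in(0,\infty)$ such that $f(\xi_0)=0$, $f(\xi)>0$ for all $\xi\in(0,\xi_0)$, and $(f^m)'(\xi_0)=0$. In the claim $\xi_0$ denotes this point. The notation $g\sim h$ means $g/h\to1$ as $\xi\to\xi_0$, $\xi<\xi_0$. *)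

theory Defs
  imports "HOL-Analysis.Analysis" "HOL-Library.Landau_Symbols"
begin

definition solves_profile_ode ::
    "nat \<Rightarrow> real \<Rightarrow> real \<Rightarrow> real \<Rightarrow> real \<Rightarrow> (real \<Rightarrow> real) \<Rightarrow> real set \<Rightarrow> bool" where
  "solves_profile_ode N m p \<sigma> \<alpha> f S \<longleftrightarrow>
     (let \<beta> = (m - 1) / 2 * \<alpha>; F = (\<lambda>\<xi>. f \<xi> powr m) in
      \<forall>\<xi>\<in>S. f differentiable (at \<xi>) \<and> F differentiable (at \<xi>) \<and> deriv F differentiable (at \<xi>) \<and>
        deriv (deriv F) \<xi> + (real N - 1) / \<xi> * deriv F \<xi> - \<alpha> * f \<xi> + \<beta> * \<xi> * deriv f \<xi>
          + \<xi> powr \<sigma> * f \<xi> powr p = 0)"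

text \<open>
  A profile is a function on \<open>[0, \<xi>0]\<close>, understood to be continued by zero beyond its interface
  point \<open>\<xi>0\<close>; the values of \<open>f\<close> outside \<open>[0, \<xi>0]\<close> play no role, and the derivatives at the two
  end points are one-sided. They entail continuity of \<open>f\<close> at these points. The point \<open>\<xi>0\<close> is
  determined by \<open>f\<close>, being its first positive zero.
\<close>

definition good_profile_with_interface ::
    "nat \<Rightarrow> real \<Rightarrow> real \<Rightarrow> real \<Rightarrow> real \<Rightarrow> (real \<Rightarrow> real) \<Rightarrow> real \<Rightarrow> bool" where
  "good_profile_with_interface N m p \<sigma> \<alpha> f \<xi>0 \<longleftrightarrow>
     f 0 > 0 \<and> (f has_real_derivative 0) (at_right 0) \<and>
     \<xi>0 > 0 \<and> f \<xi>0 = 0 \<and> (\<forall>\<xi>\<in>{0<..<\<xi>0}. f \<xi> > 0) \<and>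
     ((\<lambda>\<xi>. f \<xi> powr m) has_real_derivative 0) (at_left \<xi>0) \<and>
     solves_profile_ode N m p \<sigma> \<alpha> f {0<..<\<xi>0}"

definition interface_behavior :: "real \<Rightarrow> (real \<Rightarrow> real) \<Rightarrow> real \<Rightarrow> bool" where
  "interface_behavior \<gamma> f \<xi>0 \<longleftrightarrow>
     (\<exists>C>0. f \<sim>[at_left \<xi>0] (\<lambda>\<xi>. C * max 0 (\<xi>0 - \<xi>) powr \<gamma>))"

definition interface_type_I :: "real \<Rightarrow> (real \<Rightarrow> real) \<Rightarrow> real \<Rightarrow> bool" where
  "interface_type_I m = interface_behavior (1 / (m - 1))"

definition interface_type_II :: "real \<Rightarrow> (real \<Rightarrow> real) \<Rightarrow> real \<Rightarrow> bool" where
  "interface_type_II p = interface_behavior (1 / (1 - p))"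

text \<open>Uniqueness of profiles: same interface point, and same values up to it.\<close>

definition exists_unique_profile :: "((real \<Rightarrow> real) \<Rightarrow> real \<Rightarrow> bool) \<Rightarrow> bool" where
  "exists_unique_profile Q \<longleftrightarrow>
     (\<exists>f \<xi>0. Q f \<xi>0 \<and> (\<forall>g \<eta>0. Q g \<eta>0 \<longrightarrow> \<eta>0 = \<xi>0 \<and> (\<forall>\<xi>\<in>{0..\<xi>0}. g \<xi> = f \<xi>)))"

definition critical_exponent :: "nat \<Rightarrow> real \<Rightarrow> real \<Rightarrow> real \<Rightarrow> real \<Rightarrow> bool" where
  "critical_exponent N m p \<sigma> a \<longleftrightarrow> a > 0 \<and>
     (\<forall>\<alpha>\<ge>a. \<exists>f \<xi>0. good_profile_with_interface N m p \<sigma> \<alpha> f \<xi>0 \<and> f 0 = 1) \<and>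
     (\<forall>\<alpha>. 0 < \<alpha> \<and> \<alpha> < a \<longrightarrow>
        \<not> (\<exists>f \<xi>0. good_profile_with_interface N m p \<sigma> \<alpha> f \<xi>0 \<and> f 0 = 1))"

end

theory Submission
  imports Defs "HOL-Real_Asymp.Real_Asymp"
begin

text \<open>
  The value of \<open>\<sigma>\<close> makes the profile equation invariant under a scaling, so it reduces to a first-order
  equation. Write \<open>f x = x powr \<theta> * g\<close> with \<open>\<theta> = 2 / (m - 1)\<close>. Along a profile \<open>g\<close> decreases from infinity at
  the centre to \<open>0\<close> at the interface, and \<open>v = - d (g powr m) / d (ln x)\<close>, as a function of \<open>g\<close>, satisfies
  \<open>v' = m * \<mu> * g powr (m - 1) + \<beta> \<alpha> - forcing g / v\<close>. For each \<open>\<alpha>\<close> exactly one solution has the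
  behaviour at infinity that a smooth centre requires, since deviations from it grow
  superlinearly (\<open>trajectory_exists\<close>, \<open>trajectory_comparison\<close>). Conversely the position is recovered
  from \<open>v\<close> by a quadrature, and the normalisation \<open>f 0 = 1\<close> fixes the scale. So there is at
  most one normalised profile, and there is one exactly when \<open>v\<close> tends to \<open>0\<close> at \<open>g = 0\<close>
  (\<open>good_profile_iff_vanishing\<close>).

  The dependence on \<open>\<alpha>\<close> is read off the phase plane. The trajectory decreases as \<open>\<alpha>\<close> increases, and it
  is Lipschitz in \<open>\<alpha>\<close> uniformly down to \<open>g = 0\<close>. Its limit at \<open>0\<close> is positive for small \<open>\<alpha>\<close> and \<open>0\<close>
  for large \<open>\<alpha>\<close>. If the limit is \<open>0\<close>, then either \<open>v\<close> is asymptotic to \<open>\<beta> \<alpha> * g\<close> or to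
  \<open>m / \<beta> \<alpha> * g powr (m + p - 1)\<close>; the condition \<open>m + p > 2\<close> makes the latter smaller
  (\<open>end_dichotomy\<close>). The first case is a Type I interface, the second a Type II interface
  (\<open>parametrizes_interface\<close>). Both a positive limit and the second case persist under small changes of
  \<open>\<alpha>\<close>, so the critical exponent belongs to the first case. No other exponent does: for smaller
  \<open>\<alpha>\<close> the limit is positive, and a larger \<open>\<alpha>\<close> has a lower trajectory but would
  leave the origin more steeply (\<open>critical_trajectory\<close>).
\<close>

section \<open>Differential inequalities and initial value problems\<close>

text \<open>
  A function that cannot decrease while it is positive, and starts positive, never drops below its
  initial value. The comparison arguments below rest on it, with \<open>u\<close> the difference of two
  solutions, or of a solution and an explicit barrier.
\<close>
lemma barrier_principle:
  fixes u u' :: "real \<Rightarrow> real"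
  assumes "s \<le> t" and cont: "continuous_on {s..t} u"
    and der: "\<And>x. s < x \<Longrightarrow> x < t \<Longrightarrow> (u has_real_derivative u' x) (at x)"
    and pos: "u s > 0"
    and nonneg: "\<And>x. s < x \<Longrightarrow> x < t \<Longrightarrow> u x > 0 \<Longrightarrow> u' x \<ge> 0"
  shows "u s \<le> u t"
proof (rule ccontr)
  assume "\<not> u s \<le> u t"
  then obtain y where y: "max 0 (u t) < y" "y < u s"
    using pos by (metis dense max_less_iff_conj not_le)
  define S where "S = {s..t} \<inter> u -` {..y}"
  have "closed S" unfolding S_def
    by (intro continuous_closed_preimage cont) auto
  moreover have "t \<in> S" using \<open>s \<le> t\<close> y by (auto simp: S_def)
  moreover have bdd: "bdd_below S" by (auto simp: S_def bdd_below_def)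
  ultimately have inS: "Inf S \<in> S"
    using closed_contains_Inf by blast
  have above: "u x > y" if "s \<le> x" "x < Inf S" for x
    using cInf_lower[OF _ bdd, of x] that inS by (fastforce simp: S_def)
  have "u s \<le> u (Inf S)"
  proof (rule DERIV_nonneg_imp_increasing_open[where a=s])
    show "s \<le> Inf S" using inS by (auto simp: S_def)
    show "continuous_on {s..Inf S} u"
      by (rule continuous_on_subset[OF cont]) (use inS in \<open>auto simp: S_def\<close>)
    fix x assume "s < x" "x < Inf S"
    moreover from this have "u x > 0" using above[of x] y by auto
    ultimately show "\<exists>z. DERIV u x :> z \<and> z \<ge> 0"
      using der[of x] nonneg[of x] inS by (auto simp: S_def)
  qed
  moreover have "u (Inf S) \<le> y" using inS by (auto simp: S_def)
  ultimately show False using y by simp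
qed

text \<open>
  This selects the solution coming from infinity: a deviation that satisfies \<open>e' \<ge> q * e / g\<close> grows
  at least like \<open>g powr q\<close>, so a linear bound excludes it.
\<close>
lemma superlinear_growth:
  fixes e e' :: "real \<Rightarrow> real"
  assumes "g1 > 0" "q > 1"
    and der: "\<And>g. g \<ge> g1 \<Longrightarrow> (e has_real_derivative e' g) (at g)"
    and pos: "e g1 > 0"
    and grow: "\<And>g. g \<ge> g1 \<Longrightarrow> e g > 0 \<Longrightarrow> e' g \<ge> q * e g / g"
  shows "\<not> (\<forall>\<^sub>F g in at_top. e g \<le> C * g)"
proof
  have cont: "continuous_on {g1..g} e" for g
    by (rule DERIV_continuous_on) (use der in \<open>auto intro: has_field_derivative_at_within\<close>)
  have epos: "e g > 0" if "g \<ge> g1" for g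
  proof -
    have "e g1 \<le> e g"
    proof (rule barrier_principle[OF that cont _ pos])
      fix x assume x: "g1 < x" "x < g" and "e x > 0"
      then have "q * e x / x > 0" using assms by simp
      then show "e' x \<ge> 0" using grow[of x] x \<open>e x > 0\<close> by linarith
    qed (use der in auto)
    then show ?thesis using pos by simp
  qed
  assume "\<forall>\<^sub>F g in at_top. e g \<le> C * g"
  moreover have "\<forall>\<^sub>F g in at_top. e g1 * (g / g1) powr q \<le> e g"
    using eventually_ge_at_top[of g1]
  proof eventually_elim
    case (elim g)
    have "e g1 * g1 powr (-q) \<le> e g * g powr (-q)"
    proof (rule DERIV_nonneg_imp_nondecreasing[OF elim])
      fix x assume x: "g1 \<le> x" "x \<le> g"
      have "((\<lambda>x. e x * x powr (-q)) has_real_derivative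
          (e' x * x powr (-q) + e x * (-q * x powr (-q-1)))) (at x)"
        using x \<open>g1 > 0\<close> by (auto intro!: derivative_eq_intros der)
      moreover have "e' x * x powr (-q) + e x * (-q * x powr (-q-1))
          = (e' x - q * e x / x) * x powr (-q)"
        using x \<open>g1 > 0\<close> by (simp add: powr_diff field_simps)
      moreover have "\<dots> \<ge> 0" using grow[of x] epos[of x] x by simp
      ultimately show "\<exists>y. ((\<lambda>x. e x * x powr (-q)) has_real_derivative y) (at x) \<and> 0 \<le> y"
        by metis
    qed
    then show ?case using \<open>g1 > 0\<close> elim
      by (simp add: powr_minus powr_divide field_simps)
  qed
  moreover have "\<forall>\<^sub>F g in at_top. C * g < e g1 * (g / g1) powr q"
  proof -
    have "filterlim (\<lambda>g::real. g powr (q - 1)) at_top at_top"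
      using assms by real_asymp
    then have "\<forall>\<^sub>F g in at_top. g powr (q - 1) > C * g1 powr q / e g1"
      by (simp add: filterlim_at_top_dense)
    then show ?thesis using eventually_gt_at_top[of 0]
    proof eventually_elim
      case (elim g)
      then have "C * g1 powr q < g powr q / g * e g1"
        using pos by (simp add: powr_diff field_simps)
      then show ?case using elim \<open>g1 > 0\<close> by (simp add: powr_divide field_simps)
    qed
  qed
  ultimately have "\<forall>\<^sub>F g in (at_top :: real filter). False"
    by eventually_elim linarith
  then show False by simp
qed

text \<open>
  The Picard--Lindeloef theorem with data at the right end point \<open>t\<close> and a right-hand side that is
  Lipschitz in the unknown on the whole strip, so that the solution exists on all of \<open>[s, t]\<close>.
\<close>
lemma picard_backward:
  fixes \<Phi> :: "real \<Rightarrow> real \<Rightarrow> real"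
  assumes "s \<le> t"
    and cont: "continuous_on ({s..t} \<times> UNIV) (\<lambda>z. \<Phi> (fst z) (snd z))"
    and lip: "\<And>x y z. x \<in> {s..t} \<Longrightarrow> \<bar>\<Phi> x y - \<Phi> x z\<bar> \<le> L * \<bar>y - z\<bar>"
  obtains w where "w t = w0"
    and "\<And>x. x \<in> {s..t} \<Longrightarrow> (w has_real_derivative \<Phi> x (w x)) (at x within {s..t})"
proof -
  \<comment> \<open>The weight \<open>exp (lam * (t - x))\<close> makes the integral operator a contraction on the whole interval at
    once; without it the interval would have to be cut into pieces of length below \<open>1 / L\<close>.\<close>
  define lam where "lam = 2 * (\<bar>L\<bar> + 1)"
  have lam: "lam > 0" by (simp add: lam_def)
  define cl where "cl = (\<lambda>x. max s (min t x))"
  have cl: "cl x \<in> {s..t}" for x using \<open>s \<le> t\<close> by (auto simp: cl_def)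
  have cl_id: "cl x = x" if "x \<in> {s..t}" for x using that by (auto simp: cl_def)
  define W where "W = (\<lambda>x. exp (lam * (t - x)))"
  define rhs where "rhs = (\<lambda>(\<phi> :: real \<Rightarrow>\<^sub>C real) x. \<Phi> x (W x * \<phi> x))"
  define T where "T = (\<lambda>(\<phi> :: real \<Rightarrow>\<^sub>C real) x. (w0 - integral {x..t} (rhs \<phi>)) / W x)"
  have rhs_cont: "continuous_on {s..t} (rhs \<phi>)" for \<phi>
  proof -
    have c: "continuous_on {s..t} (\<lambda>x. (x, W x * \<phi> x))"
      unfolding W_def by (intro continuous_intros continuous_on_apply_bcontfun)
    show ?thesis unfolding rhs_def
      using continuous_on_compose2[OF cont c] by auto
  qed
  have int: "rhs \<phi> integrable_on {x..t}" if "x \<in> {s..t}" for \<phi> x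
    by (rule integrable_continuous_interval, rule continuous_on_subset[OF rhs_cont]) (use that in auto)
  have T_cont: "continuous_on {s..t} (T \<phi>)" for \<phi>
    unfolding T_def W_def
    by (intro continuous_intros indefinite_integral_continuous_1') (use int[of s] \<open>s \<le> t\<close> in auto)
  have T_bcont: "(\<lambda>x. T \<phi> (cl x)) \<in> bcontfun" for \<phi>
  proof -
    have "continuous_on UNIV (\<lambda>x. T \<phi> (cl x))"
      by (rule continuous_on_compose2[OF T_cont[of \<phi>]]) (use \<open>s \<le> t\<close> in \<open>auto simp: cl_def intro!: continuous_intros\<close>)
    moreover have "bounded (range (\<lambda>x. T \<phi> (cl x)))"
    proof (rule bounded_subset)
      show "bounded (T \<phi> ` {s..t})"
        using compact_continuous_image[OF T_cont] compact_imp_bounded by blast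
    qed (use cl in auto)
    ultimately show ?thesis by (simp add: bcontfun_def)
  qed
  define TT where "TT = (\<lambda>\<phi>. Bcontfun (\<lambda>x. T \<phi> (cl x)))"
  have TT: "apply_bcontfun (TT \<phi>) x = T \<phi> (cl x)" for \<phi> x
    unfolding TT_def using Bcontfun_inverse[OF T_bcont] by metis
  have contr: "dist (TT \<phi>) (TT \<psi>) \<le> (1/2) * dist \<phi> \<psi>" for \<phi> \<psi>
  proof (rule dist_bound)
    fix x0
    define x where "x = cl x0"
    have x: "x \<in> {s..t}" using cl x_def by simp
    have W_int: "((\<lambda>y. W y) has_integral (W x - 1) / lam) {x..t}"
    proof -
      have "((\<lambda>y. W y) has_integral ((- W t / lam) - (- W x / lam))) {x..t}"
        by (rule fundamental_theorem_of_calculus)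
          (use x lam in \<open>auto simp: W_def has_real_derivative_iff_has_vector_derivative[symmetric]
             intro!: derivative_eq_intros\<close>)
      then show ?thesis by (simp add: W_def diff_divide_distrib)
    qed
    have "integral {x..t} (\<lambda>y. rhs \<phi> y - rhs \<psi> y) = integral {x..t} (rhs \<phi>) - integral {x..t} (rhs \<psi>)"
      by (rule integral_diff) (use int x in auto)
    then have "dist (TT \<phi> x0) (TT \<psi> x0) = \<bar>integral {x..t} (\<lambda>y. rhs \<phi> y - rhs \<psi> y)\<bar> / W x"
      by (simp add: TT T_def x_def[symmetric] dist_real_def W_def abs_minus_commute
          diff_divide_distrib[symmetric])
    also have "\<bar>integral {x..t} (\<lambda>y. rhs \<phi> y - rhs \<psi> y)\<bar>
        \<le> integral {x..t} (\<lambda>y. \<bar>L\<bar> * dist \<phi> \<psi> * W y)"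
    proof (rule integral_norm_bound_integral[where 'a = real, unfolded real_norm_def])
      show "(\<lambda>y. rhs \<phi> y - rhs \<psi> y) integrable_on {x..t}" using int x by (intro integrable_diff)
      show "(\<lambda>y. \<bar>L\<bar> * dist \<phi> \<psi> * W y) integrable_on {x..t}"
        using W_int by (intro integrable_on_mult_right) blast
      fix y assume y: "y \<in> {x..t}"
      have "\<bar>rhs \<phi> y - rhs \<psi> y\<bar> \<le> L * \<bar>W y * \<phi> y - W y * \<psi> y\<bar>"
        unfolding rhs_def by (rule lip) (use x y in auto)
      also have "\<dots> \<le> \<bar>L\<bar> * \<bar>W y * \<phi> y - W y * \<psi> y\<bar>" by (intro mult_right_mono) auto
      also have "\<bar>W y * \<phi> y - W y * \<psi> y\<bar> = W y * dist (\<phi> y) (\<psi> y)"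
        by (simp add: dist_real_def W_def abs_mult flip: right_diff_distrib)
      also have "\<bar>L\<bar> * (W y * dist (\<phi> y) (\<psi> y)) \<le> \<bar>L\<bar> * (W y * dist \<phi> \<psi>)"
        by (intro mult_left_mono dist_bounded) (auto simp: W_def)
      finally show "\<bar>rhs \<phi> y - rhs \<psi> y\<bar> \<le> \<bar>L\<bar> * dist \<phi> \<psi> * W y"
        by (simp add: mult_ac)
    qed
    also have "integral {x..t} (\<lambda>y. \<bar>L\<bar> * dist \<phi> \<psi> * W y) = \<bar>L\<bar> * dist \<phi> \<psi> * ((W x - 1) / lam)"
      using integral_unique[OF has_integral_mult_right[OF W_int]] by simp
    also have "\<dots> / W x \<le> (1/2) * dist \<phi> \<psi>"
    proof -
      have "\<bar>L\<bar> * (W x - 1) \<le> \<bar>L\<bar> * W x" by (intro mult_left_mono) auto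
      also have "\<dots> \<le> lam / 2 * W x" by (intro mult_right_mono) (auto simp: lam_def W_def)
      finally have "\<bar>L\<bar> * (W x - 1) / (lam * W x) \<le> 1/2"
        using lam by (simp add: field_simps W_def)
      from mult_right_mono[OF this, of "dist \<phi> \<psi>"] show ?thesis by (simp add: field_simps)
    qed
    finally show "dist (TT \<phi> x0) (TT \<psi> x0) \<le> (1/2) * dist \<phi> \<psi>"
      by (simp add: divide_right_mono W_def)
  qed
  obtain \<phi> where \<phi>: "TT \<phi> = \<phi>"
    using banach_fix_type[of "1/2" TT] contr by auto
  define w where "w = (\<lambda>x. w0 - integral {x..t} (rhs \<phi>))"
  have w_eq: "w x = W x * \<phi> x" if "x \<in> {s..t}" for x
    using TT[of \<phi> x] \<phi> that by (simp add: cl_id T_def w_def W_def)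
  show ?thesis
  proof
    show "w t = w0" by (simp add: w_def)
    fix x assume x: "x \<in> {s..t}"
    have "((\<lambda>x. integral {x..t} (rhs \<phi>)) has_real_derivative - rhs \<phi> x) (at x within {s..t})"
      by (rule integral_has_real_derivative'[OF rhs_cont x])
    then have "(w has_real_derivative rhs \<phi> x) (at x within {s..t})"
      unfolding w_def by (auto intro!: derivative_eq_intros)
    moreover have "rhs \<phi> x = \<Phi> x (w x)" using w_eq[OF x] by (simp add: rhs_def)
    ultimately show "(w has_real_derivative \<Phi> x (w x)) (at x within {s..t})" by simp
  qed
qed

lemma tendsto_powr_at_right_0:
  assumes "a > 0"
  shows "((\<lambda>x::real. x powr a) \<longlongrightarrow> 0) (at_right 0)"
  using assms by real_asymp

lemma has_real_derivative_left_inverse: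
  fixes f g :: "real \<Rightarrow> real"
  assumes S: "open S" "x \<in> S" and f: "\<And>y. y \<in> S \<Longrightarrow> (f has_real_derivative f' y) (at y)"
    and "f' x \<noteq> 0" and "\<And>y. y \<in> S \<Longrightarrow> g (f y) = y"
  shows "(g has_real_derivative inverse (f' x)) (at (f x))"
  unfolding has_field_derivative_def
proof (rule has_derivative_inverse_strong[OF S])
  show "continuous_on S f"
    using f by (intro continuous_at_imp_continuous_on ballI DERIV_isCont)
  show "(f has_derivative (*) (f' x)) (at x)" using f[OF S(2)] by (simp add: has_field_derivative_def)
qed (use assms in \<open>auto simp: fun_eq_iff\<close>)

section \<open>The phase equation\<close>

text \<open>
  The equation is invariant under \<open>f x \<mapsto> c powr (- \<theta>) * f (c * x)\<close> precisely because of the value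
  of \<open>\<sigma>\<close>. Put \<open>f x = x powr \<theta> * g\<close> and \<open>v = - d (g powr m) / d (ln x)\<close>. Then \<open>v\<close> is a function of
  \<open>g\<close> alone with \<open>v' = slope \<alpha> g v\<close>. The constant \<open>\<kappa> = m * \<theta>\<close> is the exponent of \<open>f powr m\<close>, \<open>\<mu>\<close> and
  \<open>\<nu>\<close> are the coefficients that the Laplacian produces, and \<open>q\<close> is the exponent with which solutions
  of the phase equation separate as \<open>g\<close> tends to infinity.
\<close>
locale weighted_profile =
  fixes N :: nat and m p :: real
  assumes N: "N \<ge> 1" and m: "m > 1" and p0: "0 < p" and p1: "p < 1"
begin

definition \<theta> :: real where "\<theta> = 2 / (m - 1)"
definition \<kappa> :: real where "\<kappa> = 2 * m / (m - 1)"
definition \<mu> :: real where "\<mu> = 2 * \<kappa> + real N - 2"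
definition \<nu> :: real where "\<nu> = \<kappa> * (\<kappa> + real N - 2)"
definition q :: real where "q = 1 + real N * (m - 1) / 2"
definition \<beta> :: "real \<Rightarrow> real" where "\<beta> \<alpha> = (m - 1) / 2 * \<alpha>"

definition forcing :: "real \<Rightarrow> real" where
  "forcing g = m * g powr (m - 1) * (\<nu> * g powr m + g powr p)"

definition slope :: "real \<Rightarrow> real \<Rightarrow> real \<Rightarrow> real" where
  "slope \<alpha> g v = m * \<mu> * g powr (m - 1) + \<beta> \<alpha> - forcing g / v"

lemma \<theta>_pos: "\<theta> > 0" and \<kappa>_eq: "\<kappa> = \<theta> + 2" "\<kappa> = m * \<theta>" and \<kappa>_gt2: "\<kappa> > 2"
  and N_real: "real N \<ge> 1"
  using m N by (auto simp: \<theta>_def \<kappa>_def field_simps)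

lemma \<mu>_pos: "\<mu> > 0" and \<nu>_pos: "\<nu> > 0" and \<mu>_\<kappa>: "\<mu> * \<kappa> = \<kappa>\<^sup>2 + \<nu>"
proof -
  have "\<kappa> + real N - 2 > 0" using \<kappa>_gt2 N_real by linarith
  then show "\<mu> > 0" "\<nu> > 0" using \<kappa>_gt2 by (auto simp: \<mu>_def \<nu>_def)
qed (simp add: \<mu>_def \<nu>_def power2_eq_square algebra_simps)

lemma q_gt1: "q > 1" and q_\<nu>: "m * \<nu> = q * \<kappa>\<^sup>2"
proof -
  show "q > 1" using m N_real by (simp add: q_def)
  have "m * (\<kappa> + real N - 2) = q * \<kappa>"
    using m by (simp add: q_def \<kappa>_def field_simps)
  then have "\<kappa> * (m * (\<kappa> + real N - 2)) = \<kappa> * (q * \<kappa>)" by simp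
  then show "m * \<nu> = q * \<kappa>\<^sup>2" by (simp add: \<nu>_def power2_eq_square mult_ac)
qed

lemma \<beta>_pos: "\<alpha> > 0 \<Longrightarrow> \<beta> \<alpha> > 0" and \<beta>_diff: "\<beta> \<alpha>2 - \<beta> \<alpha>1 = \<beta> (\<alpha>2 - \<alpha>1)"
  and \<beta>_q: "\<beta> \<alpha> = (q - 1) * (\<alpha> / real N)" and \<beta>_\<kappa>: "m / \<kappa> * \<alpha> = \<beta> \<alpha>"
  using m N_real by (auto simp: \<beta>_def q_def \<kappa>_def field_simps)

lemma \<beta>_mono: "\<alpha>1 \<le> \<alpha>2 \<Longrightarrow> \<beta> \<alpha>1 \<le> \<beta> \<alpha>2"
  using m unfolding \<beta>_def by (intro mult_left_mono) auto

lemma forcing_pos: "g > 0 \<Longrightarrow> forcing g > 0"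
  using m \<nu>_pos unfolding forcing_def by (simp add: add_pos_pos)

lemma forcing_mono: "0 < g \<Longrightarrow> g \<le> h \<Longrightarrow> forcing g \<le> forcing h"
  unfolding forcing_def using m p0 \<nu>_pos
  by (intro mult_mono add_mono mult_left_mono powr_mono2 mult_nonneg_nonneg add_nonneg_nonneg) auto

lemma slope_diff:
  assumes "v1 > 0" "v2 > 0"
  shows "slope \<alpha>2 g v2 - slope \<alpha>1 g v1 = \<beta> (\<alpha>2 - \<alpha>1) + forcing g / (v1 * v2) * (v2 - v1)"
proof -
  have "forcing g / v1 - forcing g / v2 = forcing g / (v1 * v2) * (v2 - v1)"
    using assms by (simp add: field_simps)
  then show ?thesis by (simp add: slope_def \<beta>_diff[symmetric])
qed

text \<open>
  The curve \<open>v = \<kappa> * g powr m\<close> is where the profile has a critical point, and all solutions of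
  interest approach it at infinity. The identity is the equation for the distance to it.
\<close>
lemma slope_defect:
  assumes "g > 0" "v > 0"
  shows "\<kappa> * (m * g powr (m - 1)) - slope \<alpha> g v
    = - \<beta> \<alpha> + m / \<kappa> * g powr (p - 1) + forcing g / (\<kappa> * g powr m * v) * (\<kappa> * g powr m - v)"
proof -
  have kpos: "\<kappa> > 0" using \<kappa>_gt2 by simp
  have "forcing g / (\<kappa> * g powr m * v) * (\<kappa> * g powr m - v)
      = forcing g / v - forcing g / (\<kappa> * g powr m)"
    using assms kpos by (simp add: field_simps)
  moreover have "forcing g / (\<kappa> * g powr m) = m * \<nu> / \<kappa> * g powr (m - 1) + m / \<kappa> * g powr (p - 1)"
    using assms kpos unfolding forcing_def by (simp add: powr_diff field_simps)
  moreover have "m * (\<mu> - \<kappa>) = m * \<nu> / \<kappa>"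
    using \<mu>_\<kappa> kpos by (simp add: field_simps power2_eq_square)
  then have "m * \<mu> * g powr (m - 1) - \<kappa> * (m * g powr (m - 1)) = m * \<nu> / \<kappa> * g powr (m - 1)"
    by (metis (no_types, lifting) left_diff_distrib' mult.assoc mult.commute right_diff_distrib)
  ultimately show ?thesis by (simp add: slope_def)
qed

text \<open>
  Differences of solutions satisfy a linear equation with this coefficient. On the curve
  \<open>v = \<kappa> * g powr m\<close> it is \<open>q / g\<close> plus a positive term, and below the curve it can only be larger.
\<close>
lemma forcing_ge:
  assumes "g > 0" "0 < v1" "v1 \<le> \<kappa> * g powr m" "0 < v2" "v2 \<le> \<kappa> * g powr m"
  shows "q / g \<le> forcing g / (v1 * v2)"
proof -
  have "v1 * v2 \<le> (\<kappa> * g powr m) * (\<kappa> * g powr m)" using assms by (intro mult_mono) auto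
  then have "forcing g / ((\<kappa> * g powr m) * (\<kappa> * g powr m)) \<le> forcing g / (v1 * v2)"
    using assms forcing_pos[of g] by (intro divide_left_mono) auto
  moreover have "forcing g / ((\<kappa> * g powr m) * (\<kappa> * g powr m))
     = (m * \<nu>) / \<kappa>\<^sup>2 / g + m * g powr (m - 1) * g powr p / ((\<kappa> * g powr m) * (\<kappa> * g powr m))"
    using assms(1) \<kappa>_gt2 by (simp add: forcing_def powr_diff field_simps power2_eq_square)
  moreover have "(m * \<nu>) / \<kappa>\<^sup>2 = q" using q_\<nu> \<kappa>_gt2 by simp
  moreover have "m * g powr (m - 1) * g powr p / ((\<kappa> * g powr m) * (\<kappa> * g powr m)) \<ge> 0"
    using m by simp
  ultimately show ?thesis by simp
qed

text \<open>
  The value of \<open>g\<close> at which \<open>slope\<close> is tangent to the curve \<open>v = \<kappa> * g powr m\<close>. For larger \<open>g\<close> the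
  curve cannot be crossed upwards as \<open>g\<close> decreases, so profiles increase there.
\<close>
definition turning :: "real \<Rightarrow> real" where "turning \<alpha> = \<alpha> powr (-1 / (1 - p))"

lemma turning_pos: "\<alpha> > 0 \<Longrightarrow> turning \<alpha> > 0" by (simp add: turning_def)

lemma turning_antimono: "0 < \<alpha>1 \<Longrightarrow> \<alpha>1 \<le> \<alpha>2 \<Longrightarrow> turning \<alpha>2 \<le> turning \<alpha>1"
  unfolding turning_def using p1 by (intro powr_mono2') auto

lemma above_turning:
  assumes "\<alpha> > 0" "g \<ge> turning \<alpha>"
  shows "m / \<kappa> * g powr (p - 1) \<le> \<beta> \<alpha>"
proof -
  have "g powr (p - 1) \<le> turning \<alpha> powr (p - 1)"
    using assms p1 turning_pos by (intro powr_mono2') auto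
  also have "\<dots> = \<alpha>"
  proof -
    have "-1 / (1 - p) * (p - 1) = 1" using p1 by (simp add: field_simps)
    then show ?thesis using assms unfolding turning_def powr_powr by simp
  qed
  finally have "m / \<kappa> * g powr (p - 1) \<le> m / \<kappa> * \<alpha>"
    using m \<kappa>_gt2 by (intro mult_left_mono) auto
  then show ?thesis by (simp only: \<beta>_\<kappa>)
qed

section \<open>The solution coming from infinity\<close>

text \<open>
  The zero set of \<open>slope\<close> in \<open>v\<close>.
\<close>
definition nullcline :: "real \<Rightarrow> real \<Rightarrow> real" where
  "nullcline \<alpha> g = forcing g / (m * \<mu> * g powr (m - 1) + \<beta> \<alpha>)"

lemma damping_pos: "\<alpha> > 0 \<Longrightarrow> m * \<mu> * g powr (m - 1) + \<beta> \<alpha> > 0"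
  using m \<mu>_pos \<beta>_pos[of \<alpha>] by (intro add_nonneg_pos) auto

lemma nullcline_pos: "\<alpha> > 0 \<Longrightarrow> g > 0 \<Longrightarrow> nullcline \<alpha> g > 0"
  unfolding nullcline_def using forcing_pos damping_pos by simp

lemma nullcline_mono:
  assumes "\<alpha> > 0" "0 < g" "g \<le> h"
  shows "nullcline \<alpha> g \<le> nullcline \<alpha> h"
proof -
  have eq: "nullcline \<alpha> x = (\<nu> * x powr m + x powr p) * (m * x powr (m - 1) / (m * \<mu> * x powr (m - 1) + \<beta> \<alpha>))" for x
    by (simp add: nullcline_def forcing_def)
  define X Y where "X = m * g powr (m - 1)" and "Y = m * h powr (m - 1)"
  have XY: "0 \<le> X" "X \<le> Y" using assms m by (auto simp: X_def Y_def intro!: mult_left_mono powr_mono2)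
  have "X / (\<mu> * X + \<beta> \<alpha>) \<le> Y / (\<mu> * Y + \<beta> \<alpha>)"
  proof -
    have "\<mu> * X + \<beta> \<alpha> > 0" "\<mu> * Y + \<beta> \<alpha> > 0"
      using XY \<beta>_pos[OF assms(1)] \<mu>_pos by (auto intro!: add_nonneg_pos)
    moreover have "X * \<beta> \<alpha> \<le> Y * \<beta> \<alpha>" using XY \<beta>_pos[OF assms(1)] by simp
    ultimately show ?thesis
      by (simp add: pos_divide_le_eq pos_le_divide_eq algebra_simps)
  qed
  then have "m * g powr (m - 1) / (m * \<mu> * g powr (m - 1) + \<beta> \<alpha>)
      \<le> m * h powr (m - 1) / (m * \<mu> * h powr (m - 1) + \<beta> \<alpha>)"
    by (simp add: X_def Y_def mult_ac)
  moreover have "\<nu> * g powr m + g powr p \<le> \<nu> * h powr m + h powr p"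
    using assms m p0 \<nu>_pos by (intro add_mono mult_left_mono powr_mono2) auto
  ultimately show ?thesis unfolding eq
    using assms m \<nu>_pos damping_pos[OF assms(1), of g]
    by (intro mult_mono) (auto intro!: add_nonneg_nonneg)
qed

lemma slope_nonneg_iff:
  assumes "\<alpha> > 0" "v > 0"
  shows "slope \<alpha> g v \<ge> 0 \<longleftrightarrow> nullcline \<alpha> g \<le> v"
  using damping_pos[OF assms(1), of g] assms(2) by (simp add: slope_def nullcline_def field_simps)

lemma nullcline_below:
  assumes "\<alpha> > 0" "g \<ge> turning \<alpha>"
  shows "nullcline \<alpha> g \<le> \<kappa> * g powr m"
proof -
  have g: "g > 0" using assms turning_pos[of \<alpha>] by linarith
  have v: "\<kappa> * g powr m > 0" using g \<kappa>_gt2 by simp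
  have "\<kappa> * (m * g powr (m - 1)) \<ge> 0" using m \<kappa>_gt2 by simp
  then have "slope \<alpha> g (\<kappa> * g powr m) \<ge> 0"
    using slope_defect[OF g v, of \<alpha>] above_turning[OF assms] by simp
  then show ?thesis using slope_nonneg_iff[OF assms(1) v] by simp
qed

text \<open>
  Solutions starting on the curve \<open>v = \<kappa> * g powr m\<close> at a large value \<open>t\<close> of \<open>g\<close>. As \<open>t\<close> grows they
  decrease to the solution that comes from infinity.
\<close>
definition approximant :: "real \<Rightarrow> real \<Rightarrow> real \<Rightarrow> (real \<Rightarrow> real) \<Rightarrow> bool" where
  "approximant \<alpha> s t w \<longleftrightarrow> w t = \<kappa> * t powr m \<and> continuous_on {s..t} w \<and>
     (\<forall>g\<in>{s..t}. nullcline \<alpha> g \<le> w g) \<and>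
     (\<forall>g\<in>{s<..<t}. (w has_real_derivative slope \<alpha> g (w g)) (at g))"

text \<open>
  Replacing \<open>v\<close> in the denominator by \<open>max v (nullcline \<alpha> g)\<close> makes the equation globally Lipschitz.
  The modified solution is constant as long as it lies below the nullcline; since the nullcline
  increases and the solution ends above it, the solution is never below, and the modification has no
  effect.
\<close>
lemma approximant_exists:
  assumes \<alpha>: "\<alpha> > 0" and s: "0 < s" "s \<le> t" and t: "t \<ge> turning \<alpha>"
  shows "\<exists>w. approximant \<alpha> s t w"
proof -
  define \<Phi> where "\<Phi> = (\<lambda>g v. slope \<alpha> g (max v (nullcline \<alpha> g)))"
  define L where "L = forcing t / (nullcline \<alpha> s)\<^sup>2"
  have lip: "\<bar>\<Phi> g y - \<Phi> g z\<bar> \<le> L * \<bar>y - z\<bar>" if g: "g \<in> {s..t}" for g y z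
  proof -
    define Y Z where "Y = max y (nullcline \<alpha> g)" and "Z = max z (nullcline \<alpha> g)"
    have ns: "nullcline \<alpha> s > 0" using nullcline_pos \<alpha> s by simp
    have "nullcline \<alpha> s \<le> nullcline \<alpha> g" using nullcline_mono \<alpha> s g by simp
    then have YZ: "nullcline \<alpha> s \<le> Y" "nullcline \<alpha> s \<le> Z" by (auto simp: Y_def Z_def)
    have "\<Phi> g y - \<Phi> g z = forcing g / (Z * Y) * (Y - Z)"
      unfolding \<Phi>_def Y_def[symmetric] Z_def[symmetric]
      using slope_diff[of Z Y \<alpha> g \<alpha>] YZ ns by (simp add: \<beta>_def)
    then have "\<bar>\<Phi> g y - \<Phi> g z\<bar> = forcing g / (Z * Y) * \<bar>Y - Z\<bar>"
      using YZ ns forcing_pos[of g] g s by (simp add: abs_mult)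
    also have "\<dots> \<le> L * \<bar>y - z\<bar>"
    proof (rule mult_mono)
      show "forcing g / (Z * Y) \<le> L"
        unfolding L_def power2_eq_square
        using YZ ns forcing_pos[of t] forcing_mono[of g t] g s
        by (intro frac_le mult_mono) auto
      show "0 \<le> L" using forcing_pos[of t] s by (simp add: L_def)
    qed (auto simp: Y_def Z_def)
    finally show ?thesis .
  qed
  have cont: "continuous_on ({s..t} \<times> UNIV) (\<lambda>z. \<Phi> (fst z) (snd z))"
  proof -
    have c: "continuous_on ({s..t} \<times> (UNIV :: real set)) (\<lambda>z. nullcline \<alpha> (fst z))"
      unfolding nullcline_def forcing_def
      using s damping_pos[OF \<alpha>] by (intro continuous_intros) (auto simp: less_imp_neq[symmetric])
    have "max (snd z) (nullcline \<alpha> (fst z)) \<noteq> 0" if "z \<in> {s..t} \<times> UNIV" for z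
      using nullcline_pos[OF \<alpha>, of "fst z"] that s by fastforce
    then show ?thesis
      unfolding \<Phi>_def slope_def forcing_def
      using s by (intro continuous_intros c) auto
  qed
  have "\<exists>w. w t = \<kappa> * t powr m \<and>
      (\<forall>g\<in>{s..t}. (w has_real_derivative \<Phi> g (w g)) (at g within {s..t}))"
  proof (rule picard_backward[where \<Phi> = \<Phi> and L = L and ?w0.0 = "\<kappa> * t powr m"])
    show "s \<le> t" by (rule s)
    show "continuous_on ({s..t} \<times> UNIV) (\<lambda>z. \<Phi> (fst z) (snd z))" by (rule cont)
    show "\<bar>\<Phi> g y - \<Phi> g z\<bar> \<le> L * \<bar>y - z\<bar>" if "g \<in> {s..t}" for g y z by (rule lip[OF that])
  qed (rule exI, rule conjI, assumption, rule ballI)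
  then obtain w where wt: "w t = \<kappa> * t powr m"
    and w: "\<And>g. g \<in> {s..t} \<Longrightarrow> (w has_real_derivative \<Phi> g (w g)) (at g within {s..t})"
    by blast
  have wcont: "continuous_on {s..t} w" by (rule DERIV_continuous_on[OF w])
  have wd: "(w has_real_derivative \<Phi> g (w g)) (at g)" if "s < g" "g < t" for g
    using w[of g] that by (simp add: at_within_Icc_at)
  have nc: "nullcline \<alpha> g \<le> w g" if g: "g \<in> {s..t}" for g
  proof (rule ccontr)
    assume less: "\<not> nullcline \<alpha> g \<le> w g"
    have "nullcline \<alpha> g - w g \<le> nullcline \<alpha> g - w t"
    proof (rule barrier_principle[where u = "\<lambda>x. nullcline \<alpha> g - w x" and u' = "\<lambda>x. - \<Phi> x (w x)"])
      show "continuous_on {g..t} (\<lambda>x. nullcline \<alpha> g - w x)"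
        using g by (intro continuous_intros continuous_on_subset[OF wcont]) auto
      fix x assume x: "g < x" "x < t"
      show "((\<lambda>x. nullcline \<alpha> g - w x) has_real_derivative - \<Phi> x (w x)) (at x)"
        using x g by (auto intro!: derivative_eq_intros wd)
      assume "nullcline \<alpha> g - w x > 0"
      moreover have "nullcline \<alpha> g \<le> nullcline \<alpha> x" using x g \<alpha> s nullcline_mono by simp
      ultimately have "\<Phi> x (w x) = slope \<alpha> x (nullcline \<alpha> x)" by (simp add: \<Phi>_def max_def)
      also have "\<dots> = 0"
        using damping_pos[OF \<alpha>, of x] forcing_pos[of x] x g s by (simp add: slope_def nullcline_def)
      finally show "- \<Phi> x (w x) \<ge> 0" by simp
    qed (use g less in auto)
    moreover have "nullcline \<alpha> g \<le> nullcline \<alpha> t" using nullcline_mono \<alpha> g s by simp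
    ultimately show False using less nullcline_below[OF \<alpha> t] wt by simp
  qed
  have "\<Phi> g (w g) = slope \<alpha> g (w g)" if "g \<in> {s..t}" for g
    using nc[OF that] by (simp add: \<Phi>_def max_absorb1)
  then have "approximant \<alpha> s t w"
    unfolding approximant_def using wt wcont nc wd by auto
  then show ?thesis by blast
qed

lemma approximant_subinterval:
  assumes "approximant \<alpha> s t w" "0 < s" "s \<le> g" "g \<le> t" "\<alpha> > 0"
  shows "continuous_on {g..t} w" "nullcline \<alpha> g \<le> w g" "w g > 0" "w t = \<kappa> * t powr m"
    and "\<And>x. g < x \<Longrightarrow> x < t \<Longrightarrow> (w has_real_derivative slope \<alpha> x (w x)) (at x)"
proof -
  show "continuous_on {g..t} w"
    using assms continuous_on_subset[of "{s..t}" w "{g..t}"] by (auto simp: approximant_def)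
  show "nullcline \<alpha> g \<le> w g" using assms by (auto simp: approximant_def)
  then show "w g > 0" using nullcline_pos[of \<alpha> g] assms by linarith
qed (use assms in \<open>auto simp: approximant_def\<close>)

lemma homogeneous_deriv:
  "g > 0 \<Longrightarrow> ((\<lambda>g. \<kappa> * g powr m) has_real_derivative \<kappa> * (m * g powr (m - 1))) (at g)"
  by (auto intro!: derivative_eq_intros)

lemma approximant_le:
  assumes A: "approximant \<alpha> s t w" "0 < s" "\<alpha> > 0" and g: "s \<le> g" "g \<le> t" "turning \<alpha> \<le> g"
  shows "w g \<le> \<kappa> * g powr m"
proof (rule ccontr)
  assume less: "\<not> w g \<le> \<kappa> * g powr m"
  note w = approximant_subinterval[OF A(1,2) _ _ A(3)]
  have "w g - \<kappa> * g powr m \<le> w t - \<kappa> * t powr m"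
  proof (rule barrier_principle[where u = "\<lambda>x. w x - \<kappa> * x powr m"
        and u' = "\<lambda>x. slope \<alpha> x (w x) - \<kappa> * (m * x powr (m - 1))"])
    show "continuous_on {g..t} (\<lambda>x. w x - \<kappa> * x powr m)"
      using w(1)[OF g(1,2)] A g by (intro continuous_intros) auto
    fix x assume x: "g < x" "x < t"
    then have x0: "x > 0" using A g by simp
    show "((\<lambda>x. w x - \<kappa> * x powr m) has_real_derivative slope \<alpha> x (w x) - \<kappa> * (m * x powr (m - 1))) (at x)"
      using w(5)[OF g(1,2) x] homogeneous_deriv[OF x0] by (rule DERIV_diff)
    assume above: "w x - \<kappa> * x powr m > 0"
    have wx: "w x > 0" using w(3)[of x] x g by simp
    have "m / \<kappa> * x powr (p - 1) \<le> \<beta> \<alpha>" using above_turning[OF A(3), of x] x g by simp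
    moreover have "forcing x / (\<kappa> * x powr m * w x) * (\<kappa> * x powr m - w x) \<le> 0"
      using above wx forcing_pos[OF x0] \<kappa>_gt2 by (intro mult_nonneg_nonpos) auto
    ultimately show "slope \<alpha> x (w x) - \<kappa> * (m * x powr (m - 1)) \<ge> 0"
      using slope_defect[OF x0 wx, of \<alpha>] by linarith
  qed (use less g in auto)
  then show False using less w(4)[OF g(1,2)] by simp
qed

text \<open>
  The line \<open>u = \<alpha> / N * g\<close> is the exact linear solution of \<open>u' = - \<beta> \<alpha> + q * u / g\<close>, which is the leading
  part of the equation for the distance \<open>u = \<kappa> * g powr m - v\<close>.
\<close>
lemma approximant_ge:
  assumes A: "approximant \<alpha> s t w" "0 < s" "\<alpha> > 0" and g: "s \<le> g" "g \<le> t"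
  shows "\<kappa> * g powr m - \<alpha> / real N * g \<le> w g"
proof (rule ccontr)
  assume less: "\<not> ?thesis"
  define c where "c = \<alpha> / real N"
  have c: "c > 0" using A(3) N_real by (simp add: c_def)
  note w = approximant_subinterval[OF A(1,2) _ _ A(3)]
  have "\<kappa> * g powr m - w g - c * g \<le> \<kappa> * t powr m - w t - c * t"
  proof (rule barrier_principle[where u = "\<lambda>x. \<kappa> * x powr m - w x - c * x"
        and u' = "\<lambda>x. \<kappa> * (m * x powr (m - 1)) - slope \<alpha> x (w x) - c"])
    show "continuous_on {g..t} (\<lambda>x. \<kappa> * x powr m - w x - c * x)"
      using w(1)[OF g(1,2)] A g by (intro continuous_intros) auto
    fix x assume x: "g < x" "x < t"
    then have x0: "x > 0" using A g by simp
    show "((\<lambda>x. \<kappa> * x powr m - w x - c * x) has_real_derivative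
        \<kappa> * (m * x powr (m - 1)) - slope \<alpha> x (w x) - c) (at x)"
      using w(5)[OF g(1,2) x] x0 by (auto intro!: derivative_eq_intros)
    assume below: "\<kappa> * x powr m - w x - c * x > 0"
    have wx: "w x > 0" using w(3)[of x] x g by simp
    have cx: "c * x > 0" using c x0 by simp
    have "q * c = q / x * (c * x)" using x0 by simp
    also have "\<dots> \<le> forcing x / (\<kappa> * x powr m * w x) * (\<kappa> * x powr m - w x)"
      using below cx wx x0 q_gt1 \<kappa>_gt2 forcing_pos[OF x0]
      by (intro mult_mono forcing_ge) auto
    finally have "q * c \<le> forcing x / (\<kappa> * x powr m * w x) * (\<kappa> * x powr m - w x)" .
    moreover have "\<beta> \<alpha> = q * c - c" by (simp add: \<beta>_q c_def algebra_simps diff_divide_distrib)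
    moreover have "m / \<kappa> * x powr (p - 1) \<ge> 0" using m \<kappa>_gt2 by simp
    ultimately show "\<kappa> * (m * x powr (m - 1)) - slope \<alpha> x (w x) - c \<ge> 0"
      using slope_defect[OF x0 wx, of \<alpha>] by linarith
  qed (use less g in \<open>auto simp: c_def\<close>)
  moreover have "c * t > 0" using c A g by simp
  ultimately show False using less w(4)[OF g(1,2)] by (simp add: c_def)
qed

lemma approximant_antimono:
  assumes A: "approximant \<alpha> s t w" "0 < s" "\<alpha> > 0" and B: "approximant \<alpha> s' t' w'" "0 < s'"
    and t: "turning \<alpha> \<le> t" "t \<le> t'" and g: "s \<le> g" "s' \<le> g" "g \<le> t"
  shows "w' g \<le> w g"
proof (rule ccontr)
  assume less: "\<not> ?thesis"
  have gt': "g \<le> t'" using g t by simp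
  note w = approximant_subinterval[OF A(1,2) _ _ A(3)]
  note w' = approximant_subinterval[OF B(1,2) _ _ A(3)]
  have "w' g - w g \<le> w' t - w t"
  proof (rule barrier_principle[where u = "\<lambda>x. w' x - w x"
        and u' = "\<lambda>x. slope \<alpha> x (w' x) - slope \<alpha> x (w x)"])
    show "continuous_on {g..t} (\<lambda>x. w' x - w x)"
      using w(1)[OF g(1,3)] w'(1)[OF g(2) gt'] t
      by (intro continuous_intros) (auto elim: continuous_on_subset)
    fix x assume x: "g < x" "x < t"
    show "((\<lambda>x. w' x - w x) has_real_derivative slope \<alpha> x (w' x) - slope \<alpha> x (w x)) (at x)"
      using w(5)[OF g(1,3) x] w'(5)[OF g(2) gt' x(1)] x t by (intro DERIV_diff) auto
    assume "w' x - w x > 0"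
    then show "slope \<alpha> x (w' x) - slope \<alpha> x (w x) \<ge> 0"
      using slope_diff[of "w x" "w' x" \<alpha> x \<alpha>] w(3)[of x] w'(3)[of x] forcing_pos[of x] x g t A
      by (simp add: \<beta>_def)
  qed (use less g in auto)
  moreover have "w' t \<le> \<kappa> * t powr m"
    using approximant_le[OF B(1,2) A(3), of t] t g by simp
  ultimately show False using less w(4)[OF g(1,3)] by simp
qed

text \<open>
  Two approximants differ most at the right end, so pointwise convergence at one point is uniform
  convergence to its left.
\<close>
lemma approximant_gap_mono:
  assumes A: "approximant \<alpha> s t w" "0 < s" "\<alpha> > 0" and B: "approximant \<alpha> s' t' w'" "0 < s'"
    and t: "turning \<alpha> \<le> t" "t \<le> t'" and g: "s \<le> g" "s' \<le> g" "g \<le> h" "h \<le> t"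
  shows "w g - w' g \<le> w h - w' h"
proof (rule DERIV_nonneg_imp_increasing_open[OF g(3)])
  have gt: "g \<le> t" "g \<le> t'" using g t by auto
  note w = approximant_subinterval[OF A(1,2) _ _ A(3)]
  note w' = approximant_subinterval[OF B(1,2) _ _ A(3)]
  show "continuous_on {g..h} (\<lambda>x. w x - w' x)"
      using w(1)[OF g(1) gt(1)] w'(1)[OF g(2) gt(2)] t g
      by (intro continuous_intros) (auto elim: continuous_on_subset)
  fix x assume x: "g < x" "x < h"
  have "((\<lambda>x. w x - w' x) has_real_derivative slope \<alpha> x (w x) - slope \<alpha> x (w' x)) (at x)"
    using w(5)[OF g(1) gt(1) x(1)] w'(5)[OF g(2) gt(2) x(1)] x t g by (intro DERIV_diff) auto
  moreover have "slope \<alpha> x (w x) - slope \<alpha> x (w' x) \<ge> 0"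
    using slope_diff[of "w' x" "w x" \<alpha> x \<alpha>] w(3)[of x] w'(3)[of x] forcing_pos[of x] x g t A
      approximant_antimono[OF A B t, of x]
    by (simp add: \<beta>_def)
  ultimately show "\<exists>y. ((\<lambda>x. w x - w' x) has_real_derivative y) (at x) \<and> y \<ge> 0" by blast
qed

text \<open>
  The linear bound at infinity encodes the regular centre of the profile: in the original variables
  it says that the derivative of \<open>f powr m\<close> at \<open>x\<close> is at most a multiple of \<open>x * f x\<close>.
\<close>
definition trajectory :: "real \<Rightarrow> (real \<Rightarrow> real) \<Rightarrow> bool" where
  "trajectory \<alpha> v \<longleftrightarrow> (\<forall>g>0. v g > 0 \<and> (v has_real_derivative slope \<alpha> g (v g)) (at g)) \<and>
     (\<exists>C. \<forall>\<^sub>F g in at_top. \<bar>v g - \<kappa> * g powr m\<bar> \<le> C * g)"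

text \<open>
  The trajectory is the decreasing limit of the approximants. Convergence is uniform on compact
  intervals, and so is that of the slopes, hence the limit solves the equation.
\<close>
lemma trajectory_exists:
  assumes \<alpha>: "\<alpha> > 0"
  obtains v where "trajectory \<alpha> v"
    and "\<And>g. g > 0 \<Longrightarrow> nullcline \<alpha> g \<le> v g"
    and "\<And>g. g > 0 \<Longrightarrow> \<kappa> * g powr m - \<alpha> / real N * g \<le> v g"
    and "\<And>g. turning \<alpha> \<le> g \<Longrightarrow> v g \<le> \<kappa> * g powr m"
proof -
  define lo hi where "lo = (\<lambda>n. 1 / (real n + 1))" and "hi = (\<lambda>n. real n + max 1 (turning \<alpha>))"
  have lo: "lo n > 0" "lo n \<le> hi n" and hi: "turning \<alpha> \<le> hi n" for n
  proof -
    have "lo n \<le> 1" by (simp add: lo_def)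
    then show "lo n \<le> hi n" by (simp add: hi_def)
  qed (auto simp: lo_def hi_def)
  have hi_mono: "hi i \<le> hi j" if "i \<le> j" for i j using that by (simp add: hi_def)
  obtain w where w: "\<And>n. approximant \<alpha> (lo n) (hi n) (w n)"
    using approximant_exists[OF \<alpha> lo hi] by metis
  have "lo \<longlonglongrightarrow> 0" unfolding lo_def by real_asymp
  then have ev_lo: "\<forall>\<^sub>F n in sequentially. lo n < g" if "g > 0" for g
    using that by (rule order_tendstoD)
  have "filterlim hi at_top sequentially" unfolding hi_def by real_asymp
  then have ev_hi: "\<forall>\<^sub>F n in sequentially. g < hi n" for g
    by (simp add: filterlim_at_top_dense)
  have window: "\<exists>n0. \<forall>n\<ge>n0. lo n < g \<and> h < hi n" if "g > 0" for g h
    using eventually_conj[OF ev_lo[OF that] ev_hi[of h]] by (simp add: eventually_sequentially)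
  have conv: "convergent (\<lambda>n. w n g)" if g: "g > 0" for g
  proof -
    obtain n0 where n0: "\<And>n. n \<ge> n0 \<Longrightarrow> lo n < g \<and> g < hi n" using window[OF g] by blast
    have "convergent (\<lambda>n. w (n + n0) g)"
    proof (rule Bseq_monoseq_convergent)
      have dec: "w (n + n0) g \<le> w (k + n0) g" if "k \<le> n" for k n
        using approximant_antimono[OF w lo(1) \<alpha> w lo(1) hi hi_mono, of "k + n0" "n + n0" g]
          n0[of "k + n0"] n0[of "n + n0"] that by simp
      then show "monoseq (\<lambda>n. w (n + n0) g)" by (simp add: decseq_imp_monoseq decseq_def)
      show "Bseq (\<lambda>n. w (n + n0) g)"
      proof (rule BseqI')
        fix n
        have "nullcline \<alpha> g \<le> w (n + n0) g"
          using approximant_subinterval(2)[OF w lo(1) _ _ \<alpha>, of "n + n0" g] n0[of "n + n0"] by simp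
        moreover have "w (n + n0) g \<le> w n0 g" using dec[of 0 n] by simp
        ultimately show "norm (w (n + n0) g) \<le> \<bar>w n0 g\<bar> + \<bar>nullcline \<alpha> g\<bar>"
          unfolding real_norm_def by arith
      qed
    qed
    then show ?thesis by (rule convergent_ignore_initial_segment[of "\<lambda>n. w n g" n0, THEN iffD1])
  qed
  define v where "v = (\<lambda>g. lim (\<lambda>n. w n g))"
  have lim: "(\<lambda>n. w n g) \<longlonglongrightarrow> v g" if "g > 0" for g
    using conv[OF that] by (simp add: v_def convergent_LIMSEQ_iff)
  have nc: "nullcline \<alpha> g \<le> v g" if "g > 0" for g
  proof (rule tendsto_lowerbound[OF lim[OF that]])
    show "\<forall>\<^sub>F n in sequentially. nullcline \<alpha> g \<le> w n g"
      using ev_lo[OF that] ev_hi[of g]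
      by eventually_elim (use approximant_subinterval(2)[OF w lo(1) _ _ \<alpha>] in auto)
  qed simp
  have ge: "\<kappa> * g powr m - \<alpha> / real N * g \<le> v g" if "g > 0" for g
  proof (rule tendsto_lowerbound[OF lim[OF that]])
    show "\<forall>\<^sub>F n in sequentially. \<kappa> * g powr m - \<alpha> / real N * g \<le> w n g"
      using ev_lo[OF that] ev_hi[of g]
      by eventually_elim (use approximant_ge[OF w lo(1) \<alpha>] in auto)
  qed simp
  have le: "v g \<le> \<kappa> * g powr m" if "turning \<alpha> \<le> g" for g
  proof -
    have g: "g > 0" using turning_pos[OF \<alpha>] that by simp
    show ?thesis
    proof (rule tendsto_upperbound[OF lim[OF g]])
      show "\<forall>\<^sub>F n in sequentially. w n g \<le> \<kappa> * g powr m"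
        using ev_lo[OF g] ev_hi[of g]
        by eventually_elim (use approximant_le[OF w lo(1) \<alpha> _ _ that] in auto)
    qed simp
  qed
  have der: "(v has_real_derivative slope \<alpha> g (v g)) (at g)" if g: "g > 0" for g
  proof -
    define s t where "s = g / 2" and "t = g + 1"
    have st: "0 < s" "s < g" "g < t" using g by (auto simp: s_def t_def)
    obtain n0 where n0: "\<And>n. n \<ge> n0 \<Longrightarrow> lo n < s \<and> t < hi n" using window[OF st(1)] by blast
    define K where "K = forcing t / (nullcline \<alpha> s)\<^sup>2"
    have ns: "nullcline \<alpha> s > 0" using nullcline_pos \<alpha> st by simp
    have K: "K > 0" using ns forcing_pos[of t] st by (simp add: K_def)
    have gap: "0 \<le> w n x - v x \<and> w n x - v x \<le> w n t - v t" if n: "n \<ge> n0" and x: "x \<in> {s..t}" for n x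
    proof
      have "\<forall>\<^sub>F j in sequentially. w j x \<le> w n x"
        using eventually_ge_at_top[of n]
      proof eventually_elim
        case (elim j)
        show ?case
          using approximant_antimono[OF w lo(1) \<alpha> w lo(1) hi hi_mono[OF elim], of x]
            n0[of n] n0[of j] n elim x by simp
      qed
      then have "v x \<le> w n x" by (intro tendsto_upperbound[OF lim]) (use st x in auto)
      then show "0 \<le> w n x - v x" by simp
      have "\<forall>\<^sub>F j in sequentially. w n x - w j x \<le> w n t - w j t"
        using eventually_ge_at_top[of n]
      proof eventually_elim
        case (elim j)
        show ?case
          using approximant_gap_mono[OF w lo(1) \<alpha> w lo(1) hi hi_mono[OF elim], of x t]
            n0[of n] n0[of j] n elim x by simp
      qed
      moreover have "(\<lambda>j. w n x - w j x) \<longlonglongrightarrow> w n x - v x" "(\<lambda>j. w n t - w j t) \<longlonglongrightarrow> w n t - v t"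
        using st x by (auto intro!: tendsto_intros lim)
      ultimately show "w n x - v x \<le> w n t - v t"
        by (intro tendsto_le[of sequentially "\<lambda>j. w n t - w j t" _ "\<lambda>j. w n x - w j x"]) auto
    qed
    have "\<exists>V. \<forall>x\<in>{s..t}. (\<lambda>n. w (n + n0) x) \<longlonglongrightarrow> V x \<and>
        (V has_derivative (\<lambda>h. h * slope \<alpha> x (v x))) (at x within {s..t})"
    proof (rule has_derivative_sequence[where f' = "\<lambda>n x h. h * slope \<alpha> x (w (n + n0) x)"])
      show "convex {s..t}" by simp
      show "g \<in> {s..t}" using st by simp
      show "(\<lambda>n. w (n + n0) g) \<longlonglongrightarrow> v g" using lim[OF g] by (rule LIMSEQ_ignore_initial_segment)
      show "(w (n + n0) has_derivative (\<lambda>h. h * slope \<alpha> x (w (n + n0) x))) (at x within {s..t})"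
        if "x \<in> {s..t}" for n x
      proof -
        have "lo (n + n0) < x" "x < hi (n + n0)" using n0[of "n + n0"] that by auto
        then have "(w (n + n0) has_real_derivative slope \<alpha> x (w (n + n0) x)) (at x)"
          using w[of "n + n0"] by (simp add: approximant_def)
        then show ?thesis
          by (simp add: has_field_derivative_def mult_commute_abs has_derivative_at_withinI)
      qed
      fix e :: real assume e: "e > 0"
      have "(\<lambda>n. w (n + n0) t) \<longlonglongrightarrow> v t"
        using lim[of t] st by (intro LIMSEQ_ignore_initial_segment) auto
      then have "\<forall>\<^sub>F n in sequentially. w (n + n0) t < v t + e / K"
        using e K by (intro order_tendstoD) auto
      then show "\<forall>\<^sub>F n in sequentially. \<forall>x\<in>{s..t}. \<forall>h.
          norm (h * slope \<alpha> x (w (n + n0) x) - h * slope \<alpha> x (v x)) \<le> e * norm h"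
      proof eventually_elim
        case (elim n)
        show ?case
        proof (intro ballI allI)
          fix x h assume x: "x \<in> {s..t}"
          have x0: "x > 0" using st x by simp
          have mono: "nullcline \<alpha> s \<le> nullcline \<alpha> x" using nullcline_mono[OF \<alpha>, of s x] x st by simp
          have wx: "nullcline \<alpha> s \<le> w (n + n0) x"
            using approximant_subinterval(2)[OF w lo(1) _ _ \<alpha>, of "n + n0" x] n0[of "n + n0"] x mono by simp
          have vx: "nullcline \<alpha> s \<le> v x" using nc[OF x0] mono by simp
          have P: "0 \<le> forcing x / (v x * w (n + n0) x)" "forcing x / (v x * w (n + n0) x) \<le> K"
            unfolding K_def power2_eq_square
            using forcing_mono[of x t] forcing_pos[of x] x x0 ns wx vx
            by (auto intro!: frac_le mult_mono divide_nonneg_nonneg)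
          have "\<bar>slope \<alpha> x (w (n + n0) x) - slope \<alpha> x (v x)\<bar>
              = forcing x / (v x * w (n + n0) x) * (w (n + n0) x - v x)"
            using slope_diff[of "v x" "w (n + n0) x" \<alpha> x \<alpha>] ns wx vx P gap[of "n + n0" x] x
              forcing_pos[OF x0]
            by (simp add: \<beta>_def abs_mult)
          also have "\<dots> \<le> K * (e / K)"
            using P gap[of "n + n0" x] gap[of "n + n0" t] x st elim by (intro mult_mono) auto
          finally have "\<bar>slope \<alpha> x (w (n + n0) x) - slope \<alpha> x (v x)\<bar> \<le> e" using K by simp
          from mult_right_mono[OF this, of "\<bar>h\<bar>"]
          show "norm (h * slope \<alpha> x (w (n + n0) x) - h * slope \<alpha> x (v x)) \<le> e * norm h"
            by (simp add: abs_mult[symmetric] right_diff_distrib mult.commute left_diff_distrib)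
        qed
      qed
    qed
    then obtain V where V: "\<And>x. x \<in> {s..t} \<Longrightarrow> (\<lambda>n. w (n + n0) x) \<longlonglongrightarrow> V x"
      and dV: "\<And>x. x \<in> {s..t} \<Longrightarrow> (V has_derivative (\<lambda>h. h * slope \<alpha> x (v x))) (at x within {s..t})"
      by blast
    have eq: "V x = v x" if "x \<in> {s..t}" for x
    proof (rule LIMSEQ_unique[OF V[OF that]])
      show "(\<lambda>n. w (n + n0) x) \<longlonglongrightarrow> v x"
        using lim[of x] st that by (intro LIMSEQ_ignore_initial_segment) auto
    qed
    have "(V has_real_derivative slope \<alpha> g (v g)) (at g within {s..t})"
      using dV[of g] st by (simp add: has_field_derivative_def mult_commute_abs)
    then have "(V has_real_derivative slope \<alpha> g (v g)) (at g)" using st by (simp add: at_within_Icc_at)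
    then show ?thesis
      by (rule has_field_derivative_transform_within_open[where S = "{s<..<t}"]) (use st eq in auto)
  qed
  have "trajectory \<alpha> v"
    unfolding trajectory_def
  proof (intro conjI allI impI exI[of _ "\<alpha> / real N"])
    show "v g > 0" if "g > 0" for g using nc[OF that] nullcline_pos[OF \<alpha> that] by simp
    show "\<forall>\<^sub>F g in at_top. \<bar>v g - \<kappa> * g powr m\<bar> \<le> \<alpha> / real N * g"
      using eventually_ge_at_top[of "turning \<alpha>"] eventually_gt_at_top[of 0]
    proof eventually_elim
      case (elim g)
      moreover have "\<alpha> / real N * g \<ge> 0" using elim \<alpha> by simp
      ultimately show ?case using ge[of g] le[of g] by (simp add: abs_le_iff)
    qed
  qed (use der in auto)
  then show thesis using that nc ge le by blast
qed

section \<open>Comparison and continuous dependence on the exponent\<close>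

lemma trajectoryD:
  assumes "trajectory \<alpha> v" "g > 0"
  shows "v g > 0" "(v has_real_derivative slope \<alpha> g (v g)) (at g)"
  using assms by (auto simp: trajectory_def)

lemma trajectory_cont:
  assumes "trajectory \<alpha> v" "s > 0"
  shows "continuous_on {s..t} v"
proof (rule DERIV_continuous_on)
  fix x assume "x \<in> {s..t}"
  then show "(v has_real_derivative slope \<alpha> x (v x)) (at x within {s..t})"
    using trajectoryD(2)[OF assms(1), of x] assms(2) by (auto intro: has_field_derivative_at_within)
qed

lemma trajectory_ratio:
  assumes "trajectory \<alpha> v"
  shows "((\<lambda>g. v g / g powr m) \<longlongrightarrow> \<kappa>) at_top"
proof -
  obtain C where C: "\<forall>\<^sub>F g in at_top. \<bar>v g - \<kappa> * g powr m\<bar> \<le> C * g"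
    using assms by (auto simp: trajectory_def)
  have "((\<lambda>g. v g / g powr m - \<kappa>) \<longlongrightarrow> 0) at_top"
  proof (rule Lim_null_comparison)
    show "((\<lambda>g. C * g powr (1 - m)) \<longlongrightarrow> 0) at_top" using m by real_asymp
    show "\<forall>\<^sub>F g in at_top. norm (v g / g powr m - \<kappa>) \<le> C * g powr (1 - m)"
      using C eventually_gt_at_top[of 0]
    proof eventually_elim
      case (elim g)
      then have "\<bar>(v g - \<kappa> * g powr m) / g powr m\<bar> \<le> C * g / g powr m"
        by (simp add: abs_divide divide_right_mono)
      then show ?case using elim by (simp add: diff_divide_distrib powr_diff)
    qed
  qed
  then show ?thesis by (simp add: LIM_zero_iff)
qed

text \<open>
  If \<open>v2 - v1\<close> were positive somewhere, it would stay positive for all larger \<open>g\<close>, hence eventually grow faster than linearly, contrary to the bounds at infinity.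
\<close>
lemma trajectory_comparison:
  assumes T1: "trajectory \<alpha>1 v1" and T2: "trajectory \<alpha>2 v2" and le: "\<alpha>1 \<le> \<alpha>2" and g: "g > 0"
  shows "v2 g \<le> v1 g"
proof (rule ccontr)
  assume less: "\<not> v2 g \<le> v1 g"
  \<comment> \<open>The two solutions are only known to be asymptotic to \<open>\<kappa> * g powr m\<close>, not to lie below it, and this
    costs an arbitrarily small part of the exponent \<open>q\<close>.\<close>
  define r where "r = (1 + q) / 2"
  have r: "1 < r" "r < q" using q_gt1 by (auto simp: r_def)
  define e where "e = (\<lambda>x. v2 x - v1 x)"
  define e' where "e' = (\<lambda>x. \<beta> (\<alpha>2 - \<alpha>1) + forcing x / (v1 x * v2 x) * e x)"
  have de: "(e has_real_derivative e' x) (at x)" if "x > 0" for x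
  proof -
    have "(e has_real_derivative slope \<alpha>2 x (v2 x) - slope \<alpha>1 x (v1 x)) (at x)"
      unfolding e_def using trajectoryD(2)[OF T1 that] trajectoryD(2)[OF T2 that] by (intro DERIV_diff)
    then show ?thesis
      using slope_diff[of "v1 x" "v2 x" \<alpha>2 x \<alpha>1] trajectoryD(1)[OF T1 that] trajectoryD(1)[OF T2 that]
      by (simp add: e_def e'_def)
  qed
  have \<beta>0: "\<beta> (\<alpha>2 - \<alpha>1) \<ge> 0" using le m by (simp add: \<beta>_def)
  have "((\<lambda>x. (m * \<nu> + m * x powr (p - m)) / (v1 x / x powr m * (v2 x / x powr m))) \<longlongrightarrow> (m * \<nu> + m * 0) / (\<kappa> * \<kappa>)) at_top"
  proof (intro tendsto_intros trajectory_ratio[OF T1] trajectory_ratio[OF T2])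
    show "((\<lambda>x. x powr (p - m)) \<longlongrightarrow> 0) at_top" using p1 m by real_asymp
  qed (use \<kappa>_gt2 in auto)
  moreover have "(m * \<nu> + m * 0) / (\<kappa> * \<kappa>) = q" using q_\<nu> \<kappa>_gt2 by (simp add: power2_eq_square)
  ultimately have "((\<lambda>x. (m * \<nu> + m * x powr (p - m)) / (v1 x / x powr m * (v2 x / x powr m))) \<longlongrightarrow> q) at_top"
    by simp
  from order_tendstoD(1)[OF this r(2)]
  have "\<forall>\<^sub>F x in at_top. r < (m * \<nu> + m * x powr (p - m)) / (v1 x / x powr m * (v2 x / x powr m))" .
  then have "\<forall>\<^sub>F x in at_top. x \<ge> g \<and> r / x \<le> forcing x / (v1 x * v2 x)"
    using eventually_ge_at_top[of g]
  proof eventually_elim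
    case (elim x)
    then have x: "x > 0" using g by simp
    have "x * forcing x = (m * \<nu> + m * x powr (p - m)) * (x powr m * x powr m)"
      using x unfolding forcing_def by (simp add: powr_diff field_simps)
    then have eq: "(m * \<nu> + m * x powr (p - m)) / (v1 x / x powr m * (v2 x / x powr m))
      = x * (forcing x / (v1 x * v2 x))" by simp
    have "r < x * (forcing x / (v1 x * v2 x))" using elim(1) unfolding eq .
    then show ?case using elim x by (simp add: pos_divide_le_eq mult.commute)
  qed
  then obtain g1 where g1: "\<And>x. x \<ge> g1 \<Longrightarrow> x \<ge> g \<and> r / x \<le> forcing x / (v1 x * v2 x)"
    by (auto simp: eventually_at_top_linorder)
  have g1g: "g1 \<ge> g" using g1 by blast
  have "e g \<le> e g1"
  proof (rule barrier_principle[where u = e and u' = e'])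
    show "continuous_on {g..g1} e" unfolding e_def
      by (intro continuous_intros trajectory_cont[OF T1] trajectory_cont[OF T2] g)
    show "e' x \<ge> 0" if "g < x" "e x > 0" for x
      using that g \<beta>0 forcing_pos[of x] trajectoryD(1)[OF T1, of x] trajectoryD(1)[OF T2, of x]
      by (simp add: e'_def)
  qed (use g g1g less de in \<open>auto simp: e_def\<close>)
  then have "e g1 > 0" using less by (simp add: e_def)
  obtain C1 C2 where C1: "\<forall>\<^sub>F g in at_top. \<bar>v1 g - \<kappa> * g powr m\<bar> \<le> C1 * g"
    and C2: "\<forall>\<^sub>F g in at_top. \<bar>v2 g - \<kappa> * g powr m\<bar> \<le> C2 * g"
    using T1 T2 by (auto simp: trajectory_def)
  have "\<forall>\<^sub>F g in at_top. e g \<le> (C1 + C2) * g"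
    using C1 C2 by eventually_elim (simp add: e_def distrib_right abs_le_iff)
  moreover have "\<not> (\<forall>\<^sub>F g in at_top. e g \<le> (C1 + C2) * g)"
  proof (rule superlinear_growth[where e = e and q = r and e' = e', OF _ r(1) _ \<open>e g1 > 0\<close>])
    fix x assume x: "x \<ge> g1" "e x > 0"
    have "r / x * e x \<le> forcing x / (v1 x * v2 x) * e x"
      using g1[of x] x by (intro mult_right_mono) auto
    then show "r * e x / x \<le> e' x" using \<beta>0 by (simp add: e'_def)
  qed (use g g1g de in auto)
  ultimately show False by blast
qed

corollary trajectory_unique:
  "trajectory \<alpha> v1 \<Longrightarrow> trajectory \<alpha> v2 \<Longrightarrow> g > 0 \<Longrightarrow> v1 g = v2 g"
  using trajectory_comparison[of \<alpha> v1 \<alpha> v2 g] trajectory_comparison[of \<alpha> v2 \<alpha> v1 g] by simp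

lemma trajectory_bounds:
  assumes "\<alpha> > 0" "trajectory \<alpha> v" "g > 0"
  shows "nullcline \<alpha> g \<le> v g" "\<kappa> * g powr m - \<alpha> / real N * g \<le> v g"
    and "turning \<alpha> \<le> g \<Longrightarrow> v g \<le> \<kappa> * g powr m"
proof -
  obtain w where "trajectory \<alpha> w" and "nullcline \<alpha> g \<le> w g" "\<kappa> * g powr m - \<alpha> / real N * g \<le> w g"
    "turning \<alpha> \<le> g \<Longrightarrow> w g \<le> \<kappa> * g powr m"
    using trajectory_exists[OF assms(1)] assms(3) by metis
  then show "nullcline \<alpha> g \<le> v g" "\<kappa> * g powr m - \<alpha> / real N * g \<le> v g"
     "turning \<alpha> \<le> g \<Longrightarrow> v g \<le> \<kappa> * g powr m"
    using trajectory_unique[OF assms(2), of w g] assms(3) by auto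
qed

lemma trajectory_mono:
  assumes "\<alpha> > 0" "trajectory \<alpha> v" "0 < g" "g \<le> h"
  shows "v g \<le> v h"
proof (rule DERIV_nonneg_imp_nondecreasing[OF assms(4)])
  fix x assume "g \<le> x" "x \<le> h"
  then have x: "x > 0" using assms by simp
  show "\<exists>y. (v has_real_derivative y) (at x) \<and> 0 \<le> y"
    using trajectoryD[OF assms(2) x] trajectory_bounds(1)[OF assms(1,2) x] slope_nonneg_iff[OF assms(1)]
    by blast
qed

text \<open>
  The line \<open>(\<alpha>2 - \<alpha>1) / N * g\<close> solves the leading part of the equation for the gap, and a gap above it
  would grow superlinearly.
\<close>
lemma trajectory_gap_far:
  assumes T1: "trajectory \<alpha>1 v1" and T2: "trajectory \<alpha>2 v2" and \<alpha>: "0 < \<alpha>1" "\<alpha>1 \<le> \<alpha>2"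
    and g: "turning \<alpha>1 \<le> g"
  shows "v1 g - v2 g \<le> (\<alpha>2 - \<alpha>1) / real N * g"
proof (rule ccontr)
  assume less: "\<not> ?thesis"
  define c where "c = (\<alpha>2 - \<alpha>1) / real N"
  have c: "c \<ge> 0" using \<alpha> by (simp add: c_def)
  have g0: "g > 0" using g turning_pos[OF \<alpha>(1)] by simp
  define e where "e = (\<lambda>x. v1 x - v2 x - c * x)"
  define e' where "e' = (\<lambda>x. slope \<alpha>1 x (v1 x) - slope \<alpha>2 x (v2 x) - c)"
  have de: "(e has_real_derivative e' x) (at x)" if "x > 0" for x
    using trajectoryD[OF T1 that] trajectoryD[OF T2 that]
    unfolding e_def e'_def by (auto intro!: derivative_eq_intros)
  have grow: "q * e x / x \<le> e' x" if x: "x \<ge> g" "e x > 0" for x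
  proof -
    have x0: "x > 0" using x g0 by simp
    have t: "turning \<alpha>1 \<le> x" "turning \<alpha>2 \<le> x" using turning_antimono[OF \<alpha>] g x by auto
    have "v1 x - v2 x \<ge> 0" using trajectory_comparison[OF T1 T2 \<alpha>(2) x0] by simp
    then have "q / x * (v1 x - v2 x) \<le> forcing x / (v2 x * v1 x) * (v1 x - v2 x)"
      using t \<alpha> x0 trajectoryD(1)[OF T1 x0] trajectoryD(1)[OF T2 x0]
        trajectory_bounds(3)[OF _ T1 x0] trajectory_bounds(3)[OF _ T2 x0]
      by (intro mult_right_mono forcing_ge) auto
    moreover have "q / x * (v1 x - v2 x) = q * e x / x + q * c"
      using x0 by (simp add: e_def field_simps)
    moreover have "\<beta> (\<alpha>1 - \<alpha>2) = - (q - 1) * c"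
      using \<beta>_q[of "\<alpha>1 - \<alpha>2"] by (simp add: c_def minus_divide_left[symmetric] algebra_simps diff_divide_distrib)
    ultimately show ?thesis
      using slope_diff[of "v2 x" "v1 x" \<alpha>1 x \<alpha>2] trajectoryD(1)[OF T1 x0] trajectoryD(1)[OF T2 x0]
      by (simp add: e'_def algebra_simps)
  qed
  obtain C1 C2 where C1: "\<forall>\<^sub>F g in at_top. \<bar>v1 g - \<kappa> * g powr m\<bar> \<le> C1 * g"
    and C2: "\<forall>\<^sub>F g in at_top. \<bar>v2 g - \<kappa> * g powr m\<bar> \<le> C2 * g"
    using T1 T2 by (auto simp: trajectory_def)
  have "\<forall>\<^sub>F g in at_top. e g \<le> (C1 + C2) * g"
    using C1 C2 eventually_gt_at_top[of 0]
  proof eventually_elim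
    case (elim x)
    moreover have "c * x \<ge> 0" using c elim by simp
    ultimately show ?case by (simp add: e_def distrib_right abs_le_iff)
  qed
  moreover have "\<not> (\<forall>\<^sub>F g in at_top. e g \<le> (C1 + C2) * g)"
    by (rule superlinear_growth[where e = e and q = q and e' = e' and ?g1.0 = g])
      (use g0 q_gt1 de grow less in \<open>auto simp: e_def c_def\<close>)
  ultimately show False by blast
qed

text \<open>
  Below a fixed value of \<open>g\<close> the gap can increase towards \<open>0\<close> at most at the rate
  \<open>\<beta> (\<alpha>2 - \<alpha>1)\<close>, because the other term in its derivative has the favourable sign. Hence dependence on
  \<open>\<alpha>\<close> is Lipschitz uniformly down to \<open>g = 0\<close>.
\<close>
lemma trajectory_gap_near:
  assumes T1: "trajectory \<alpha>1 v1" and T2: "trajectory \<alpha>2 v2" and \<alpha>: "0 < \<alpha>0" "\<alpha>0 \<le> \<alpha>1" "\<alpha>1 \<le> \<alpha>2"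
    and g: "0 < g" "g \<le> turning \<alpha>0"
  shows "v1 g - v2 g \<le> (\<alpha>2 - \<alpha>1) * ((1 / real N + (m - 1) / 2) * turning \<alpha>0)"
proof -
  define T where "T = turning \<alpha>0"
  have "v1 g - v2 g + \<beta> (\<alpha>2 - \<alpha>1) * g \<le> v1 T - v2 T + \<beta> (\<alpha>2 - \<alpha>1) * T"
  proof (rule DERIV_nonneg_imp_nondecreasing[where f = "\<lambda>x. v1 x - v2 x + \<beta> (\<alpha>2 - \<alpha>1) * x"])
    show "g \<le> T" using g by (simp add: T_def)
    fix x assume "g \<le> x" "x \<le> T"
    then have x0: "x > 0" using g by simp
    have "((\<lambda>x. v1 x - v2 x + \<beta> (\<alpha>2 - \<alpha>1) * x) has_real_derivative
        slope \<alpha>1 x (v1 x) - slope \<alpha>2 x (v2 x) + \<beta> (\<alpha>2 - \<alpha>1)) (at x)"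
      using trajectoryD[OF T1 x0] trajectoryD[OF T2 x0] by (auto intro!: derivative_eq_intros)
    moreover have "slope \<alpha>1 x (v1 x) - slope \<alpha>2 x (v2 x) + \<beta> (\<alpha>2 - \<alpha>1)
        = forcing x / (v2 x * v1 x) * (v1 x - v2 x)"
      using slope_diff[of "v2 x" "v1 x" \<alpha>1 x \<alpha>2] trajectoryD(1)[OF T1 x0] trajectoryD(1)[OF T2 x0]
        \<beta>_diff[of \<alpha>1 \<alpha>2] \<beta>_diff[of \<alpha>2 \<alpha>1] by linarith
    moreover have "\<dots> \<ge> 0"
      using trajectory_comparison[OF T1 T2 \<alpha>(3) x0] forcing_pos[OF x0]
        trajectoryD(1)[OF T1 x0] trajectoryD(1)[OF T2 x0] by simp
    ultimately show "\<exists>y. ((\<lambda>x. v1 x - v2 x + \<beta> (\<alpha>2 - \<alpha>1) * x) has_real_derivative y) (at x) \<and> 0 \<le> y"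
      by metis
  qed
  moreover have "v1 T - v2 T \<le> (\<alpha>2 - \<alpha>1) / real N * T"
    using trajectory_gap_far[OF T1 T2 _ \<alpha>(3), of T] turning_antimono[OF \<alpha>(1,2)] \<alpha> by (simp add: T_def)
  moreover have "\<beta> (\<alpha>2 - \<alpha>1) * g \<ge> 0" using \<alpha> m g by (simp add: \<beta>_def)
  ultimately have "v1 g - v2 g \<le> (\<alpha>2 - \<alpha>1) / real N * T + \<beta> (\<alpha>2 - \<alpha>1) * T" by linarith
  also have "\<dots> = (\<alpha>2 - \<alpha>1) * ((1 / real N + (m - 1) / 2) * T)" by (simp add: \<beta>_def algebra_simps)
  finally show ?thesis by (simp add: T_def)
qed

lemma trajectory_limit_0:
  assumes "\<alpha> > 0" "trajectory \<alpha> v"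
  shows "(v \<longlongrightarrow> 0) (at_right 0) \<or> (\<exists>c>0. \<forall>g>0. c \<le> v g)"
proof (cases "\<exists>c>0. \<forall>g>0. c \<le> v g")
  case False
  have "(v \<longlongrightarrow> 0) (at_right 0)"
  proof (rule order_tendstoI)
    fix a :: real assume "a < 0"
    then show "\<forall>\<^sub>F g in at_right 0. a < v g"
      using eventually_at_right_less[of "0::real"] trajectoryD(1)[OF assms(2)]
      by (auto elim!: eventually_mono intro: less_trans)
  next
    fix a :: real assume "a > 0"
    then obtain h where h: "h > 0" "v h < a" using False by (meson not_le)
    show "\<forall>\<^sub>F g in at_right 0. v g < a"
      unfolding eventually_at_right_field
      using h trajectory_mono[OF assms, of _ h] by (intro exI[of _ h]) force
  qed
  then show ?thesis by blast
qed simp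

text \<open>
  Where the forcing is small, the slope of the trajectory on and above the line \<open>v = \<epsilon> * g\<close> is at least
  \<open>\<epsilon>\<close>, so the sector below the line cannot be left as \<open>g\<close> decreases.
\<close>
lemma trajectory_trap:
  assumes T: "trajectory \<alpha> v" and \<epsilon>: "\<epsilon> > 0" and h: "v h \<le> \<epsilon> * h"
    and small: "\<And>g. 0 < g \<Longrightarrow> g \<le> h \<Longrightarrow> forcing g \<le> \<epsilon> * (\<beta> \<alpha> - \<epsilon>) * g"
    and g: "0 < g" "g \<le> h"
  shows "v g \<le> \<epsilon> * g"
proof (rule ccontr)
  assume less: "\<not> ?thesis"
  have "v g - \<epsilon> * g \<le> v h - \<epsilon> * h"
  proof (rule barrier_principle[where u = "\<lambda>x. v x - \<epsilon> * x", OF g(2)])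
    show "continuous_on {g..h} (\<lambda>x. v x - \<epsilon> * x)"
      by (intro continuous_intros trajectory_cont[OF T] g)
    fix x assume x: "g < x" "x < h"
    then have x0: "x > 0" using g by simp
    show "((\<lambda>x. v x - \<epsilon> * x) has_real_derivative slope \<alpha> x (v x) - \<epsilon>) (at x)"
      using trajectoryD(2)[OF T x0] by (auto intro!: derivative_eq_intros)
    assume above: "v x - \<epsilon> * x > 0"
    have "forcing x / v x \<le> forcing x / (\<epsilon> * x)"
      using above x0 \<epsilon> forcing_pos[OF x0] trajectoryD(1)[OF T x0]
      by (intro divide_left_mono) auto
    also have "\<dots> \<le> \<beta> \<alpha> - \<epsilon>" using small[OF x0] x \<epsilon> x0 by (simp add: field_simps)
    finally have "forcing x / v x \<le> \<beta> \<alpha> - \<epsilon>" .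
    moreover have "m * \<mu> * x powr (m - 1) \<ge> 0" using m \<mu>_pos by simp
    ultimately show "slope \<alpha> x (v x) - \<epsilon> \<ge> 0" by (simp add: slope_def)
  qed (use less in auto)
  then show False using less h by simp
qed

text \<open>
  This is where \<open>m + p > 2\<close> enters: the forcing is \<open>o(g)\<close>, so that a trajectory can leave the origin along
  a line.
\<close>
lemma forcing_near_0:
  assumes mp: "m + p > 2"
  shows "((\<lambda>g. forcing g / g) \<longlongrightarrow> 0) (at_right 0)"
proof -
  have "((\<lambda>g. m * \<nu> * g powr ((m - 1) + (m - 1)) + m * g powr ((m - 1) + (p - 1)))
      \<longlongrightarrow> m * \<nu> * 0 + m * 0) (at_right 0)"
    using m mp by (intro tendsto_intros tendsto_powr_at_right_0) auto
  moreover have "\<forall>\<^sub>F g in at_right 0. m * \<nu> * g powr ((m - 1) + (m - 1)) + m * g powr ((m - 1) + (p - 1))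
      = forcing g / g"
    using eventually_at_right_less[of "0::real"]
    unfolding powr_add by eventually_elim (simp add: forcing_def powr_diff field_simps)
  ultimately show ?thesis by (simp add: filterlim_cong)
qed

section \<open>The end of the trajectory at the origin and the critical exponent\<close>

definition traj :: "real \<Rightarrow> real \<Rightarrow> real" where "traj \<alpha> = (SOME v. trajectory \<alpha> v)"

text \<open>
  The derivative of \<open>f powr m\<close> at the zero of \<open>f\<close> is a negative multiple of the limit of \<open>v\<close> at \<open>0\<close>;
  so vanishing of this limit characterises the exponents that have a profile with interface.
\<close>
definition vanishing :: "real \<Rightarrow> bool" where
  "vanishing \<alpha> \<longleftrightarrow> (traj \<alpha> \<longlongrightarrow> 0) (at_right 0)"

lemma traj:
  assumes "\<alpha> > 0"
  shows "trajectory \<alpha> (traj \<alpha>)"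
proof -
  obtain v where "trajectory \<alpha> v" by (rule trajectory_exists[OF assms]) (rule that)
  then show ?thesis unfolding traj_def by (rule someI[of "trajectory \<alpha>"])
qed

lemma not_vanishing_iff:
  assumes "\<alpha> > 0"
  shows "\<not> vanishing \<alpha> \<longleftrightarrow> (\<exists>c>0. \<forall>g>0. c \<le> traj \<alpha> g)"
proof
  assume "\<exists>c>0. \<forall>g>0. c \<le> traj \<alpha> g"
  then obtain c where c: "c > 0" "\<And>g. g > 0 \<Longrightarrow> c \<le> traj \<alpha> g" by blast
  have "\<not> (\<forall>\<^sub>F g in at_right 0. traj \<alpha> g < c)"
  proof
    assume "\<forall>\<^sub>F g in at_right 0. traj \<alpha> g < c"
    then have "\<forall>\<^sub>F g in at_right (0 :: real). False"
      using eventually_at_right_less[of "0::real"] by eventually_elim (use c in force)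
    then show False by simp
  qed
  then show "\<not> vanishing \<alpha>" using order_tendstoD(2)[OF _ c(1), of "traj \<alpha>"] unfolding vanishing_def by auto
next
  assume "\<not> vanishing \<alpha>"
  then show "\<exists>c>0. \<forall>g>0. c \<le> traj \<alpha> g"
    using trajectory_limit_0[OF assms traj[OF assms]] unfolding vanishing_def by (elim disjE) (erule notE, assumption+)
qed

lemma vanishing_if_linear_bound:
  assumes "\<alpha> > 0" "h > 0" "\<And>g. 0 < g \<Longrightarrow> g \<le> h \<Longrightarrow> traj \<alpha> g \<le> \<epsilon> * g"
  shows "vanishing \<alpha>"
  unfolding vanishing_def
proof (rule tendsto_sandwich[of "\<lambda>_. 0"])
  show "\<forall>\<^sub>F g in at_right 0. 0 \<le> traj \<alpha> g"
    using eventually_at_right_less[of "0::real"]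
    by eventually_elim (simp add: trajectoryD(1)[OF traj[OF assms(1)]] less_imp_le)
  show "\<forall>\<^sub>F g in at_right 0. traj \<alpha> g \<le> \<epsilon> * g"
    unfolding eventually_at_right_field using assms by (intro exI[of _ h]) auto
  show "((\<lambda>g. \<epsilon> * g) \<longlongrightarrow> 0) (at_right 0)" by real_asymp
qed simp

lemma vanishing_mono:
  assumes "vanishing \<alpha>1" "0 < \<alpha>1" "\<alpha>1 \<le> \<alpha>2"
  shows "vanishing \<alpha>2"
proof (rule ccontr)
  assume "\<not> vanishing \<alpha>2"
  then obtain c where "c > 0" "\<forall>g>0. c \<le> traj \<alpha>2 g" using not_vanishing_iff[of \<alpha>2] assms by auto
  moreover have "traj \<alpha>2 g \<le> traj \<alpha>1 g" if "g > 0" for g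
    using trajectory_comparison[OF traj traj assms(3) that] assms by simp
  ultimately have "\<not> vanishing \<alpha>1"
    unfolding not_vanishing_iff[OF assms(2)] by (meson order_trans)
  then show False using assms by simp
qed

text \<open>
  For large \<open>\<alpha>\<close> the trajectory is below \<open>\<kappa>\<close> at \<open>g = 1\<close> and already caught in the sector of slope \<open>\<kappa>\<close>.
\<close>
lemma vanishing_large:
  assumes mp: "m + p > 2"
  shows "\<exists>\<alpha>>0. vanishing \<alpha>"
proof -
  define \<alpha> where "\<alpha> = max 1 (2 / (m - 1) * (m * (\<nu> + 1) / \<kappa> + \<kappa>))"
  have \<alpha>: "\<alpha> \<ge> 1" "\<alpha> > 0" by (auto simp: \<alpha>_def)
  have "(m - 1) / 2 * (2 / (m - 1) * x) = x" for x using m by simp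
  moreover have "(m - 1) / 2 * (2 / (m - 1) * (m * (\<nu> + 1) / \<kappa> + \<kappa>)) \<le> \<beta> \<alpha>"
    unfolding \<beta>_def using m by (intro mult_left_mono) (auto simp: \<alpha>_def)
  ultimately have "m * (\<nu> + 1) / \<kappa> + \<kappa> \<le> \<beta> \<alpha>" by metis
  then have \<beta>: "m * (\<nu> + 1) \<le> \<kappa> * (\<beta> \<alpha> - \<kappa>)" using \<kappa>_gt2 by (simp add: field_simps)
  have t1: "turning \<alpha> \<le> 1"
    using turning_antimono[of 1 \<alpha>] \<alpha> by (simp add: turning_def)
  have small: "forcing g \<le> \<kappa> * (\<beta> \<alpha> - \<kappa>) * g" if g: "0 < g" "g \<le> 1" for g
  proof -
    have "g powr (m - 1) * g powr m \<le> g powr 1" "g powr (m - 1) * g powr p \<le> g powr 1"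
      unfolding powr_add[symmetric] using g m mp by (intro powr_mono'; simp)+
    then have "\<nu> * (g powr (m - 1) * g powr m) + g powr (m - 1) * g powr p \<le> \<nu> * g + g"
      using \<nu>_pos g by (intro add_mono mult_left_mono) auto
    then have "m * (\<nu> * (g powr (m - 1) * g powr m) + g powr (m - 1) * g powr p) \<le> m * (\<nu> * g + g)"
      using m by (intro mult_left_mono) auto
    moreover have "m * (\<nu> + 1) * g \<le> \<kappa> * (\<beta> \<alpha> - \<kappa>) * g"
      using \<beta> g by (intro mult_right_mono) auto
    ultimately show ?thesis by (simp add: forcing_def algebra_simps)
  qed
  have "vanishing \<alpha>"
  proof (rule vanishing_if_linear_bound[OF \<alpha>(2)])
    have "traj \<alpha> 1 \<le> \<kappa> * 1" using trajectory_bounds(3)[OF \<alpha>(2) traj[OF \<alpha>(2)], of 1] t1 by simp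
    then show "traj \<alpha> g \<le> \<kappa> * g" if "0 < g" "g \<le> 1" for g
      using trajectory_trap[OF traj[OF \<alpha>(2)] _ _ small that] \<kappa>_gt2 by simp
  qed simp
  then show ?thesis using \<alpha> by blast
qed

text \<open>
  Suppose \<open>v\<close> vanishes at \<open>0\<close>. Then \<open>v \<le> \<beta> \<alpha> * g + \<mu> * g powr m\<close>, which makes the term \<open>forcing g / v\<close>
  at least of order \<open>g powr (p - 1)\<close> away from a neighbourhood of \<open>0\<close> that shrinks with \<open>\<alpha>\<close>. Integrating,
  \<open>v\<close> becomes negative at a fixed small \<open>h\<close>.
\<close>
lemma not_vanishing_small: "\<exists>\<alpha>0>0. \<forall>\<alpha>. 0 < \<alpha> \<and> \<alpha> < \<alpha>0 \<longrightarrow> \<not> vanishing \<alpha>"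
proof -
  define K where "K = m / (2 * \<mu> * p)"
  have K: "K > 0" using m \<mu>_pos p0 by (simp add: K_def)
  \<comment> \<open>Near \<open>0\<close> the forcing contributes \<open>K * g powr p\<close>, which beats \<open>\<mu> * g powr m\<close> because \<open>p < m\<close>;
    at \<open>h\<close> the latter is a quarter of the former.\<close>
  define h where "h = (K / (4 * \<mu>)) powr (1 / (m - p))"
  have h: "h > 0" using K \<mu>_pos by (simp add: h_def)
  have mp: "m - p > 0" using m p1 by simp
  have "\<mu> * h powr m = \<mu> * (h powr p * h powr (m - p))" by (simp add: powr_add[symmetric])
  also have "h powr (m - p) = K / (4 * \<mu>)" using K \<mu>_pos mp by (simp add: h_def powr_powr)
  finally have h_eq: "\<mu> * h powr m = K / 4 * h powr p" using \<mu>_pos by simp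
  \<comment> \<open>Beyond \<open>sw \<alpha>\<close> the term \<open>\<mu> * g powr m\<close> dominates \<open>\<beta> \<alpha> * g\<close>, and \<open>sw \<alpha>\<close> tends to \<open>0\<close>
    with \<open>\<alpha>\<close>, so that the forcing acts on nearly all of \<open>(0, h]\<close>.\<close>
  define sw where "sw = (\<lambda>\<alpha>. (\<beta> \<alpha> / \<mu>) powr (1 / (m - 1)))"
  have sw_lim: "(sw \<longlongrightarrow> 0) (at_right 0)"
    unfolding sw_def \<beta>_def using m \<mu>_pos by real_asymp
  have "((\<lambda>\<alpha>. \<beta> \<alpha> * h + K * sw \<alpha> powr p) \<longlongrightarrow> 0 * h + K * 0) (at_right 0)"
  proof (intro tendsto_intros)
    show "(\<beta> \<longlongrightarrow> 0) (at_right 0)" unfolding \<beta>_def using m by real_asymp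
    show "((\<lambda>\<alpha>. sw \<alpha> powr p) \<longlongrightarrow> 0) (at_right 0)"
      unfolding sw_def \<beta>_def powr_powr using m \<mu>_pos p0 by real_asymp
  qed
  then have "\<forall>\<^sub>F \<alpha> in at_right 0. \<beta> \<alpha> * h + K * sw \<alpha> powr p < 3 / 4 * K * h powr p"
    using K h by (intro order_tendstoD(2)) auto
  moreover have "\<forall>\<^sub>F \<alpha> in at_right 0. sw \<alpha> < h" using sw_lim h by (rule order_tendstoD(2))
  ultimately have "\<forall>\<^sub>F \<alpha> in at_right 0. sw \<alpha> < h \<and> \<beta> \<alpha> * h + K * sw \<alpha> powr p < 3 / 4 * K * h powr p"
    by eventually_elim simp
  then obtain \<alpha>0 where \<alpha>0: "\<alpha>0 > 0" "\<And>\<alpha>. 0 < \<alpha> \<Longrightarrow> \<alpha> < \<alpha>0 \<Longrightarrow>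
      sw \<alpha> < h \<and> \<beta> \<alpha> * h + K * sw \<alpha> powr p < 3 / 4 * K * h powr p"
    by (auto simp: eventually_at_right_field)
  have "\<not> vanishing \<alpha>" if \<alpha>: "0 < \<alpha>" "\<alpha> < \<alpha>0" for \<alpha>
  proof
    assume van: "vanishing \<alpha>"
    note T = traj[OF \<alpha>(1)]
    define v where "v = traj \<alpha>"
    have vpos: "v x > 0" and dv: "(v has_real_derivative slope \<alpha> x (v x)) (at x)" if "x > 0" for x
      using trajectoryD[OF T that] by (auto simp: v_def)
    have below: "v g \<le> \<beta> \<alpha> * g + \<mu> * g powr m" if g: "g > 0" for g
    proof -
      define U where "U = (\<lambda>x. v x - \<beta> \<alpha> * x - \<mu> * x powr m)"
      have dec: "U g \<le> U x" if x: "0 < x" "x \<le> g" for x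
      proof (rule DERIV_nonpos_imp_nonincreasing[where f = U, OF x(2)])
        fix y assume "x \<le> y" "y \<le> g"
        then have y: "y > 0" using x by simp
        have "(U has_real_derivative slope \<alpha> y (v y) - \<beta> \<alpha> - \<mu> * (m * y powr (m - 1))) (at y)"
          unfolding U_def using y by (auto intro!: derivative_eq_intros dv)
        moreover have "slope \<alpha> y (v y) - \<beta> \<alpha> - \<mu> * (m * y powr (m - 1)) \<le> 0"
          using forcing_pos[OF y] vpos[OF y] by (simp add: slope_def)
        ultimately show "\<exists>z. (U has_real_derivative z) (at y) \<and> z \<le> 0" by blast
      qed
      have "(U \<longlongrightarrow> 0 - \<beta> \<alpha> * 0 - \<mu> * 0) (at_right 0)"
        unfolding U_def
        using van m by (intro tendsto_intros tendsto_powr_at_right_0) (auto simp: vanishing_def v_def)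
      moreover have "\<forall>\<^sub>F x in at_right 0. U g \<le> U x"
        unfolding eventually_at_right_field using g dec by (intro exI[of _ g]) auto
      ultimately have "U g \<le> 0" by (intro tendsto_lowerbound[of U]) auto
      then show ?thesis by (simp add: U_def)
    qed
    define s where "s = sw \<alpha>"
    have s: "0 < s" "s < h" and sh: "\<beta> \<alpha> * h + K * s powr p < 3 / 4 * K * h powr p"
      using \<alpha>0(2)[OF \<alpha>] \<beta>_pos[OF \<alpha>(1)] \<mu>_pos by (auto simp: s_def sw_def)
    define U where "U = (\<lambda>x. v x - \<beta> \<alpha> * x - \<mu> * x powr m + K * x powr p)"
    have "U h \<le> U s"
    proof (rule DERIV_nonpos_imp_nonincreasing[where f = U])
      fix y assume y: "s \<le> y" "y \<le> h"
      then have y0: "y > 0" using s by simp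
      have dU: "(U has_real_derivative slope \<alpha> y (v y) - \<beta> \<alpha> - \<mu> * (m * y powr (m - 1)) + K * (p * y powr (p - 1))) (at y)"
        unfolding U_def using y0 by (auto intro!: derivative_eq_intros dv)
      have "\<beta> \<alpha> / \<mu> = s powr (m - 1)"
        using m \<beta>_pos[OF \<alpha>(1)] \<mu>_pos by (simp add: s_def sw_def powr_powr)
      also have "\<dots> \<le> y powr (m - 1)" using m y s by (intro powr_mono2) auto
      finally have "\<beta> \<alpha> \<le> \<mu> * y powr (m - 1)" using \<mu>_pos by (simp add: field_simps)
      then have "\<beta> \<alpha> * y \<le> \<mu> * y powr (m - 1) * y" using y0 by (intro mult_right_mono) auto
      then have "\<beta> \<alpha> * y \<le> \<mu> * y powr m" using y0 by (simp add: powr_diff)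
      then have vy: "v y \<le> 2 * \<mu> * y powr m" using below[OF y0] by simp
      have "K * (p * y powr (p - 1)) = m * y powr (m - 1) * y powr p / (2 * \<mu> * y powr m)"
        using y0 p0 \<mu>_pos by (simp add: K_def powr_diff)
      also have "\<dots> \<le> forcing y / (2 * \<mu> * y powr m)"
        unfolding forcing_def using m \<mu>_pos \<nu>_pos y0 by (intro divide_right_mono mult_left_mono) auto
      also have "\<dots> \<le> forcing y / v y"
        using vy vpos[OF y0] forcing_pos[OF y0] y0 \<mu>_pos by (intro divide_left_mono) auto
      finally have "slope \<alpha> y (v y) - \<beta> \<alpha> - \<mu> * (m * y powr (m - 1)) + K * (p * y powr (p - 1)) \<le> 0"
        by (simp add: slope_def)
      then show "\<exists>z. (U has_real_derivative z) (at y) \<and> z \<le> 0" using dU by blast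
    qed (use s in auto)
    also have "U s \<le> K * s powr p" using below[OF s(1)] by (simp add: U_def)
    finally have "v h - \<beta> \<alpha> * h - K / 4 * h powr p + K * h powr p \<le> K * s powr p"
      by (simp add: U_def h_eq)
    then show False using vpos[OF h] sh by (simp add: algebra_simps)
  qed
  then show ?thesis using \<alpha>0(1) by blast
qed

lemma nullcline_near_0:
  assumes "\<alpha> > 0"
  shows "((\<lambda>g. nullcline \<alpha> g / g powr (m + p - 1)) \<longlongrightarrow> m / \<beta> \<alpha>) (at_right 0)"
proof -
  have "((\<lambda>g. (m * (1 + \<nu> * g powr (m - p))) / (m * \<mu> * g powr (m - 1) + \<beta> \<alpha>))
      \<longlongrightarrow> (m * (1 + \<nu> * 0)) / (m * \<mu> * 0 + \<beta> \<alpha>)) (at_right 0)"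
    using m p1 \<beta>_pos[OF assms] by (intro tendsto_intros tendsto_powr_at_right_0) auto
  moreover have "\<forall>\<^sub>F g in at_right 0. (m * (1 + \<nu> * g powr (m - p))) / (m * \<mu> * g powr (m - 1) + \<beta> \<alpha>)
      = nullcline \<alpha> g / g powr (m + p - 1)"
    using eventually_at_right_less[of "0::real"]
  proof eventually_elim
    case (elim g)
    then have eq: "forcing g / g powr (m + p - 1) = m * (1 + \<nu> * g powr (m - p))"
      by (simp add: forcing_def powr_diff powr_add field_simps)
    have "nullcline \<alpha> g / g powr (m + p - 1)
        = forcing g / g powr (m + p - 1) / (m * \<mu> * g powr (m - 1) + \<beta> \<alpha>)"
      by (simp add: nullcline_def mult.commute)
    then show ?case by (simp only: eq)
  qed
  ultimately show ?thesis by (simp add: filterlim_cong)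
qed

text \<open>
  The two ways for a trajectory to reach the origin: tangentially to the line of slope \<open>\<beta> \<alpha>\<close>, which
  gives an interface of Type I, or along the nullcline, which gives Type II.
\<close>
definition linear_end :: "real \<Rightarrow> bool" where
  "linear_end \<alpha> \<longleftrightarrow> ((\<lambda>g. traj \<alpha> g / g) \<longlongrightarrow> \<beta> \<alpha>) (at_right 0)"

definition sublinear_end :: "real \<Rightarrow> bool" where
  "sublinear_end \<alpha> \<longleftrightarrow> ((\<lambda>g. traj \<alpha> g / g powr (m + p - 1)) \<longlongrightarrow> m / \<beta> \<alpha>) (at_right 0)"

lemma small_forcing:
  assumes "m + p > 2" "c > 0"
  shows "\<exists>h>0. \<forall>g. 0 < g \<and> g \<le> h \<longrightarrow> forcing g \<le> c * g"
proof -
  have "\<forall>\<^sub>F g in at_right 0. forcing g / g < c"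
    using forcing_near_0[OF assms(1)] assms(2) by (rule order_tendstoD(2))
  then obtain h where h: "h > 0" "\<And>g. 0 < g \<Longrightarrow> g < h \<Longrightarrow> forcing g / g < c"
    by (auto simp: eventually_at_right_field)
  show ?thesis
  proof (intro exI[of _ "h / 2"] conjI allI impI)
    fix g assume "0 < g \<and> g \<le> h / 2"
    then show "forcing g \<le> c * g" using h(2)[of g] h(1) by (simp add: pos_divide_less_eq)
  qed (use h in auto)
qed

text \<open>
  A linear lower bound makes \<open>forcing g / v\<close> negligible, so that \<open>v'\<close> tends to \<open>\<beta> \<alpha>\<close>.
\<close>
lemma linear_end_if_linear_lower_bound:
  assumes mp: "m + p > 2" and \<alpha>: "\<alpha> > 0" and van: "vanishing \<alpha>" and \<epsilon>: "\<epsilon> > 0"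
    and above: "\<forall>\<^sub>F g in at_right 0. \<epsilon> * g < traj \<alpha> g"
  shows "linear_end \<alpha>"
proof -
  note T = traj[OF \<alpha>]
  have "((\<lambda>g. forcing g / traj \<alpha> g) \<longlongrightarrow> 0) (at_right 0)"
  proof (rule tendsto_sandwich[of "\<lambda>_. 0"])
    show "\<forall>\<^sub>F g in at_right 0. 0 \<le> forcing g / traj \<alpha> g"
      using eventually_at_right_less[of "0::real"]
      by eventually_elim (simp add: trajectoryD(1)[OF T] forcing_pos less_imp_le)
    show "\<forall>\<^sub>F g in at_right 0. forcing g / traj \<alpha> g \<le> forcing g / g / \<epsilon>"
      using above eventually_at_right_less[of "0::real"]
    proof eventually_elim
      case (elim g)
      then have "forcing g / traj \<alpha> g \<le> forcing g / (\<epsilon> * g)"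
        using forcing_pos[of g] trajectoryD(1)[OF T, of g] \<epsilon> by (intro divide_left_mono) auto
      then show ?case by (simp add: mult.commute)
    qed
    show "((\<lambda>g. forcing g / g / \<epsilon>) \<longlongrightarrow> 0) (at_right 0)"
      using tendsto_divide[OF forcing_near_0[OF mp] tendsto_const[of \<epsilon>]] \<epsilon> by simp
  qed simp
  then have "((\<lambda>g. slope \<alpha> g (traj \<alpha> g)) \<longlongrightarrow> m * \<mu> * 0 + \<beta> \<alpha> - 0) (at_right 0)"
    unfolding slope_def using m by (intro tendsto_intros tendsto_powr_at_right_0) auto
  then have lim: "((\<lambda>g. slope \<alpha> g (traj \<alpha> g) / 1) \<longlongrightarrow> \<beta> \<alpha>) (at_right 0)" by simp
  have pos: "\<forall>\<^sub>F g::real in at_right 0. g > 0" by (rule eventually_at_right_less)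
  show ?thesis
    unfolding linear_end_def
  proof (rule lhopital_right_0[where g' = "\<lambda>_. 1" and f' = "\<lambda>g. slope \<alpha> g (traj \<alpha> g)"])
    show "(traj \<alpha> \<longlongrightarrow> 0) (at_right 0)" using van by (simp add: vanishing_def)
    show "\<forall>\<^sub>F g in at_right 0. (traj \<alpha> has_real_derivative slope \<alpha> g (traj \<alpha> g)) (at g)"
      using pos by eventually_elim (rule trajectoryD(2)[OF T])
    show "\<forall>\<^sub>F g::real in at_right 0. g \<noteq> 0" using pos by eventually_elim simp
  qed (use lim in \<open>auto intro!: tendsto_intros\<close>)
qed

text \<open>
  The trajectory lies above the nullcline, which behaves like \<open>m / \<beta> \<alpha> * g powr (m + p - 1)\<close>. Above a
  curve with a larger constant the slope is bounded below by some \<open>c > 0\<close>; staying there would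
  contradict \<open>v = o(g)\<close>, and once below the curve the trajectory remains below as \<open>g\<close> decreases.
\<close>
lemma sublinear_end_if_small:
  assumes \<alpha>: "\<alpha> > 0" and van: "vanishing \<alpha>" and mp: "m + p > 2"
    and small: "((\<lambda>g. traj \<alpha> g / g) \<longlongrightarrow> 0) (at_right 0)"
  shows "sublinear_end \<alpha>"
  unfolding sublinear_end_def
proof (rule order_tendstoI)
  note T = traj[OF \<alpha>]
  fix a assume "a < m / \<beta> \<alpha>"
  then have "\<forall>\<^sub>F g in at_right 0. a < nullcline \<alpha> g / g powr (m + p - 1)"
    using nullcline_near_0[OF \<alpha>] by (intro order_tendstoD(1))
  then show "\<forall>\<^sub>F g in at_right 0. a < traj \<alpha> g / g powr (m + p - 1)"
    using eventually_at_right_less[of "0::real"]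
  proof eventually_elim
    case (elim g)
    then show ?case
      using trajectory_bounds(1)[OF \<alpha> T, of g] divide_right_mono[of "nullcline \<alpha> g" "traj \<alpha> g" "g powr (m + p - 1)"]
      by simp
  qed
next
  note T = traj[OF \<alpha>]
  have \<beta>0: "\<beta> \<alpha> > 0" by (rule \<beta>_pos[OF \<alpha>])
  fix a assume a: "m / \<beta> \<alpha> < a"
  define n where "n = m + p - 1"
  have n: "n > 1" using mp by (simp add: n_def)
  have "0 < m / \<beta> \<alpha>" using m \<beta>0 by simp
  then obtain l where l: "m / \<beta> \<alpha> < l" "l < a" "0 < l" using dense[OF a] by force
  define X where "X = m / l"
  define c where "c = (\<beta> \<alpha> - X) / 2"
  have "X < \<beta> \<alpha>" using l \<beta>0 by (simp add: X_def field_simps)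
  then have c: "c > 0" "X < \<beta> \<alpha> - c" by (auto simp: c_def field_simps)
  have "((\<lambda>g. m * (1 + \<nu> * g powr (m - p)) / l) \<longlongrightarrow> m * (1 + \<nu> * 0) / l) (at_right 0)"
    using m p1 l by (intro tendsto_intros tendsto_powr_at_right_0) auto
  then have "\<forall>\<^sub>F g in at_right 0. m * (1 + \<nu> * g powr (m - p)) / l < \<beta> \<alpha> - c"
  proof (rule order_tendstoD(2))
    show "m * (1 + \<nu> * 0) / l < \<beta> \<alpha> - c" using c(2) by (simp add: X_def)
  qed
  moreover have "((\<lambda>g. l * (n * g powr (n - 1))) \<longlongrightarrow> l * (n * 0)) (at_right 0)"
    using n by (intro tendsto_intros tendsto_powr_at_right_0) auto
  then have "\<forall>\<^sub>F g in at_right 0. l * (n * g powr (n - 1)) < c"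
    using c(1) by (intro order_tendstoD(2)) auto
  moreover have "\<forall>\<^sub>F g in at_right 0. traj \<alpha> g / g < c"
    using small c(1) by (rule order_tendstoD(2))
  ultimately have "\<forall>\<^sub>F g in at_right 0. m * (1 + \<nu> * g powr (m - p)) / l < \<beta> \<alpha> - c \<and>
      l * (n * g powr (n - 1)) < c \<and> traj \<alpha> g / g < c"
    by eventually_elim simp
  then obtain h where h: "h > 0" "\<And>g. 0 < g \<Longrightarrow> g < h \<Longrightarrow> m * (1 + \<nu> * g powr (m - p)) / l < \<beta> \<alpha> - c \<and>
      l * (n * g powr (n - 1)) < c \<and> traj \<alpha> g / g < c"
    by (auto simp: eventually_at_right_field)
  have steep: "slope \<alpha> g (traj \<alpha> g) \<ge> c" if g: "0 < g" "g < h" and above: "traj \<alpha> g > l * g powr n" for g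
  proof -
    have "forcing g / traj \<alpha> g \<le> forcing g / (l * g powr n)"
      using above forcing_pos[OF g(1)] trajectoryD(1)[OF T g(1)] l g by (intro divide_left_mono) auto
    also have "\<dots> = m * (1 + \<nu> * g powr (m - p)) / l"
      using g l(3) by (simp add: forcing_def n_def powr_diff powr_add field_simps)
    finally have "forcing g / traj \<alpha> g < \<beta> \<alpha> - c" using h(2)[OF g] by linarith
    moreover have "m * \<mu> * g powr (m - 1) \<ge> 0" using m \<mu>_pos by simp
    ultimately show ?thesis by (simp add: slope_def)
  qed
  have stays: "traj \<alpha> x > l * x powr n" if g: "0 < g" "traj \<alpha> g > l * g powr n" and x: "g \<le> x" "x < h" for g x
  proof -
    have "traj \<alpha> g - l * g powr n \<le> traj \<alpha> x - l * x powr n"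
    proof (rule barrier_principle[where u = "\<lambda>x. traj \<alpha> x - l * x powr n", OF x(1)])
      show "continuous_on {g..x} (\<lambda>x. traj \<alpha> x - l * x powr n)"
        using g by (intro continuous_intros trajectory_cont[OF T]) auto
      fix y assume y: "g < y" "y < x"
      then have y0: "0 < y" "y < h" using g x by auto
      show "((\<lambda>x. traj \<alpha> x - l * x powr n) has_real_derivative
          slope \<alpha> y (traj \<alpha> y) - l * (n * y powr (n - 1))) (at y)"
        using trajectoryD(2)[OF T y0(1)] y0 by (auto intro!: derivative_eq_intros)
      assume "traj \<alpha> y - l * y powr n > 0"
      then show "slope \<alpha> y (traj \<alpha> y) - l * (n * y powr (n - 1)) \<ge> 0"
        using steep[OF y0] h(2)[OF y0] by simp
    qed (use g in auto)
    then show ?thesis using g by simp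
  qed
  have "\<exists>g0. 0 < g0 \<and> g0 < h \<and> (\<forall>g. 0 < g \<and> g < g0 \<longrightarrow> traj \<alpha> g \<le> l * g powr n)"
  proof (rule ccontr)
    assume none: "\<not> ?thesis"
    have all: "traj \<alpha> x > l * x powr n" if x: "0 < x" "x < h" for x
    proof -
      obtain g where "0 < g" "g < x" "traj \<alpha> g > l * g powr n"
        using none x by (meson not_le)
      then show ?thesis using stays[of g x] x by simp
    qed
    \<comment> \<open>If the trajectory stayed above \<open>l * g powr n\<close>, its slope would stay above \<open>c\<close>, and it would
    lie above the line \<open>c * g\<close>, which \<open>small\<close> forbids.\<close>
  define y where "y = h / 2"
    have y: "0 < y" "y < h" using h by (auto simp: y_def)
    have inc: "traj \<alpha> x - c * x \<le> traj \<alpha> y - c * y" if x: "0 < x" "x \<le> y" for x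
    proof (rule DERIV_nonneg_imp_nondecreasing[where f = "\<lambda>x. traj \<alpha> x - c * x", OF x(2)])
      fix z assume "x \<le> z" "z \<le> y"
      then have z: "0 < z" "z < h" using x y by auto
      have "((\<lambda>x. traj \<alpha> x - c * x) has_real_derivative slope \<alpha> z (traj \<alpha> z) - c) (at z)"
        using trajectoryD(2)[OF T z(1)] by (auto intro!: derivative_eq_intros)
      moreover have "slope \<alpha> z (traj \<alpha> z) - c \<ge> 0" using steep[OF z all[OF z]] by simp
      ultimately show "\<exists>d. ((\<lambda>x. traj \<alpha> x - c * x) has_real_derivative d) (at z) \<and> 0 \<le> d" by blast
    qed
    have "((\<lambda>x. traj \<alpha> x - c * x) \<longlongrightarrow> 0 - c * 0) (at_right 0)"
      using van unfolding vanishing_def by (intro tendsto_intros)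
    moreover have "\<forall>\<^sub>F x in at_right 0. traj \<alpha> x - c * x \<le> traj \<alpha> y - c * y"
      unfolding eventually_at_right_field using y inc by (intro exI[of _ y]) auto
    ultimately have "0 - c * 0 \<le> traj \<alpha> y - c * y" by (intro tendsto_upperbound) auto
    then show False using h(2)[OF y] y by (simp add: pos_divide_less_eq)
  qed
  then obtain g0 where g0: "g0 > 0" "\<And>g. 0 < g \<Longrightarrow> g < g0 \<Longrightarrow> traj \<alpha> g \<le> l * g powr n" by blast
  show "\<forall>\<^sub>F g in at_right 0. traj \<alpha> g / g powr (m + p - 1) < a"
    unfolding eventually_at_right_field
  proof (intro exI[of _ g0] conjI allI impI)
    fix g assume g: "0 < g" "g < g0"
    have "traj \<alpha> g / g powr n \<le> l" using g0(2)[OF g] g by (simp add: pos_divide_le_eq)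
    then show "traj \<alpha> g / g powr (m + p - 1) < a" using l by (simp add: n_def)
  qed (use g0 in auto)
qed

text \<open>
  Either the trajectory eventually stays above some line, or it falls below lines of arbitrarily
  small slope, where it is trapped.
\<close>
lemma end_dichotomy:
  assumes mp: "m + p > 2" and \<alpha>: "\<alpha> > 0" and van: "vanishing \<alpha>"
  shows "linear_end \<alpha> \<or> (sublinear_end \<alpha> \<and> ((\<lambda>g. traj \<alpha> g / g) \<longlongrightarrow> 0) (at_right 0))"
proof (cases "\<exists>\<epsilon>>0. \<forall>\<^sub>F g in at_right 0. \<epsilon> * g < traj \<alpha> g")
  case True
  then show ?thesis using linear_end_if_linear_lower_bound[OF mp \<alpha> van] by blast
next
  case False
  note T = traj[OF \<alpha>]
  have "((\<lambda>g. traj \<alpha> g / g) \<longlongrightarrow> 0) (at_right 0)"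
  proof (rule order_tendstoI)
    fix a :: real assume "a < 0"
    show "\<forall>\<^sub>F g in at_right 0. a < traj \<alpha> g / g"
      using eventually_at_right_less[of "0::real"]
    proof eventually_elim
      case (elim g)
      then have "0 < traj \<alpha> g / g" using trajectoryD(1)[OF T] by simp
      then show ?case using \<open>a < 0\<close> by simp
    qed
  next
    fix a :: real assume a: "a > 0"
    define \<epsilon> where "\<epsilon> = min a (\<beta> \<alpha>) / 2"
    have \<epsilon>: "0 < \<epsilon>" "\<epsilon> < a" "\<epsilon> < \<beta> \<alpha>" using a \<beta>_pos[OF \<alpha>] by (auto simp: \<epsilon>_def)
    obtain h where h: "h > 0" "\<And>g. 0 < g \<Longrightarrow> g \<le> h \<Longrightarrow> forcing g \<le> \<epsilon> * (\<beta> \<alpha> - \<epsilon>) * g"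
      using small_forcing[OF mp, of "\<epsilon> * (\<beta> \<alpha> - \<epsilon>)"] \<epsilon> by auto
    have "\<not> (\<forall>g. 0 < g \<and> g < h \<longrightarrow> \<epsilon> * g < traj \<alpha> g)"
      using False \<epsilon>(1) h(1) unfolding eventually_at_right_field by blast
    then obtain g1 where g1: "0 < g1" "g1 < h" "traj \<alpha> g1 \<le> \<epsilon> * g1" by (meson not_le)
    show "\<forall>\<^sub>F g in at_right 0. traj \<alpha> g / g < a"
      unfolding eventually_at_right_field
    proof (intro exI[of _ g1] conjI allI impI)
      fix g assume g: "0 < g" "g < g1"
      have "traj \<alpha> g \<le> \<epsilon> * g"
        by (rule trajectory_trap[OF T \<epsilon>(1) g1(3)]) (use h g g1 in auto)
      then have "traj \<alpha> g / g \<le> \<epsilon>" using g by (simp add: pos_divide_le_eq)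
      then show "traj \<alpha> g / g < a" using \<epsilon> by simp
    qed (use g1 in auto)
  qed
  then show ?thesis using sublinear_end_if_small[OF \<alpha> van mp] by blast
qed

text \<open>
  The critical exponent is the supremum of the exponents for which \<open>v\<close> does not vanish at \<open>0\<close>. By
  Lipschitz dependence on \<open>\<alpha>\<close>, a positive limit at the critical exponent would persist slightly above it,
  and a sublinear end would persist slightly below it, because the trap is an open condition. So the
  critical trajectory has a linear end. No larger exponent has one: its trajectory would be lower but
  leave the origin with the larger slope \<open>\<beta> \<alpha>\<close>.
\<close>
lemma critical_trajectory:
  assumes mp: "m + p > 2"
  obtains \<alpha>s where "\<alpha>s > 0" and "\<And>\<alpha>. \<alpha> \<ge> \<alpha>s \<Longrightarrow> vanishing \<alpha>"
    and "\<And>\<alpha>. 0 < \<alpha> \<Longrightarrow> \<alpha> < \<alpha>s \<Longrightarrow> \<not> vanishing \<alpha>"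
    and "linear_end \<alpha>s" and "\<And>\<alpha>. \<alpha> > \<alpha>s \<Longrightarrow> sublinear_end \<alpha>"
proof -
  define S where "S = {\<alpha>. 0 < \<alpha> \<and> \<not> vanishing \<alpha>}"
  obtain \<alpha>0 where \<alpha>0: "\<alpha>0 > 0" "\<And>\<alpha>. 0 < \<alpha> \<Longrightarrow> \<alpha> < \<alpha>0 \<Longrightarrow> \<not> vanishing \<alpha>"
    using not_vanishing_small by blast
  obtain \<alpha>1 where \<alpha>1: "\<alpha>1 > 0" "vanishing \<alpha>1" using vanishing_large[OF mp] by blast
  have half: "\<alpha>0 / 2 \<in> S" using \<alpha>0 by (simp add: S_def)
  have "\<alpha> \<le> \<alpha>1" if "\<alpha> \<in> S" for \<alpha>
    using vanishing_mono[OF \<alpha>1(2,1), of \<alpha>] that by (cases "\<alpha>1 \<le> \<alpha>") (auto simp: S_def)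
  then have bdd: "bdd_above S" by (auto simp: bdd_above_def)
  define \<alpha>s where "\<alpha>s = Sup S"
  have pos: "\<alpha>s > 0" using cSup_upper[OF half bdd] \<alpha>0(1) by (simp add: \<alpha>s_def)
  have below: "\<not> vanishing \<alpha>" if \<alpha>: "0 < \<alpha>" "\<alpha> < \<alpha>s" for \<alpha>
  proof -
    obtain \<alpha>' where "\<alpha>' \<in> S" "\<alpha> < \<alpha>'"
      using \<alpha>(2) half bdd unfolding \<alpha>s_def by (metis empty_iff less_cSup_iff)
    then show ?thesis using vanishing_mono[OF _ \<alpha>(1), of \<alpha>'] by (auto simp: S_def)
  qed
  have above: "vanishing \<alpha>" if \<alpha>: "\<alpha> > \<alpha>s" for \<alpha>
  proof (rule ccontr)
    assume "\<not> vanishing \<alpha>"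
    then have "\<alpha> \<in> S" using \<alpha> pos by (simp add: S_def)
    from cSup_upper[OF this bdd] show False using \<alpha> by (simp add: \<alpha>s_def)
  qed
  have crit: "vanishing \<alpha>s"
  proof (rule ccontr)
    assume "\<not> vanishing \<alpha>s"
    then obtain c where c: "c > 0" "\<And>g. g > 0 \<Longrightarrow> c \<le> traj \<alpha>s g" using not_vanishing_iff[OF pos] by blast
    define D where "D = (1 / real N + (m - 1) / 2) * turning \<alpha>s"
    have D: "D > 0" using N_real m turning_pos[OF pos] by (auto simp: D_def intro!: mult_pos_pos add_pos_pos)
    define \<alpha> where "\<alpha> = \<alpha>s + c / (2 * D)"
    have \<alpha>: "\<alpha> > \<alpha>s" "\<alpha> > 0" using c D pos by (auto simp: \<alpha>_def add_pos_pos)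
    have bnd: "c / 2 \<le> traj \<alpha> g" if g: "0 < g" "g \<le> turning \<alpha>s" for g
    proof -
      have "traj \<alpha>s g - traj \<alpha> g \<le> (\<alpha> - \<alpha>s) * D"
        unfolding D_def by (rule trajectory_gap_near[OF traj traj]) (use pos \<alpha> g in auto)
      also have "\<dots> = c / 2" using D by (simp add: \<alpha>_def)
      finally show ?thesis using c(2)[OF g(1)] by simp
    qed
    have "c / 2 \<le> traj \<alpha> g" if g: "0 < g" for g
    proof (cases "g \<le> turning \<alpha>s")
      case False
      then have "traj \<alpha> (turning \<alpha>s) \<le> traj \<alpha> g"
        using trajectory_mono[OF \<alpha>(2) traj[OF \<alpha>(2)], of "turning \<alpha>s" g] turning_pos[OF pos] by simp
      then show ?thesis using bnd[of "turning \<alpha>s"] turning_pos[OF pos] by simp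
    qed (use bnd g in blast)
    then have "\<not> vanishing \<alpha>" unfolding not_vanishing_iff[OF \<alpha>(2)] using c(1) half_gt_zero by blast
    then show False using above \<alpha> by blast
  qed
  have "linear_end \<alpha>s"
  proof (rule ccontr)
    assume "\<not> linear_end \<alpha>s"
    then have small: "((\<lambda>g. traj \<alpha>s g / g) \<longlongrightarrow> 0) (at_right 0)"
      using end_dichotomy[OF mp pos crit] by blast
    define \<epsilon> where "\<epsilon> = \<beta> (\<alpha>s / 2) / 2"
    have \<beta>2: "\<beta> (\<alpha>s / 2) > 0" using \<beta>_pos pos by simp
    have \<epsilon>: "\<epsilon> > 0" using \<beta>2 by (simp add: \<epsilon>_def)
    obtain h where h: "h > 0" "\<And>g. 0 < g \<Longrightarrow> g \<le> h \<Longrightarrow> forcing g \<le> \<epsilon> * \<epsilon> * g"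
      using small_forcing[OF mp, of "\<epsilon> * \<epsilon>"] \<epsilon> by auto
    define T where "T = turning (\<alpha>s / 2)"
    have T: "T > 0" using turning_pos pos by (simp add: T_def)
    have "\<forall>\<^sub>F g in at_right 0. traj \<alpha>s g / g < \<epsilon>" using small \<epsilon> by (rule order_tendstoD(2))
    moreover have "\<forall>\<^sub>F g in at_right 0. g < min h T"
      unfolding eventually_at_right_field using h T by (intro exI[of _ "min h T"]) auto
    moreover have "\<forall>\<^sub>F g::real in at_right 0. g > 0" by (rule eventually_at_right_less)
    ultimately have "\<forall>\<^sub>F g in at_right 0. traj \<alpha>s g / g < \<epsilon> \<and> g < min h T \<and> g > 0"
      by eventually_elim simp
    then obtain g1 where g1: "traj \<alpha>s g1 / g1 < \<epsilon>" "g1 < h" "g1 < T" "g1 > 0"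
      using eventually_happens'[OF trivial_limit_at_right_real] by fastforce
    define gap where "gap = \<epsilon> * g1 - traj \<alpha>s g1"
    have gap: "gap > 0" using g1 by (simp add: gap_def pos_divide_less_eq)
    define D where "D = (1 / real N + (m - 1) / 2) * T"
    have D: "D > 0" using N_real m T by (auto simp: D_def intro!: mult_pos_pos add_pos_pos)
    define \<alpha> where "\<alpha> = \<alpha>s - min (\<alpha>s / 2) (gap / D)"
    have \<alpha>: "\<alpha>s / 2 \<le> \<alpha>" "\<alpha> < \<alpha>s" "\<alpha> > 0" "\<alpha>s - \<alpha> \<le> gap / D"
    proof -
      have "min (\<alpha>s / 2) (gap / D) > 0" using pos gap D by simp
      then show "\<alpha> < \<alpha>s" by (simp add: \<alpha>_def)
      show half: "\<alpha>s / 2 \<le> \<alpha>" using min.cobounded1[of "\<alpha>s / 2" "gap / D"] unfolding \<alpha>_def by linarith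
      show "\<alpha> > 0" using half pos by linarith
      show "\<alpha>s - \<alpha> \<le> gap / D" by (simp add: \<alpha>_def)
    qed
    have "traj \<alpha> g1 - traj \<alpha>s g1 \<le> (\<alpha>s - \<alpha>) * D"
      unfolding D_def T_def by (rule trajectory_gap_near[OF traj traj]) (use pos \<alpha> g1 in \<open>auto simp: T_def\<close>)
    also have "\<dots> \<le> gap / D * D" using \<alpha>(4) D by (intro mult_right_mono) auto
    also have "\<dots> = gap" using D by simp
    finally have start: "traj \<alpha> g1 \<le> \<epsilon> * g1" by (simp add: gap_def)
    have "vanishing \<alpha>"
    proof (rule vanishing_if_linear_bound[OF \<alpha>(3) g1(4)])
      fix g assume g: "0 < g" "g \<le> g1"
      show "traj \<alpha> g \<le> \<epsilon> * g"
      proof (rule trajectory_trap[OF traj[OF \<alpha>(3)] \<epsilon> start _ g])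
        fix x assume x: "0 < x" "x \<le> g1"
        have "\<epsilon> \<le> \<beta> \<alpha> - \<epsilon>" using \<beta>_mono[OF \<alpha>(1)] by (simp add: \<epsilon>_def)
        then have "\<epsilon> * \<epsilon> * x \<le> \<epsilon> * (\<beta> \<alpha> - \<epsilon>) * x" using \<epsilon> x by (intro mult_right_mono mult_left_mono) auto
        then show "forcing x \<le> \<epsilon> * (\<beta> \<alpha> - \<epsilon>) * x" using h(2)[of x] x g1 by simp
      qed
    qed
    then show False using below[OF \<alpha>(3,2)] by simp
  qed
  moreover have "sublinear_end \<alpha>" if \<alpha>: "\<alpha> > \<alpha>s" for \<alpha>
  proof -
    have \<alpha>pos: "\<alpha> > 0" using \<alpha> pos by simp
    have "\<not> linear_end \<alpha>"
    proof
      assume lin: "linear_end \<alpha>"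
      have "\<forall>\<^sub>F g in at_right 0. traj \<alpha> g / g \<le> traj \<alpha>s g / g"
        using eventually_at_right_less[of "0::real"]
        by eventually_elim (use trajectory_comparison[OF traj traj] pos \<alpha> \<alpha>pos in \<open>auto intro!: divide_right_mono\<close>)
      then have "\<beta> \<alpha> \<le> \<beta> \<alpha>s"
        using lin \<open>linear_end \<alpha>s\<close> unfolding linear_end_def
        by (intro tendsto_le[of "at_right 0" "\<lambda>g. traj \<alpha>s g / g" _ "\<lambda>g. traj \<alpha> g / g"]) auto
      then show False using \<alpha> m by (simp add: \<beta>_def)
    qed
    then show ?thesis using end_dichotomy[OF mp \<alpha>pos above[OF \<alpha>]] by blast
  qed
  ultimately show thesis
    using that[OF pos] above below crit by (metis le_less)
qed

section \<open>Profiles parametrised by the trajectory\<close>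

text \<open>
  \<open>h\<close> gives the position \<open>x\<close> as a function of the phase variable \<open>g\<close>, and \<open>G\<close> is its inverse. The
  equation for \<open>h\<close> is the definition of \<open>v\<close> read backwards.
\<close>
definition parametrizes :: "real \<Rightarrow> (real \<Rightarrow> real) \<Rightarrow> real \<Rightarrow> (real \<Rightarrow> real) \<Rightarrow> (real \<Rightarrow> real) \<Rightarrow> bool" where
  "parametrizes \<alpha> f \<xi>0 h G \<longleftrightarrow>
     (\<forall>g>0. 0 < h g \<and> h g < \<xi>0 \<and> G (h g) = g \<and>
        (h has_real_derivative - (m * g powr (m - 1) * h g / traj \<alpha> g)) (at g)) \<and>
     (\<forall>x\<in>{0<..<\<xi>0}. 0 < G x \<and> h (G x) = x \<and> f x = x powr \<theta> * G x)"

lemma parametrizesD: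
  assumes "parametrizes \<alpha> f \<xi>0 h G"
  shows "g > 0 \<Longrightarrow> 0 < h g" "g > 0 \<Longrightarrow> h g < \<xi>0" "g > 0 \<Longrightarrow> G (h g) = g"
    "g > 0 \<Longrightarrow> (h has_real_derivative - (m * g powr (m - 1) * h g / traj \<alpha> g)) (at g)"
    "0 < x \<Longrightarrow> x < \<xi>0 \<Longrightarrow> 0 < G x" "0 < x \<Longrightarrow> x < \<xi>0 \<Longrightarrow> h (G x) = x"
    "0 < x \<Longrightarrow> x < \<xi>0 \<Longrightarrow> f x = x powr \<theta> * G x"
  using assms by (auto simp: parametrizes_def)

lemma parametrizes_antimono:
  assumes P: "parametrizes \<alpha> f \<xi>0 h G" and \<alpha>: "\<alpha> > 0" and g: "0 < g1" "g1 < g2"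
  shows "h g2 < h g1"
proof (rule DERIV_neg_imp_decreasing[OF g(2)])
  fix x assume "g1 \<le> x" "x \<le> g2"
  then have x: "x > 0" using g by simp
  have "m * x powr (m - 1) * h x / traj \<alpha> x > 0"
    using x m parametrizesD(1)[OF P x] trajectoryD(1)[OF traj[OF \<alpha>] x] by simp
  then show "\<exists>y. (h has_real_derivative y) (at x) \<and> y < 0"
    using parametrizesD(4)[OF P x] by (intro exI conjI) auto
qed

lemma parametrizes_antimono_iff:
  assumes "parametrizes \<alpha> f \<xi>0 h G" "\<alpha> > 0" "0 < g1" "0 < g2"
  shows "h g2 < h g1 \<longleftrightarrow> g1 < g2"
  using parametrizes_antimono[OF assms(1,2), of g1 g2] parametrizes_antimono[OF assms(1,2), of g2 g1] assms(3,4)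
  by (metis less_asym less_irrefl linorder_neqE_linordered_idom)

lemma parametrizes_limits:
  assumes P: "parametrizes \<alpha> f \<xi>0 h G" and \<alpha>: "\<alpha> > 0" and \<xi>0: "\<xi>0 > 0"
  shows "filterlim G (at_right 0) (at_left \<xi>0)" "(h \<longlongrightarrow> \<xi>0) (at_right 0)" "filterlim h (at_right 0) at_top"
proof -
  note D = parametrizesD[OF P] and iff = parametrizes_antimono_iff[OF P \<alpha>]
  show "filterlim G (at_right 0) (at_left \<xi>0)"
    unfolding filterlim_at
  proof (intro conjI order_tendstoI)
    have pos: "\<forall>\<^sub>F x in at_left \<xi>0. 0 < G x"
      unfolding eventually_at_left_field using \<xi>0 D(5) by (intro exI[of _ 0]) auto
    show "\<forall>\<^sub>F x in at_left \<xi>0. G x \<in> {0<..} \<and> G x \<noteq> 0" using pos by eventually_elim auto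
    show "\<forall>\<^sub>F x in at_left \<xi>0. a < G x" if "a < 0" for a using pos by eventually_elim (use that in auto)
    show "\<forall>\<^sub>F x in at_left \<xi>0. G x < a" if a: "a > 0" for a
      unfolding eventually_at_left_field
    proof (intro exI[of _ "h a"] conjI allI impI)
      show "h a < \<xi>0" using D(2)[OF a] .
      fix x assume x: "h a < x" "x < \<xi>0"
      then have "0 < x" using D(1)[OF a] by simp
      then show "G x < a" using iff[OF D(5) a, of x] D(6)[of x] x by simp
    qed
  qed
  show "(h \<longlongrightarrow> \<xi>0) (at_right 0)"
  proof (rule order_tendstoI)
    fix a assume a: "a < \<xi>0"
    define x where "x = max a (\<xi>0 / 2)"
    have x: "0 < x" "x < \<xi>0" "a \<le> x" using a \<xi>0 by (auto simp: x_def)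
    show "\<forall>\<^sub>F g in at_right 0. a < h g"
      unfolding eventually_at_right_field
    proof (intro exI[of _ "G x"] conjI allI impI D(5) x)
      fix g assume g: "0 < g" "g < G x"
      then have "x < h g" using iff[OF g(1) D(5)[OF x(1,2)]] D(6)[OF x(1,2)] by simp
      then show "a < h g" using x by simp
    qed
  next
    fix a assume a: "\<xi>0 < a"
    show "\<forall>\<^sub>F g in at_right 0. h g < a"
      using eventually_at_right_less[of "0::real"]
    proof eventually_elim
      case (elim g)
      show ?case using D(2)[OF elim] a by simp
    qed
  qed
  show "filterlim h (at_right 0) at_top"
    unfolding filterlim_at
  proof (intro conjI order_tendstoI)
    have pos: "\<forall>\<^sub>F g in at_top. 0 < h g"
      using eventually_gt_at_top[of 0] by eventually_elim (rule D(1))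
    show "\<forall>\<^sub>F g in at_top. h g \<in> {0<..} \<and> h g \<noteq> 0" using pos by eventually_elim auto
    show "\<forall>\<^sub>F g in at_top. a < h g" if "a < 0" for a using pos by eventually_elim (use that in auto)
    show "\<forall>\<^sub>F g in at_top. h g < a" if a: "a > 0" for a
    proof -
      define x where "x = min a (\<xi>0 / 2)"
      have x: "0 < x" "x < \<xi>0" "x \<le> a" using a \<xi>0 by (auto simp: x_def)
      show ?thesis using eventually_gt_at_top[of "G x"]
      proof eventually_elim
        case (elim g)
        have "0 < g" using elim D(5)[OF x(1,2)] by simp
        then have "h g < x" using iff[OF D(5)[OF x(1,2)], of g] D(6)[OF x(1,2)] elim by simp
        then show ?case using x by simp
      qed
    qed
  qed
qed

text \<open>
  Both position functions solve the same linear equation, so they are proportional; the values at the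
  centre force the factor to be \<open>1\<close>.
\<close>
lemma parametrizes_unique:
  assumes P: "parametrizes \<alpha> f1 \<xi>1 h1 G1" "parametrizes \<alpha> f2 \<xi>2 h2 G2" and \<alpha>: "\<alpha> > 0" and \<xi>: "\<xi>1 > 0" "\<xi>2 > 0"
    and f: "(f1 \<longlongrightarrow> 1) (at_right 0)" "(f2 \<longlongrightarrow> 1) (at_right 0)"
  shows "\<xi>1 = \<xi>2" and "0 < x \<Longrightarrow> x < \<xi>1 \<Longrightarrow> f1 x = f2 x"
proof -
  note D1 = parametrizesD[OF P(1)] and D2 = parametrizesD[OF P(2)]
  have fh1: "f1 (h1 g) = h1 g powr \<theta> * g" and fh2: "f2 (h2 g) = h2 g powr \<theta> * g" if "g > 0" for g
    using D1(1-3,7)[OF that] D1(1,2)[OF that] D1(7)[of "h1 g"] D1(3)[OF that]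
      D2(1,2)[OF that] D2(7)[of "h2 g"] D2(3)[OF that] by auto
  have "\<exists>c. \<forall>g\<in>{0<..}. ln (h1 g) - ln (h2 g) = c"
  proof (rule has_field_derivative_zero_constant)
    show "convex {0 :: real <..}" by simp
    fix g :: real assume "g \<in> {0<..}"
    then have g: "g > 0" by simp
    have "((\<lambda>g. ln (h1 g) - ln (h2 g)) has_real_derivative
        inverse (h1 g) * - (m * g powr (m - 1) * h1 g / traj \<alpha> g)
        - inverse (h2 g) * - (m * g powr (m - 1) * h2 g / traj \<alpha> g)) (at g)"
      (is "(_ has_real_derivative ?d) _")
      using D1(1,4)[OF g] D2(1,4)[OF g]
      by (auto intro!: derivative_eq_intros simp: divide_inverse)
    moreover have "?d = 0"
      using D1(1)[OF g] D2(1)[OF g] by simp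
    ultimately show "((\<lambda>g. ln (h1 g) - ln (h2 g)) has_real_derivative 0) (at g within {0<..})"
      using has_field_derivative_at_within by metis
  qed
  then obtain c where c: "\<And>g. g > 0 \<Longrightarrow> ln (h1 g) - ln (h2 g) = c" by auto
  have ratio: "h1 g = exp c * h2 g" if g: "g > 0" for g
  proof -
    have "h1 g = exp (ln (h1 g))" using D1(1)[OF g] by simp
    also have "ln (h1 g) = c + ln (h2 g)" using c[OF g] by simp
    finally show ?thesis using D2(1)[OF g] by (simp add: exp_add)
  qed
  have "((\<lambda>g. f1 (h1 g) / f2 (h2 g)) \<longlongrightarrow> 1 / 1) at_top"
    by (intro tendsto_divide filterlim_compose[OF f(1)] filterlim_compose[OF f(2)]
        parametrizes_limits(3)[OF P(1) \<alpha> \<xi>(1)] parametrizes_limits(3)[OF P(2) \<alpha> \<xi>(2)]) simp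
  moreover have "\<forall>\<^sub>F g in at_top. f1 (h1 g) / f2 (h2 g) = exp c powr \<theta>"
    using eventually_gt_at_top[of 0]
  proof eventually_elim
    case (elim g)
    have "f1 (h1 g) = (exp c * h2 g) powr \<theta> * g" using fh1[OF elim] unfolding ratio[OF elim] .
    then show ?case using fh2[OF elim] D2(1)[OF elim] elim by (simp add: powr_mult)
  qed
  ultimately have "((\<lambda>g :: real. exp c powr \<theta>) \<longlongrightarrow> 1) at_top"
    by (simp add: tendsto_cong)
  then have "exp c powr \<theta> = 1"
    by (simp add: tendsto_const_iff)
  then have "c = 0" using \<theta>_pos by (simp add: powr_def)
  then have heq: "h1 g = h2 g" if "g > 0" for g using ratio[OF that] by simp
  have "\<not> \<xi>1 < \<xi>2"
  proof
    assume "\<xi>1 < \<xi>2"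
    then have "h2 (G2 \<xi>1) = \<xi>1" "G2 \<xi>1 > 0" using D2(5,6)[of \<xi>1] \<xi> by auto
    then show False using heq[of "G2 \<xi>1"] D1(2)[of "G2 \<xi>1"] by simp
  qed
  moreover have "\<not> \<xi>2 < \<xi>1"
  proof
    assume "\<xi>2 < \<xi>1"
    then have "h1 (G1 \<xi>2) = \<xi>2" "G1 \<xi>2 > 0" using D1(5,6)[of \<xi>2] \<xi> by auto
    then show False using heq[of "G1 \<xi>2"] D2(2)[of "G1 \<xi>2"] by simp
  qed
  ultimately show eq: "\<xi>1 = \<xi>2" by simp
  show "f1 x = f2 x" if x: "0 < x" "x < \<xi>1"
  proof -
    have "G2 x > 0" "h2 (G2 x) = x" using D2(5,6)[of x] x eq by auto
    then have "G1 x = G2 x" using D1(3)[of "G2 x"] heq[of "G2 x"] by simp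
    then show ?thesis using D1(7)[OF x] D2(7)[of x] x eq by simp
  qed
qed

text \<open>
  If \<open>v\<close> is asymptotic to \<open>K * g powr (m - \<rho>)\<close>, the rule of l'Hospital shows that \<open>g powr \<rho>\<close> is asymptotic to
  a multiple of \<open>\<xi>0 - x\<close>. The values \<open>\<rho> = m - 1\<close> and \<open>\<rho> = 1 - p\<close> give Types I and II.
\<close>
lemma parametrizes_interface:
  assumes P: "parametrizes \<alpha> f \<xi>0 h G" and \<alpha>: "\<alpha> > 0" and \<xi>0: "\<xi>0 > 0"
    and \<rho>: "\<rho> > 0" and K: "K > 0"
    and v: "((\<lambda>g. traj \<alpha> g / g powr (m - \<rho>)) \<longlongrightarrow> K) (at_right 0)"
  shows "interface_behavior (1 / \<rho>) f \<xi>0"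
proof -
  note D = parametrizesD[OF P] and lims = parametrizes_limits[OF P \<alpha> \<xi>0]
  have pos: "\<forall>\<^sub>F g::real in at_right 0. g > 0" by (rule eventually_at_right_less)
  define l where "l = \<rho> / m * K / \<xi>0"
  have l: "l > 0" using \<rho> m K \<xi>0 by (simp add: l_def)
  have "((\<lambda>g. g powr \<rho> / (\<xi>0 - h g)) \<longlongrightarrow> l) (at_right 0)"
  proof (rule lhopital_right_0[where f' = "\<lambda>g. \<rho> * g powr (\<rho> - 1)"
        and g' = "\<lambda>g. m * g powr (m - 1) * h g / traj \<alpha> g"])
    show "((\<lambda>g. g powr \<rho>) \<longlongrightarrow> 0) (at_right 0)" by (rule tendsto_powr_at_right_0[OF \<rho>])
    show "((\<lambda>g. \<xi>0 - h g) \<longlongrightarrow> 0) (at_right 0)" using tendsto_diff[OF tendsto_const lims(2), of \<xi>0] by simp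
    show "\<forall>\<^sub>F g in at_right 0. \<xi>0 - h g \<noteq> 0" using pos by eventually_elim (use D(2) in fastforce)
    show "\<forall>\<^sub>F g in at_right 0. m * g powr (m - 1) * h g / traj \<alpha> g \<noteq> 0"
      using pos
    proof eventually_elim
      case (elim g)
      then show ?case using D(1)[of g] trajectoryD(1)[OF traj[OF \<alpha>], of g] m by simp
    qed
    show "\<forall>\<^sub>F g in at_right 0. ((\<lambda>g. g powr \<rho>) has_real_derivative \<rho> * g powr (\<rho> - 1)) (at g)"
      using pos by eventually_elim (auto intro!: derivative_eq_intros)
    show "\<forall>\<^sub>F g in at_right 0. ((\<lambda>g. \<xi>0 - h g) has_real_derivative m * g powr (m - 1) * h g / traj \<alpha> g) (at g)"
      using pos
    proof eventually_elim
      case (elim g)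
      show ?case using DERIV_diff[OF DERIV_const D(4)[OF elim], of \<xi>0] by simp
    qed
    \<comment> \<open>The ratio of the derivatives is, up to constants, the given limit divided by \<open>h g\<close>.\<close>
    have "((\<lambda>g. \<rho> / m * (traj \<alpha> g / g powr (m - \<rho>)) / h g) \<longlongrightarrow> l) (at_right 0)"
      unfolding l_def using \<xi>0 by (intro tendsto_intros v lims) auto
    moreover have "\<forall>\<^sub>F g in at_right 0. \<rho> / m * (traj \<alpha> g / g powr (m - \<rho>)) / h g
        = \<rho> * g powr (\<rho> - 1) / (m * g powr (m - 1) * h g / traj \<alpha> g)"
      using pos
    proof eventually_elim
      case (elim g)
      then show ?case using D(1)[of g] trajectoryD(1)[OF traj[OF \<alpha>], of g] m
        by (simp add: powr_diff field_simps)
    qed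
    ultimately show "((\<lambda>g. \<rho> * g powr (\<rho> - 1) / (m * g powr (m - 1) * h g / traj \<alpha> g)) \<longlongrightarrow> l) (at_right 0)"
      by (simp add: filterlim_cong)
  qed
  then have "((\<lambda>g. h g powr \<theta> * (g powr \<rho> / (\<xi>0 - h g)) powr (1 / \<rho>)) \<longlongrightarrow> \<xi>0 powr \<theta> * l powr (1 / \<rho>)) (at_right 0)"
    using l \<xi>0 by (intro tendsto_intros lims) auto
  from filterlim_compose[OF this lims(1)]
  have lim: "((\<lambda>x. h (G x) powr \<theta> * (G x powr \<rho> / (\<xi>0 - h (G x))) powr (1 / \<rho>)) \<longlongrightarrow> \<xi>0 powr \<theta> * l powr (1 / \<rho>)) (at_left \<xi>0)" .
  define C where "C = \<xi>0 powr \<theta> * l powr (1 / \<rho>)"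
  have C: "C > 0" using l \<xi>0 by (simp add: C_def)
  have near: "\<forall>\<^sub>F x in at_left \<xi>0. 0 < x \<and> x < \<xi>0"
    unfolding eventually_at_left_field using \<xi>0 by (intro exI[of _ 0]) auto
  have "((\<lambda>x. h (G x) powr \<theta> * (G x powr \<rho> / (\<xi>0 - h (G x))) powr (1 / \<rho>) / C) \<longlongrightarrow> C / C) (at_left \<xi>0)"
    using lim C unfolding C_def[symmetric] by (intro tendsto_intros) auto
  moreover have "\<forall>\<^sub>F x in at_left \<xi>0. h (G x) powr \<theta> * (G x powr \<rho> / (\<xi>0 - h (G x))) powr (1 / \<rho>) / C
      = f x / (C * max 0 (\<xi>0 - x) powr (1 / \<rho>))"
    using near
  proof eventually_elim
    case (elim x)
    then show ?case using D(5,6,7)[of x] \<rho> by (simp add: powr_divide powr_powr max_def)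
  qed
  ultimately have "((\<lambda>x. f x / (C * max 0 (\<xi>0 - x) powr (1 / \<rho>))) \<longlongrightarrow> 1) (at_left \<xi>0)"
    using C by (simp add: filterlim_cong)
  then have "f \<sim>[at_left \<xi>0] (\<lambda>x. C * max 0 (\<xi>0 - x) powr (1 / \<rho>))"
    by (rule asymp_equivI')
  then show ?thesis using C by (auto simp: interface_behavior_def)
qed

end

section \<open>Every profile follows the trajectory\<close>

text \<open>
  An arbitrary profile is rewritten in the phase variables: \<open>G\<close> is \<open>g\<close> and \<open>D\<close> is \<open>v\<close>, both still
  functions of the position.
\<close>
locale normalized_profile = weighted_profile +
  fixes \<sigma> \<alpha> :: real and f :: "real \<Rightarrow> real" and \<xi>0 :: real
  assumes \<sigma>: "\<sigma> = 2 * (1 - p) / (m - 1)" and \<alpha>: "\<alpha> > 0"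
    and good: "good_profile_with_interface N m p \<sigma> \<alpha> f \<xi>0" and f0: "f 0 = 1"
begin

definition F :: "real \<Rightarrow> real" where "F x = f x powr m"
definition G :: "real \<Rightarrow> real" where "G x = x powr (- \<theta>) * f x"
definition D :: "real \<Rightarrow> real" where
  "D x = \<kappa> * x powr (- \<kappa>) * F x - x powr (1 - \<kappa>) * deriv F x"

lemma \<sigma>_eq: "\<sigma> = \<theta> * (1 - p)" and \<theta>_m: "\<theta> * (m - 1) = 2" and \<alpha>_\<beta>: "\<beta> \<alpha> * \<theta> = \<alpha>"
  using m by (auto simp: \<sigma> \<theta>_def \<beta>_def field_simps)

lemma \<xi>0: "\<xi>0 > 0" and f_end: "f \<xi>0 = 0" and f_right: "(f has_real_derivative 0) (at_right 0)"
  and F_left: "(F has_real_derivative 0) (at_left \<xi>0)"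
  using good by (auto simp: good_profile_with_interface_def F_def[abs_def])

lemma profile_facts:
  assumes x: "0 < x" "x < \<xi>0"
  shows f_pos: "f x > 0" and f_deriv: "(f has_real_derivative deriv f x) (at x)"
    and F_deriv: "(F has_real_derivative deriv F x) (at x)"
    and F1_deriv: "(deriv F has_real_derivative deriv (deriv F) x) (at x)"
    and F1_eq: "deriv F x = m * f x powr (m - 1) * deriv f x"
    and ode: "deriv (deriv F) x = \<alpha> * f x - (real N - 1) / x * deriv F x - \<beta> \<alpha> * x * deriv f x
      - x powr \<sigma> * f x powr p"
proof -
  show pos: "f x > 0" using good x by (simp add: good_profile_with_interface_def)
  have *: "f differentiable (at x) \<and> F differentiable (at x) \<and> deriv F differentiable (at x) \<and>
      deriv (deriv F) x + (real N - 1) / x * deriv F x - \<alpha> * f x + \<beta> \<alpha> * x * deriv f x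
        + x powr \<sigma> * f x powr p = 0"
    using good x unfolding good_profile_with_interface_def solves_profile_ode_def
    by (simp add: Let_def F_def[abs_def] \<beta>_def)
  show df: "(f has_real_derivative deriv f x) (at x)"
    and "(F has_real_derivative deriv F x) (at x)"
    and "(deriv F has_real_derivative deriv (deriv F) x) (at x)"
    using * by (auto simp: DERIV_deriv_iff_real_differentiable)
  show "deriv F x = m * f x powr (m - 1) * deriv f x"
    unfolding F_def[abs_def] using df pos by (intro DERIV_imp_deriv) (auto intro!: derivative_eq_intros)
  show "deriv (deriv F) x = \<alpha> * f x - (real N - 1) / x * deriv F x - \<beta> \<alpha> * x * deriv f x
      - x powr \<sigma> * f x powr p"
    using * by linarith
qed

lemma powr_rules:
  fixes x :: real assumes "x > 0"
  shows "x powr (- \<kappa>) = x powr (- \<theta>) / x\<^sup>2" "x powr (1 - \<kappa>) = x powr (- \<theta>) / x"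
    "x powr (- \<theta> - 1) = x powr (- \<theta>) / x" "x powr (- \<kappa> - 1) = x powr (- \<theta>) / x ^ 3"
    "x powr \<sigma> = (x powr (- \<theta>)) powr p / x powr (- \<theta>)"
proof -
  have e: "x\<^sup>2 = x powr 2" "x ^ 3 = x powr 3" "x = x powr 1" using assms by (auto simp: powr_numeral)
  show "x powr (- \<kappa>) = x powr (- \<theta>) / x\<^sup>2" "x powr (- \<kappa> - 1) = x powr (- \<theta>) / x ^ 3"
    unfolding e(1,2) by (simp_all add: powr_diff[symmetric] \<kappa>_eq(1) algebra_simps)
  show "x powr (1 - \<kappa>) = x powr (- \<theta>) / x" "x powr (- \<theta> - 1) = x powr (- \<theta>) / x"
    using assms by (simp_all add: powr_diff \<kappa>_eq(1) powr_add powr_minus field_simps power2_eq_square)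
  show "x powr \<sigma> = (x powr (- \<theta>)) powr p / x powr (- \<theta>)"
    unfolding powr_powr powr_diff[symmetric] by (simp add: \<sigma>_eq algebra_simps)
qed

lemma G_powr:
  assumes x: "0 < x" "x < \<xi>0"
  shows "G x > 0" "G x powr m = x powr (- \<theta>) / x\<^sup>2 * (f x powr (m - 1) * f x)"
    "G x powr (m - 1) = f x powr (m - 1) / x\<^sup>2" "G x powr p = (x powr (- \<theta>)) powr p * f x powr p"
proof -
  have f: "f x > 0" by (rule f_pos[OF x])
  show "G x > 0" using f x by (simp add: G_def)
  show G1: "G x powr (m - 1) = f x powr (m - 1) / x\<^sup>2"
  proof -
    have "(x powr (- \<theta>)) powr (m - 1) = x powr (- (\<theta> * (m - 1)))" by (simp add: powr_powr)
    also have "\<dots> = inverse (x\<^sup>2)" unfolding \<theta>_m using x by (simp add: powr_minus powr_numeral)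
    finally show ?thesis using f by (simp add: G_def powr_mult divide_inverse)
  qed
  have "G x powr m = G x powr (m - 1) * G x" using \<open>G x > 0\<close> by (simp add: powr_diff)
  then show "G x powr m = x powr (- \<theta>) / x\<^sup>2 * (f x powr (m - 1) * f x)"
    unfolding G1 by (simp add: G_def)
  show "G x powr p = (x powr (- \<theta>)) powr p * f x powr p"
    using f by (simp add: G_def powr_mult)
qed

lemma D_eq:
  assumes x: "0 < x" "x < \<xi>0"
  shows "D x = x powr (- \<theta>) * f x powr (m - 1) * (\<kappa> * f x / x\<^sup>2 - m * deriv f x / x)"
proof -
  have "F x = f x powr (m - 1) * f x" using f_pos[OF x] by (simp add: F_def powr_diff)
  then show ?thesis unfolding D_def powr_rules[OF x(1)] F1_eq[OF x] using x by (simp add: field_simps)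
qed

lemma G_deriv:
  assumes x: "0 < x" "x < \<xi>0"
  shows "(G has_real_derivative - (D x / (m * x * G x powr (m - 1)))) (at x)"
proof -
  define y E where "y = x powr (- \<theta>)" and "E = f x powr (m - 1)"
  have pos: "y > 0" "E > 0" using x f_pos[OF x] by (auto simp: y_def E_def)
  have "(G has_real_derivative (- \<theta> * x powr (- \<theta> - 1) * f x + x powr (- \<theta>) * deriv f x)) (at x)"
    unfolding G_def[abs_def] using x by (auto intro!: derivative_eq_intros f_deriv)
  moreover have "- \<theta> * x powr (- \<theta> - 1) * f x + x powr (- \<theta>) * deriv f x = - \<theta> * y / x * f x + y * deriv f x"
    unfolding powr_rules[OF x(1)] y_def by simp
  moreover have "\<dots> = - (D x / (m * x * G x powr (m - 1)))"
    unfolding D_eq[OF x] G_powr[OF x] y_def[symmetric] E_def[symmetric] \<kappa>_eq(2)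
    using x pos m by (simp add: field_simps power2_eq_square)
  ultimately show ?thesis by simp
qed

text \<open>
  The explicit powers of \<open>x\<close> cancel and leave an autonomous equation in \<open>ln x\<close>. It is linear in \<open>D\<close> with
  positive inhomogeneity, which is why \<open>D\<close> cannot change sign from positive to negative.
\<close>
lemma D_deriv:
  assumes x: "0 < x" "x < \<xi>0"
  shows "(D has_real_derivative
     (\<nu> * G x powr m + G x powr p - (\<mu> + \<beta> \<alpha> / (m * G x powr (m - 1))) * D x) / x) (at x)"
proof -
  define y E B P where "y = x powr (- \<theta>)" and "E = f x powr (m - 1)" and "B = \<beta> \<alpha>"
    and "P = (x powr (- \<theta>)) powr p * f x powr p"
  have pos: "y > 0" "E > 0" using x f_pos[OF x] by (auto simp: y_def E_def)
  have Fx: "F x = E * f x" using f_pos[OF x] by (simp add: F_def powr_diff E_def)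
  have "(D has_real_derivative
      \<kappa> * (- \<kappa> * x powr (- \<kappa> - 1)) * F x + \<kappa> * x powr (- \<kappa>) * deriv F x
      - ((1 - \<kappa>) * x powr (1 - \<kappa> - 1) * deriv F x + x powr (1 - \<kappa>) * deriv (deriv F) x)) (at x)"
    (is "(_ has_real_derivative ?d) _")
    unfolding D_def[abs_def] using x by (auto intro!: derivative_eq_intros F_deriv F1_deriv)
  moreover have "?d = (\<nu> * G x powr m + G x powr p - (\<mu> + \<beta> \<alpha> / (m * G x powr (m - 1))) * D x) / x"
  proof -
    have "?d = \<kappa> * (- \<kappa> * (y / x ^ 3)) * (E * f x) + \<kappa> * (y / x\<^sup>2) * (m * E * deriv f x)
      - ((1 - \<kappa>) * (y / x\<^sup>2) * (m * E * deriv f x)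
         + y / x * (B * \<theta> * f x - (real N - 1) / x * (m * E * deriv f x) - B * x * deriv f x) - P / x)"
      unfolding ode[OF x] F1_eq[OF x] Fx y_def E_def B_def P_def \<alpha>_\<beta>
      using x by (simp add: powr_rules[OF x(1)] right_diff_distrib)
    also have "\<dots> = (\<nu> * (y / x\<^sup>2 * (E * f x)) + P
        - (\<mu> + B / (m * (E / x\<^sup>2))) * (y * E * (\<kappa> * f x / x\<^sup>2 - m * deriv f x / x))) / x"
    proof -
      define W where "W = y * E * (\<kappa> * f x / x\<^sup>2 - m * deriv f x / x)"
      have "B / (m * (E / x\<^sup>2)) * W = B * y * (\<theta> * f x - x * deriv f x)"
        unfolding W_def \<kappa>_eq(2) using x pos m by (simp add: field_simps power2_eq_square)
      then have W: "(\<mu> + B / (m * (E / x\<^sup>2))) * W = \<mu> * W + B * y * (\<theta> * f x - x * deriv f x)"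
        by (simp only: distrib_right)
      have \<nu>: "\<nu> = \<mu> * \<kappa> - \<kappa>\<^sup>2" using \<mu>_\<kappa> by simp
      show ?thesis
        unfolding W_def[symmetric] W
        unfolding W_def \<nu> \<mu>_def divide_inverse power_inverse[symmetric]
        by (simp add: algebra_simps power2_eq_square power3_eq_cube)
    qed
    also have "\<dots> = (\<nu> * G x powr m + G x powr p - (\<mu> + \<beta> \<alpha> / (m * G x powr (m - 1))) * D x) / x"
      unfolding D_eq[OF x] G_powr[OF x] y_def E_def B_def P_def by simp
    finally show ?thesis .
  qed
  ultimately show ?thesis by simp
qed

lemma f_tendsto_1: "(f \<longlongrightarrow> 1) (at_right 0)"
  using DERIV_continuous[OF f_right] unfolding continuous_within f0 .

lemma F_right: "(F has_real_derivative 0) (at_right 0)"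
proof -
  have "((\<lambda>y. y powr m) has_real_derivative m * f 0 powr (m - 1)) (at (f 0))"
    using f0 by (auto intro!: derivative_eq_intros)
  then have "((\<lambda>y. y powr m) has_real_derivative m * f 0 powr (m - 1)) (at (f 0) within f ` {0<..})"
    by (rule has_field_derivative_at_within)
  then have "((\<lambda>y. y powr m) \<circ> f has_real_derivative m * f 0 powr (m - 1) * 0) (at_right 0)"
    using f_right by (rule DERIV_image_chain[where f = "\<lambda>y. y powr m" and g = f and x = 0 and s = "{0<..}"])
  moreover have "(\<lambda>y. y powr m) \<circ> f = F" by (simp add: fun_eq_iff F_def)
  ultimately show ?thesis by simp
qed

text \<open>
  The one-sided derivative at the centre gives no limit of \<open>deriv F\<close>, but the mean value theorem yields
  points near the centre where it is small.
\<close>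
lemma deriv_F_small_somewhere:
  assumes "e > 0" "s > 0"
  shows "\<exists>t. 0 < t \<and> t < s \<and> \<bar>deriv F t\<bar> \<le> e"
proof -
  have "((\<lambda>x. (F x - F 0) / x) \<longlongrightarrow> 0) (at_right 0)"
    using F_right by (simp add: has_field_derivative_iff)
  then have "\<forall>\<^sub>F x in at_right 0. dist ((F x - F 0) / x) 0 < e" using assms(1) by (rule tendstoD)
  moreover have "\<forall>\<^sub>F x in at_right 0. 0 < x \<and> x < s \<and> x < \<xi>0"
    unfolding eventually_at_right_field using assms(2) \<xi>0 by (intro exI[of _ "min s \<xi>0"]) auto
  ultimately have "\<forall>\<^sub>F x in at_right 0. dist ((F x - F 0) / x) 0 < e \<and> 0 < x \<and> x < s \<and> x < \<xi>0"
    by eventually_elim simp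
  then obtain x where x: "dist ((F x - F 0) / x) 0 < e" "0 < x" "x < s" "x < \<xi>0"
    using eventually_happens'[OF trivial_limit_at_right_real] by blast
  have "\<exists>l z. 0 < z \<and> z < x \<and> DERIV F z :> l \<and> F x - F 0 = (x - 0) * l"
  proof (rule MVT[OF x(2)])
    show "continuous_on {0..x} F"
    proof (rule continuous_on_IccI)
      show "(F \<longlongrightarrow> F 0) (at_right 0)"
        using DERIV_continuous[OF F_right] by (simp add: continuous_within)
      have cont: "isCont F z" if "0 < z" "z < \<xi>0" for z using F_deriv[OF that] by (rule DERIV_isCont)
      show "(F \<longlongrightarrow> F x) (at_left x)"
        using cont[of x] x by (simp add: isCont_def filterlim_at_split)
      show "F \<midarrow>z\<rightarrow> F z" if "0 < z" "z < x" for z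
        using cont[of z] that x by (simp add: isCont_def)
    qed (use x in auto)
    show "F differentiable (at z)" if "0 < z" "z < x" for z
      using F_deriv[of z] that x by (auto simp: real_differentiable_def)
  qed
  then obtain l z where z: "0 < z" "z < x" "DERIV F z :> l" "F x - F 0 = x * l" by auto
  then have "deriv F z = (F x - F 0) / x" using x DERIV_imp_deriv[OF z(3)] by simp
  then show ?thesis using x z by (intro exI[of _ z]) (simp add: dist_real_def)
qed

text \<open>
  \<open>H = x powr (N - 1) * deriv F x + \<beta> \<alpha> * x powr N * f x\<close> varies by at most a multiple of \<open>x powr N\<close> on \<open>(0, x)\<close>,
  and it is arbitrarily small at suitable points near \<open>0\<close>; hence it is itself of order \<open>x powr N\<close>.
\<close>
lemma deriv_F_bound:
  obtains C \<delta> where "0 < \<delta>" "\<delta> \<le> \<xi>0" "\<And>x. 0 < x \<Longrightarrow> x < \<delta> \<Longrightarrow> \<bar>deriv F x\<bar> \<le> C * x"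
    "\<And>x. 0 < x \<Longrightarrow> x < \<delta> \<Longrightarrow> 1 / 2 < f x"
proof -
  have "\<forall>\<^sub>F x in at_right 0. 1 / 2 < f x" "\<forall>\<^sub>F x in at_right 0. f x < 2"
    by (rule order_tendstoD[OF f_tendsto_1]; simp)+
  moreover have "\<forall>\<^sub>F x in at_right 0. x < min 1 \<xi>0"
    unfolding eventually_at_right_field using \<xi>0 by (intro exI[of _ "min 1 \<xi>0"]) auto
  ultimately have "\<forall>\<^sub>F x in at_right 0. 1 / 2 < f x \<and> f x < 2 \<and> x < 1 \<and> x < \<xi>0"
    by eventually_elim simp
  then obtain \<delta>1 where \<delta>1: "\<delta>1 > 0" "\<And>x. 0 < x \<Longrightarrow> x < \<delta>1 \<Longrightarrow> 1 / 2 < f x \<and> f x < 2 \<and> x < 1 \<and> x < \<xi>0"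
    by (auto simp: eventually_at_right_field)
  define \<delta> where "\<delta> = min \<delta>1 \<xi>0"
  have \<delta>: "\<delta> > 0" "\<delta> \<le> \<xi>0" "\<And>x. 0 < x \<Longrightarrow> x < \<delta> \<Longrightarrow> 1 / 2 < f x \<and> f x < 2 \<and> x < 1 \<and> x < \<xi>0"
    using \<delta>1 \<xi>0 by (auto simp: \<delta>_def)
  define n where "n = real N"
  have n: "n \<ge> 1" using N_real by (simp add: n_def)
  define B where "B = \<beta> \<alpha>"
  have B: "B > 0" using \<beta>_pos[OF \<alpha>] by (simp add: B_def)
  define C where "C = ((\<alpha> + n * B) * 2 + 2) / n"
  \<comment> \<open>Multiplied by \<open>x powr (n - 1)\<close> the equation becomes \<open>H' = x powr (n - 1) * (...)\<close> with a bounded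
    bracket, the second derivative and \<open>f'\<close> being absorbed into \<open>H\<close>.\<close>
  define H where "H = (\<lambda>x. x powr (n - 1) * deriv F x + B * (x powr n * f x))"
  define H' where "H' = (\<lambda>x. x powr (n - 1) * ((\<alpha> + n * B) * f x - x powr \<sigma> * f x powr p))"
  have dH: "(H has_real_derivative H' x) (at x)" and H'_bound: "\<bar>H' x\<bar> \<le> C * (n * x powr (n - 1))"
    if x: "0 < x" "x < \<delta>" for x
  proof -
    have x': "x < \<xi>0" "x < 1" "0 < f x" "f x < 2" using \<delta>(3)[OF x] by auto
    have "(H has_real_derivative ((n - 1) * x powr (n - 1 - 1) * deriv F x + x powr (n - 1) * deriv (deriv F) x)
        + B * (n * x powr (n - 1) * f x + x powr n * deriv f x)) (at x)" (is "(_ has_real_derivative ?d) _")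
      unfolding H_def using x x' by (auto intro!: derivative_eq_intros F1_deriv f_deriv)
    moreover have "?d = H' x"
      unfolding ode[OF x(1) x'(1)] H'_def B_def[symmetric] n_def[symmetric] using x
      by (simp add: powr_diff field_simps power2_eq_square)
    ultimately show "(H has_real_derivative H' x) (at x)" by (simp only:)
    have "x powr \<sigma> * f x powr p \<le> 1 * 2"
    proof (rule mult_mono)
      have "\<sigma> \<ge> 0" using \<theta>_pos p1 by (simp add: \<sigma>_eq)
      then show "x powr \<sigma> \<le> 1" using x x' by (intro powr_le1) auto
      have "f x powr p \<le> 2 powr p" using x' p0 by (intro powr_mono2) auto
      also have "\<dots> \<le> 2 powr 1" using p1 by (intro powr_mono) auto
      finally show "f x powr p \<le> 2" by simp
    qed auto
    then have q: "x powr \<sigma> * f x powr p \<le> 2" "x powr \<sigma> * f x powr p \<ge> 0" by auto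
    have M: "\<alpha> + n * B > 0" using B \<alpha> n by (intro add_pos_pos mult_pos_pos) auto
    have "(\<alpha> + n * B) * f x \<le> (\<alpha> + n * B) * 2" "(\<alpha> + n * B) * f x \<ge> 0"
      using M x' by (intro mult_left_mono mult_nonneg_nonneg; linarith)+
    with q have "\<bar>(\<alpha> + n * B) * f x - x powr \<sigma> * f x powr p\<bar> \<le> (\<alpha> + n * B) * 2 + 2"
      by (simp only: abs_le_iff minus_diff_eq) (intro conjI; linarith)
    then have "x powr (n - 1) * \<bar>(\<alpha> + n * B) * f x - x powr \<sigma> * f x powr p\<bar> \<le> x powr (n - 1) * ((\<alpha> + n * B) * 2 + 2)"
      by (intro mult_left_mono) auto
    also have "\<dots> = C * (n * x powr (n - 1))" using n by (simp add: C_def)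
    finally show "\<bar>H' x\<bar> \<le> C * (n * x powr (n - 1))" by (simp add: H'_def abs_mult)
  qed
  have H_diff: "H x - C * x powr n \<le> H t" "H t \<le> H x + C * x powr n" if t: "0 < t" "t < x" "x < \<delta>" for t x
  proof -
    have Ct: "C * t powr n \<ge> 0" using B \<alpha> n by (simp add: C_def)
    have "H x - C * x powr n \<le> H t - C * t powr n"
    proof (rule DERIV_nonpos_imp_nonincreasing[where f = "\<lambda>x. H x - C * x powr n"])
      fix y assume "t \<le> y" "y \<le> x"
      then have y: "0 < y" "y < \<delta>" using t by auto
      have "((\<lambda>x. H x - C * x powr n) has_real_derivative H' y - C * (n * y powr (n - 1))) (at y)"
        using y by (auto intro!: derivative_eq_intros dH)
      then show "\<exists>d. ((\<lambda>x. H x - C * x powr n) has_real_derivative d) (at y) \<and> d \<le> 0"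
        using H'_bound[OF y] by (intro exI conjI) (assumption, simp)
    qed (use t in auto)
    then show "H x - C * x powr n \<le> H t" using Ct by simp
    have "H t + C * t powr n \<le> H x + C * x powr n"
    proof (rule DERIV_nonneg_imp_nondecreasing[where f = "\<lambda>x. H x + C * x powr n"])
      fix y assume "t \<le> y" "y \<le> x"
      then have y: "0 < y" "y < \<delta>" using t by auto
      have "((\<lambda>x. H x + C * x powr n) has_real_derivative H' y + C * (n * y powr (n - 1))) (at y)"
        using y by (auto intro!: derivative_eq_intros dH)
      then show "\<exists>d. ((\<lambda>x. H x + C * x powr n) has_real_derivative d) (at y) \<and> 0 \<le> d"
        using H'_bound[OF y] by (intro exI conjI) (assumption, simp)
    qed (use t in auto)
    then show "H t \<le> H x + C * x powr n" using Ct by simp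
  qed
  have H_bound: "\<bar>H x\<bar> \<le> C * x powr n" if x: "0 < x" "x < \<delta>" for x
  proof (rule field_le_epsilon)
    fix e :: real assume e: "e > 0"
    define e1 where "e1 = e / (1 + 2 * B)"
    have e1: "e1 > 0" using e B by (simp add: e1_def)
    obtain t where t: "0 < t" "t < min x e1" "\<bar>deriv F t\<bar> \<le> e1"
      using deriv_F_small_somewhere[OF e1, of "min x e1"] x e1 by auto
    have t': "t < 1" "0 < f t" "f t < 2" using \<delta>(3)[of t] t x by auto
    have "\<bar>t powr (n - 1) * deriv F t\<bar> \<le> 1 * e1"
      unfolding abs_mult using t t' n by (intro mult_mono) (auto intro: powr_le1)
    moreover have "B * (t powr n * f t) \<le> B * (e1 * 2)"
    proof (intro mult_left_mono mult_mono)
      have "t powr n \<le> t powr 1" using t t' n by (intro powr_mono') auto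
      then show "t powr n \<le> e1" using t by simp
    qed (use t' e1 B in auto)
    moreover have "B * (t powr n * f t) \<ge> 0" using B t' by simp
    ultimately have "\<bar>H t\<bar> \<le> e1 + B * (e1 * 2)" unfolding H_def by linarith
    also have "\<dots> = e1 * (1 + 2 * B)" by (simp add: algebra_simps)
    also have "\<dots> = e" using B by (simp add: e1_def)
    finally show "\<bar>H x\<bar> \<le> C * x powr n + e" using H_diff[of t x] t x by (simp add: abs_le_iff)
  qed
  have "\<bar>deriv F x\<bar> \<le> (C + 2 * B) * x" if x: "0 < x" "x < \<delta>" for x
  proof -
    have fx: "0 < f x" "f x < 2" using \<delta>(3)[OF x] by auto
    have "B * (x powr n * f x) \<le> B * (x powr n * 2)" using B fx by (intro mult_left_mono) auto
    moreover have "B * (x powr n * f x) \<ge> 0" using B fx by simp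
    ultimately have "\<bar>x powr (n - 1) * deriv F x\<bar> \<le> C * x powr n + B * (x powr n * 2)"
      using H_bound[OF x] unfolding H_def by linarith
    also have "\<dots> = x powr (n - 1) * ((C + 2 * B) * x)"
      using x by (simp add: powr_diff algebra_simps)
    finally show ?thesis using x by (simp add: abs_mult)
  qed
  then show thesis using that[of \<delta> "C + 2 * B"] \<delta> by blast
qed

lemma D_pos_near_0: "\<forall>\<^sub>F x in at_right 0. D x > 0"
proof -
  obtain C \<delta> where \<delta>: "0 < \<delta>" "\<And>x. 0 < x \<Longrightarrow> x < \<delta> \<Longrightarrow> \<bar>deriv F x\<bar> \<le> C * x"
    by (rule deriv_F_bound) (rule that)
  have "((\<lambda>x. x * deriv F x) \<longlongrightarrow> 0) (at_right 0)"
  proof (rule Lim_null_comparison)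
    show "\<forall>\<^sub>F x in at_right 0. norm (x * deriv F x) \<le> x * (C * x)"
      unfolding eventually_at_right_field using \<delta>
      by (intro exI[of _ \<delta>]) (auto simp: abs_mult intro!: mult_left_mono)
    show "((\<lambda>x. x * (C * x)) \<longlongrightarrow> 0) (at_right 0)" by real_asymp
  qed
  moreover have "((\<lambda>x. F x) \<longlongrightarrow> 1 powr m) (at_right 0)"
    unfolding F_def by (intro tendsto_intros f_tendsto_1) simp
  ultimately have "((\<lambda>x. \<kappa> * F x - x * deriv F x) \<longlongrightarrow> \<kappa> * 1 powr m - 0) (at_right 0)"
    by (intro tendsto_intros)
  then have "\<forall>\<^sub>F x in at_right 0. 0 < \<kappa> * F x - x * deriv F x"
    using \<kappa>_gt2 by (intro order_tendstoD(1)) auto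
  then show ?thesis
    using eventually_at_right_less[of "0::real"]
  proof eventually_elim
    case (elim x)
    have "D x = x powr (- \<kappa>) * (\<kappa> * F x - x * deriv F x)"
      using elim by (simp add: D_def powr_diff powr_minus field_simps)
    then show ?case using elim by simp
  qed
qed

lemma D_increasing_if_nonpos:
  assumes x: "0 < x" "x < \<xi>0" and "D x \<le> 0"
  obtains d where "(D has_real_derivative d) (at x)" "d > 0"
proof
  have "(\<mu> + \<beta> \<alpha> / (m * G x powr (m - 1))) * D x \<le> 0"
    using assms \<mu>_pos \<beta>_pos[OF \<alpha>] m by (intro mult_nonneg_nonpos add_nonneg_nonneg) auto
  moreover have "\<nu> * G x powr m > 0" "G x powr p > 0" using \<nu>_pos G_powr(1)[OF x] by auto
  ultimately show "0 < (\<nu> * G x powr m + G x powr p - (\<mu> + \<beta> \<alpha> / (m * G x powr (m - 1))) * D x) / x"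
    using x by (intro divide_pos_pos) linarith+
qed (rule D_deriv[OF x])

lemma D_nonneg:
  assumes x: "0 < x" "x < \<xi>0"
  shows "D x \<ge> 0"
proof (rule ccontr)
  assume neg: "\<not> D x \<ge> 0"
  have "\<forall>\<^sub>F t in at_right 0. t < x"
    unfolding eventually_at_right_field using x by (intro exI[of _ x]) auto
  with D_pos_near_0 eventually_at_right_less[of "0::real"]
  have "\<forall>\<^sub>F t in at_right 0. D t > 0 \<and> 0 < t \<and> t < x" by eventually_elim simp
  then obtain t where t: "D t > 0" "0 < t" "t < x"
    using eventually_happens'[OF trivial_limit_at_right_real] by blast
  \<comment> \<open>Running backwards from \<open>x\<close>, the quantity \<open>- D\<close> would only grow, whereas it is negative at \<open>t\<close>.\<close>
  have "- D (- (- x)) \<le> - D (- (- t))"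
  proof (rule barrier_principle[where u = "\<lambda>z. - D (- z)" and u' = "\<lambda>z. deriv D (- z)"])
    have dD: "(D has_real_derivative deriv D z) (at z)" if "t \<le> z" "z \<le> x" for z
    proof -
      have z: "0 < z" "z < \<xi>0" using that t x by auto
      show ?thesis using D_deriv[OF z] unfolding DERIV_imp_deriv[OF D_deriv[OF z]] .
    qed
    have dU: "((\<lambda>z. - D (- z)) has_real_derivative deriv D (- z)) (at z)" if "- x \<le> z" "z \<le> - t" for z
    proof -
      have "((\<lambda>z. D (- z)) has_real_derivative deriv D (- z) * (- 1)) (at z)"
        by (rule DERIV_chain2[of D _ uminus]) (use dD[of "- z"] that in \<open>auto intro!: derivative_eq_intros\<close>)
      then show ?thesis by (auto intro!: derivative_eq_intros)
    qed
    show "continuous_on {- x..- t} (\<lambda>z. - D (- z))"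
      using dU by (intro continuous_at_imp_continuous_on ballI DERIV_isCont) auto
    fix z assume z: "- x < z" "z < - t"
    then show "((\<lambda>z. - D (- z)) has_real_derivative deriv D (- z)) (at z)" using dU by simp
    assume "- D (- z) > 0"
    moreover have "0 < - z" "- z < \<xi>0" using z t x by auto
    ultimately obtain d where "(D has_real_derivative d) (at (- z))" "d > 0"
      using D_increasing_if_nonpos[of "- z"] by auto
    then show "deriv D (- z) \<ge> 0" by (simp add: DERIV_imp_deriv)
  qed (use neg t in auto)
  then show False using neg t by simp
qed

lemma D_pos:
  assumes x: "0 < x" "x < \<xi>0"
  shows "D x > 0"
proof (rule ccontr)
  assume "\<not> D x > 0"
  then have zero: "D x = 0" using D_nonneg[OF x] by simp
  obtain d where d: "(D has_real_derivative d) (at x)" "d > 0"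
    using D_increasing_if_nonpos[OF x] zero by auto
  then obtain \<epsilon> where \<epsilon>: "\<epsilon> > 0" "\<And>h. 0 < h \<Longrightarrow> h < \<epsilon> \<Longrightarrow> D (x - h) < D x"
    using DERIV_pos_inc_left by blast
  define h where "h = min \<epsilon> x / 2"
  have "0 < h" "h < \<epsilon>" "h < x" using \<epsilon>(1) x by (auto simp: h_def)
  then show False using \<epsilon>(2)[of h] D_nonneg[of "x - h"] zero x by simp
qed

lemma G_antimono:
  assumes "0 < x" "x < y" "y < \<xi>0"
  shows "G y < G x"
proof (rule DERIV_neg_imp_decreasing[OF assms(2)])
  fix z assume "x \<le> z" "z \<le> y"
  then have z: "0 < z" "z < \<xi>0" using assms by auto
  have "D z / (m * z * G z powr (m - 1)) > 0" using D_pos[OF z] G_powr(1)[OF z] m z by simp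
  then show "\<exists>d. (G has_real_derivative d) (at z) \<and> d < 0"
    using G_deriv[OF z] by (intro exI conjI) auto
qed

lemma G_at_0: "filterlim G at_top (at_right 0)"
proof (rule filterlim_at_top_mono)
  show "filterlim (\<lambda>x. x powr (- \<theta>) / 2) at_top (at_right 0)" using \<theta>_pos by real_asymp
  have "\<forall>\<^sub>F x in at_right 0. 1 / 2 < f x" using f_tendsto_1 by (rule order_tendstoD) simp
  then show "\<forall>\<^sub>F x in at_right 0. x powr (- \<theta>) / 2 \<le> G x"
  proof eventually_elim
    case (elim x)
    then show ?case using mult_left_mono[of "1 / 2" "f x" "x powr (- \<theta>)"] by (simp add: G_def)
  qed
qed

lemma F_at_\<xi>0: "(F \<longlongrightarrow> 0) (at_left \<xi>0)"
  using DERIV_continuous[OF F_left] by (simp add: continuous_within F_def f_end)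

lemma near_\<xi>0: "\<forall>\<^sub>F x in at_left \<xi>0. 0 < x \<and> x < \<xi>0"
  unfolding eventually_at_left_field using \<xi>0 by (intro exI[of _ 0]) auto

lemma G_at_\<xi>0: "(G \<longlongrightarrow> 0) (at_left \<xi>0)"
proof -
  have "((\<lambda>x. F x powr (1 / m)) \<longlongrightarrow> 0 powr (1 / m)) (at_left \<xi>0)"
    using m by (intro tendsto_powr'[OF F_at_\<xi>0 tendsto_const]) (auto simp: F_def)
  moreover have "\<forall>\<^sub>F x in at_left \<xi>0. F x powr (1 / m) = f x"
    using near_\<xi>0
  proof eventually_elim
    case (elim x)
    then show ?case using f_pos[of x] m by (simp add: F_def powr_powr)
  qed
  ultimately have "(f \<longlongrightarrow> 0) (at_left \<xi>0)" by (simp add: tendsto_cong)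
  then have "((\<lambda>x. x powr (- \<theta>) * f x) \<longlongrightarrow> \<xi>0 powr (- \<theta>) * 0) (at_left \<xi>0)"
    using \<xi>0 by (intro tendsto_intros) auto
  then show ?thesis by (simp add: G_def[abs_def])
qed

definition h :: "real \<Rightarrow> real" where "h = inv_into {0<..<\<xi>0} G"

lemma h_G: "0 < x \<Longrightarrow> x < \<xi>0 \<Longrightarrow> h (G x) = x"
proof -
  have "inj_on G {0<..<\<xi>0}"
  proof (rule linorder_inj_onI)
    show "G x \<noteq> G y" if "x < y" "x \<in> {0<..<\<xi>0}" "y \<in> {0<..<\<xi>0}" for x y
      using G_antimono[of x y] that by simp
  qed auto
  then show "0 < x \<Longrightarrow> x < \<xi>0 \<Longrightarrow> h (G x) = x" by (simp add: h_def)
qed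

lemma h_facts:
  assumes "y > 0"
  shows "0 < h y" "h y < \<xi>0" "G (h y) = y"
proof -
  have "\<forall>\<^sub>F x in at_right 0. y < G x" using G_at_0 by (simp add: filterlim_at_top_dense)
  moreover have "\<forall>\<^sub>F x in at_right 0. 0 < x \<and> x < \<xi>0 / 2"
    unfolding eventually_at_right_field using \<xi>0 by (intro exI[of _ "\<xi>0 / 2"]) auto
  ultimately have "\<forall>\<^sub>F x in at_right 0. y < G x \<and> 0 < x \<and> x < \<xi>0 / 2" by eventually_elim simp
  then obtain x1 where x1: "y < G x1" "0 < x1" "x1 < \<xi>0 / 2"
    using eventually_happens'[OF trivial_limit_at_right_real] by blast
  have "\<forall>\<^sub>F x in at_left \<xi>0. G x < y" using G_at_\<xi>0 assms by (rule order_tendstoD(2))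
  moreover have "\<forall>\<^sub>F x in at_left \<xi>0. \<xi>0 / 2 < x \<and> x < \<xi>0"
    unfolding eventually_at_left_field using \<xi>0 by (intro exI[of _ "\<xi>0 / 2"]) auto
  ultimately have "\<forall>\<^sub>F x in at_left \<xi>0. G x < y \<and> \<xi>0 / 2 < x \<and> x < \<xi>0" by eventually_elim simp
  then obtain x2 where x2: "G x2 < y" "\<xi>0 / 2 < x2" "x2 < \<xi>0"
    using eventually_happens'[OF trivial_limit_at_left_real] by blast
  have "\<exists>x. x1 \<le> x \<and> x \<le> x2 \<and> G x = y"
  proof (rule IVT2)
    show "\<forall>x. x1 \<le> x \<and> x \<le> x2 \<longrightarrow> isCont G x"
      using x1 x2 by (auto intro!: DERIV_isCont[OF G_deriv])
  qed (use x1 x2 in auto)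
  then have "y \<in> G ` {0<..<\<xi>0}" using x1 x2 by force
  then show "0 < h y" "h y < \<xi>0" "G (h y) = y"
    using inv_into_into[of y G "{0<..<\<xi>0}"] f_inv_into_f[of y G "{0<..<\<xi>0}"] by (auto simp: h_def)
qed

lemma h_deriv:
  assumes "y > 0"
  shows "(h has_real_derivative - (m * y powr (m - 1) * h y / D (h y))) (at y)"
proof -
  note hy = h_facts[OF assms]
  have "(h has_real_derivative inverse (- (D (h y) / (m * h y * G (h y) powr (m - 1))))) (at (G (h y)))"
  proof (rule has_real_derivative_left_inverse[where f = G and S = "{0<..<\<xi>0}"
        and f' = "\<lambda>x. - (D x / (m * x * G x powr (m - 1)))"])
    show "(G has_real_derivative - (D x / (m * x * G x powr (m - 1)))) (at x)" if "x \<in> {0<..<\<xi>0}" for x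
      using that G_deriv by simp
    show "- (D (h y) / (m * h y * G (h y) powr (m - 1))) \<noteq> 0"
      using D_pos[OF hy(1,2)] hy assms m by simp
    show "h (G z) = z" if "z \<in> {0<..<\<xi>0}" for z using that h_G by simp
  qed (use hy in auto)
  moreover have "inverse (- (D (h y) / (m * h y * G (h y) powr (m - 1)))) = - (m * y powr (m - 1) * h y / D (h y))"
    by (simp add: hy mult_ac)
  ultimately show ?thesis using hy by (simp add: mult_ac)
qed

text \<open>
  By the chain rule \<open>D\<close> as a function of \<open>G\<close> solves the phase equation, and the bound on \<open>deriv F\<close>
  near the centre is the linear bound at infinity.
\<close>
lemma trajectory_D_h: "trajectory \<alpha> (\<lambda>y. D (h y))"
  unfolding trajectory_def
proof (intro conjI allI impI)
  fix y :: real assume y: "y > 0"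
  note hy = h_facts[OF y]
  have Dp: "D (h y) > 0" by (rule D_pos[OF hy(1,2)])
  then show "D (h y) > 0" .
  have "((\<lambda>y. D (h y)) has_real_derivative
    (\<nu> * G (h y) powr m + G (h y) powr p - (\<mu> + \<beta> \<alpha> / (m * G (h y) powr (m - 1))) * D (h y)) / h y
     * - (m * y powr (m - 1) * h y / D (h y))) (at y)"
    by (rule DERIV_chain2[OF D_deriv[OF hy(1,2)] h_deriv[OF y]])
  moreover have "(\<nu> * G (h y) powr m + G (h y) powr p - (\<mu> + \<beta> \<alpha> / (m * G (h y) powr (m - 1))) * D (h y)) / h y
     * - (m * y powr (m - 1) * h y / D (h y)) = slope \<alpha> y (D (h y))"
    using hy(1) Dp y m unfolding hy(3) slope_def forcing_def by (simp add: field_simps)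
  ultimately show "((\<lambda>y. D (h y)) has_real_derivative slope \<alpha> y (D (h y))) (at y)" by simp
next
  obtain C \<delta> where \<delta>: "0 < \<delta>" "\<delta> \<le> \<xi>0" "\<And>x. 0 < x \<Longrightarrow> x < \<delta> \<Longrightarrow> \<bar>deriv F x\<bar> \<le> C * x"
    "\<And>x. 0 < x \<Longrightarrow> x < \<delta> \<Longrightarrow> 1 / 2 < f x"
    by (rule deriv_F_bound) (rule that)
  have bound: "\<bar>D x - \<kappa> * G x powr m\<bar> \<le> (2 * \<bar>C\<bar>) * G x" if x: "0 < x" "x < \<delta>" for x
  proof -
    have fx: "f x > 1 / 2" using \<delta>(4)[OF x] .
    have "G x powr m = x powr (- \<kappa>) * F x"
      using fx by (simp add: G_def F_def powr_mult powr_powr \<kappa>_eq(2) mult.commute)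
    then have "\<bar>D x - \<kappa> * G x powr m\<bar> = x powr (1 - \<kappa>) * \<bar>deriv F x\<bar>" by (simp add: D_def abs_mult)
    also have "\<dots> \<le> x powr (1 - \<kappa>) * (\<bar>C\<bar> * x)"
      using \<delta>(3)[OF x] x by (intro mult_left_mono order_trans[OF \<delta>(3)[OF x]] mult_right_mono) auto
    also have "\<dots> = \<bar>C\<bar> * x powr (- \<theta>) * 1"
      using x by (simp add: powr_rules(2))
    also have "\<dots> \<le> \<bar>C\<bar> * x powr (- \<theta>) * (2 * f x)" using fx by (intro mult_left_mono) auto
    finally show ?thesis by (simp add: G_def mult_ac)
  qed
  have "\<forall>\<^sub>F y in at_top. \<bar>D (h y) - \<kappa> * y powr m\<bar> \<le> (2 * \<bar>C\<bar>) * y"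
    using eventually_gt_at_top[of "max 0 (G (\<delta> / 2))"]
  proof eventually_elim
    case (elim y)
    then have y: "y > 0" "y > G (\<delta> / 2)" by auto
    note hy = h_facts[OF y(1)]
    have "h y < \<delta>"
    proof (rule ccontr)
      assume "\<not> h y < \<delta>"
      then have "G (h y) < G (\<delta> / 2)" using G_antimono[of "\<delta> / 2" "h y"] \<delta>(1) hy by simp
      then show False using hy y by simp
    qed
    then show ?case using bound[OF hy(1)] by (simp add: hy(3))
  qed
  then show "\<exists>C. \<forall>\<^sub>F y in at_top. \<bar>D (h y) - \<kappa> * y powr m\<bar> \<le> C * y" by blast
qed

lemma D_h: "y > 0 \<Longrightarrow> D (h y) = traj \<alpha> y"
  by (rule trajectory_unique[OF trajectory_D_h traj[OF \<alpha>]])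

lemma profile_parametrizes: "parametrizes \<alpha> f \<xi>0 h G"
  unfolding parametrizes_def
proof (intro conjI allI impI ballI)
  fix y :: real assume y: "y > 0"
  show "0 < h y" "h y < \<xi>0" "G (h y) = y" using h_facts[OF y] by auto
  show "(h has_real_derivative - (m * y powr (m - 1) * h y / traj \<alpha> y)) (at y)"
    using h_deriv[OF y] by (simp add: D_h[OF y])
next
  fix x assume "x \<in> {0<..<\<xi>0}"
  then have x: "0 < x" "x < \<xi>0" by auto
  show "0 < G x" by (rule G_powr(1)[OF x])
  show "h (G x) = x" by (rule h_G[OF x])
  show "f x = x powr \<theta> * G x" using x by (simp add: G_def powr_minus)
qed

text \<open>
  If \<open>v\<close> stayed away from \<open>0\<close>, then \<open>deriv F\<close> would be bounded above by a negative constant near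
  \<open>\<xi>0\<close>, contrary to the vanishing one-sided derivative of \<open>F\<close> there.
\<close>
lemma profile_vanishing: "vanishing \<alpha>"
proof (rule ccontr)
  assume "\<not> vanishing \<alpha>"
  then obtain c where c: "c > 0" "\<And>y. y > 0 \<Longrightarrow> c \<le> traj \<alpha> y" using not_vanishing_iff[OF \<alpha>] by blast
  define d where "d = (\<xi>0 / 2) powr (\<kappa> - 1) * (c / 2)"
  have d: "d > 0" using \<xi>0 c by (simp add: d_def)
  have "((\<lambda>x. \<kappa> * G x powr m) \<longlongrightarrow> \<kappa> * 0 powr m) (at_left \<xi>0)"
  proof (intro tendsto_intros tendsto_powr' G_at_\<xi>0)
    have "\<forall>\<^sub>F x in at_left \<xi>0. 0 \<le> G x"
      using near_\<xi>0
    proof eventually_elim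
      case (elim x)
      then show ?case using G_powr(1)[of x] by simp
    qed
    then show "0 \<noteq> 0 \<or> 0 < m \<and> (\<forall>\<^sub>F x in at_left \<xi>0. 0 \<le> G x)" using m by simp
  qed
  then have "\<forall>\<^sub>F x in at_left \<xi>0. \<kappa> * G x powr m < c / 2" using c(1) by (intro order_tendstoD(2)) auto
  moreover have "\<forall>\<^sub>F x in at_left \<xi>0. \<xi>0 / 2 < x \<and> x < \<xi>0"
    unfolding eventually_at_left_field using \<xi>0 by (intro exI[of _ "\<xi>0 / 2"]) auto
  ultimately have "\<forall>\<^sub>F x in at_left \<xi>0. deriv F x \<le> - d \<and> 0 < x \<and> x < \<xi>0"
  proof eventually_elim
    case (elim x)
    then have x: "0 < x" "x < \<xi>0" using \<xi>0 by auto
    have "c \<le> D x" using c(2)[OF G_powr(1)[OF x]] D_h[OF G_powr(1)[OF x]] h_G[OF x] by simp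
    have "G x powr m = x powr (- \<kappa>) * F x"
      using f_pos[OF x] by (simp add: G_def F_def powr_mult powr_powr \<kappa>_eq(2) mult.commute)
    then have "x powr (1 - \<kappa>) * deriv F x = \<kappa> * G x powr m - D x" by (simp add: D_def)
    then have "x powr (\<kappa> - 1) * (x powr (1 - \<kappa>) * deriv F x) = x powr (\<kappa> - 1) * (\<kappa> * G x powr m - D x)"
      by simp
    also have "x powr (\<kappa> - 1) * (x powr (1 - \<kappa>) * deriv F x) = deriv F x"
      using x by (simp add: mult.assoc[symmetric] powr_add[symmetric])
    also have "x powr (\<kappa> - 1) * (\<kappa> * G x powr m - D x) \<le> x powr (\<kappa> - 1) * (- (c / 2))"
      using elim \<open>c \<le> D x\<close> by (intro mult_left_mono) auto
    also have "\<dots> \<le> (\<xi>0 / 2) powr (\<kappa> - 1) * (- (c / 2))"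
      using elim \<xi>0 \<kappa>_gt2 c(1) by (intro mult_right_mono_neg powr_mono2) auto
    finally show ?case using x by (simp add: d_def)
  qed
  then obtain b where b: "b < \<xi>0" "\<And>x. b < x \<Longrightarrow> x < \<xi>0 \<Longrightarrow> deriv F x \<le> - d \<and> 0 < x"
    by (auto simp: eventually_at_left_field)
  have quot: "(F x - F \<xi>0) / (x - \<xi>0) \<le> - d" if x: "b < x" "x < \<xi>0" for x
  proof -
    have "\<exists>l z. x < z \<and> z < \<xi>0 \<and> DERIV F z :> l \<and> F \<xi>0 - F x = (\<xi>0 - x) * l"
    proof (rule MVT[OF x(2)])
      have cont: "isCont F z" if "0 < z" "z < \<xi>0" for z using F_deriv[OF that] by (rule DERIV_isCont)
      have x0: "0 < x" using b(2)[OF x] by simp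
      show "continuous_on {x..\<xi>0} F"
      proof (rule continuous_on_IccI)
        show "(F \<longlongrightarrow> F x) (at_right x)"
          using cont[of x] x x0 by (simp add: isCont_def filterlim_at_split)
        show "(F \<longlongrightarrow> F \<xi>0) (at_left \<xi>0)" using F_at_\<xi>0 by (simp add: F_def f_end)
        show "F \<midarrow>z\<rightarrow> F z" if "x < z" "z < \<xi>0" for z
          using cont[of z] that x0 by (simp add: isCont_def)
      qed (use x in auto)
      show "F differentiable (at z)" if "x < z" "z < \<xi>0" for z
        using F_deriv[of z] that x0 by (auto simp: real_differentiable_def)
    qed
    then obtain l z where z: "x < z" "z < \<xi>0" "DERIV F z :> l" "F \<xi>0 - F x = (\<xi>0 - x) * l" by auto
    have "(F x - F \<xi>0) / (x - \<xi>0) = l"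
    proof -
      have "F x - F \<xi>0 = l * (x - \<xi>0)" using z(4) by (simp add: algebra_simps)
      then show ?thesis using x by simp
    qed
    also have "l = deriv F z" using z(3) by (simp add: DERIV_imp_deriv)
    also have "\<dots> \<le> - d" using b(2)[of z] z x by simp
    finally show ?thesis .
  qed
  have "((\<lambda>x. (F x - F \<xi>0) / (x - \<xi>0)) \<longlongrightarrow> 0) (at_left \<xi>0)"
    using F_left by (simp add: has_field_derivative_iff)
  moreover have "\<forall>\<^sub>F x in at_left \<xi>0. (F x - F \<xi>0) / (x - \<xi>0) \<le> - d"
    unfolding eventually_at_left_field using b(1) quot by (intro exI[of _ b]) auto
  ultimately have "0 \<le> - d" by (intro tendsto_upperbound) auto
  then show False using d by simp
qed

end

context weighted_profile begin

section \<open>The profile of a vanishing trajectory\<close>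

text \<open>
  \<open>s\<close> is the logarithm of the position. The bounds \<open>\<kappa> * g powr m - \<alpha> / N * g \<le> v \<le> \<kappa> * g powr m\<close> make the
  derivative of \<open>\<theta> * s g + ln g\<close>, the logarithm of the profile, integrable at infinity.
\<close>
lemma trajectory_clock:
  assumes \<alpha>: "\<alpha> > 0"
  obtains s K g1 where "K > 0" "g1 \<ge> 1"
    and "\<And>g. g > 0 \<Longrightarrow> (s has_real_derivative - (m * g powr (m - 1) / traj \<alpha> g)) (at g)"
    and "\<And>g. g \<ge> g1 \<Longrightarrow> 0 \<le> \<theta> * s g + ln g \<and> \<theta> * s g + ln g \<le> K * g powr (1 - m)"
proof -
  note T = traj[OF \<alpha>]
  define v where "v = traj \<alpha>"
  have vpos: "v g > 0" and dv: "(v has_real_derivative slope \<alpha> g (v g)) (at g)" if "g > 0" for g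
    using trajectoryD[OF T that] by (auto simp: v_def)
  have "\<exists>S. \<forall>x. (0::ereal) < ereal x \<longrightarrow> ereal x < \<infinity> \<longrightarrow>
      (S has_vector_derivative - (x powr (m - 1) * m / v x)) (at x)"
  proof (rule einterval_antiderivative)
    fix x :: real assume "(0::ereal) < ereal x"
    then have x: "x > 0" by simp
    then show "isCont (\<lambda>x. - (x powr (m - 1) * m / v x)) x"
      using vpos[OF x] DERIV_isCont[OF dv[OF x]] by (intro continuous_intros) auto
  qed simp
  then obtain s0 where s0: "\<And>g. g > 0 \<Longrightarrow> (s0 has_real_derivative - (m * g powr (m - 1) / v g)) (at g)"
    by (auto simp: has_real_derivative_iff_has_vector_derivative mult.commute)
  define A where "A = \<alpha> / real N"
  have A: "A > 0" using \<alpha> N_real by (simp add: A_def)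
  define K where "K = 2 * A / \<kappa> / (m - 1)"
  have K: "K > 0" using A \<kappa>_gt2 m by (simp add: K_def)
  have "\<forall>\<^sub>F g in at_top. \<kappa> / 2 < v g / g powr m"
    using trajectory_ratio[OF T] \<kappa>_gt2 unfolding v_def by (intro order_tendstoD(1)) auto
  then have "\<forall>\<^sub>F g in at_top. \<kappa> / 2 < v g / g powr m \<and> g \<ge> 1 \<and> g \<ge> turning \<alpha>"
    using eventually_ge_at_top[of 1] eventually_ge_at_top[of "turning \<alpha>"] by eventually_elim simp
  then obtain g1 where g1: "\<And>g. g \<ge> g1 \<Longrightarrow> \<kappa> / 2 < v g / g powr m \<and> g \<ge> 1 \<and> g \<ge> turning \<alpha>"
    by (auto simp: eventually_at_top_linorder)
  have g1_1: "g1 \<ge> 1" using g1[of g1] by simp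
  define L where "L = (\<lambda>g. \<theta> * s0 g + ln g)"
  define L' where "L' = (\<lambda>g. (v g - \<kappa> * g powr m) / (g * v g))"
  have dL: "(L has_real_derivative L' g) (at g)" if g: "g > 0" for g
  proof -
    have "(L has_real_derivative \<theta> * - (m * g powr (m - 1) / v g) + 1 / g) (at g)"
      unfolding L_def using g by (auto intro!: derivative_eq_intros s0)
    moreover have "\<theta> * - (m * g powr (m - 1) / v g) + 1 / g = L' g"
      unfolding L'_def \<kappa>_eq(2) using g vpos[OF g] by (simp add: powr_diff field_simps)
    ultimately show ?thesis by simp
  qed
  have L'_bounds: "L' g \<le> 0" "- (K * (m - 1) * g powr (- m)) \<le> L' g" if g: "g \<ge> g1" for g
  proof -
    have g0: "g > 0" and gt: "g \<ge> turning \<alpha>" using g1[OF g] by auto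
    have half: "\<kappa> / 2 * g powr m < v g"
      using g1[OF g] g0 by (simp only: pos_less_divide_eq powr_gt_zero)
    show "L' g \<le> 0"
      unfolding L'_def using trajectory_bounds(3)[OF \<alpha> T g0 gt] vpos[OF g0] g0
      by (intro divide_nonpos_pos) (auto simp: v_def)
    have "A / v g \<le> A / (\<kappa> / 2 * g powr m)"
      using half A vpos[OF g0] g0 \<kappa>_gt2 by (intro divide_left_mono) auto
    also have "\<dots> = 2 * A / \<kappa> * g powr (- m)"
      using \<kappa>_gt2 g0 by (simp add: powr_minus_divide)
    also have "2 * A / \<kappa> = K * (m - 1)" using m by (simp add: K_def)
    finally have "- (K * (m - 1) * g powr (- m)) \<le> - (A * g) / (g * v g)" using g0 by simp
    also have "\<dots> \<le> L' g"
      unfolding L'_def using trajectory_bounds(2)[OF \<alpha> T g0] vpos[OF g0] g0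
      by (intro divide_right_mono) (auto simp: v_def A_def)
    finally show "- (K * (m - 1) * g powr (- m)) \<le> L' g" .
  qed
  have L_dec: "L h \<le> L g" if "g1 \<le> g" "g \<le> h" for g h
  proof (rule DERIV_nonpos_imp_nonincreasing[where f = L, OF that(2)])
    fix x assume "g \<le> x" "x \<le> h"
    then show "\<exists>y. (L has_real_derivative y) (at x) \<and> y \<le> 0"
      using dL[of x] L'_bounds(1)[of x] that g1_1 by (intro exI conjI) auto
  qed
  have L_inc: "L g - K * g powr (1 - m) \<le> L h - K * h powr (1 - m)" if "g1 \<le> g" "g \<le> h" for g h
  proof (rule DERIV_nonneg_imp_nondecreasing[where f = "\<lambda>g. L g - K * g powr (1 - m)", OF that(2)])
    fix x assume "g \<le> x" "x \<le> h"
    then have x: "x > 0" "x \<ge> g1" using that g1_1 by auto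
    have "((\<lambda>g. L g - K * g powr (1 - m)) has_real_derivative L' x - K * ((1 - m) * x powr (1 - m - 1))) (at x)"
      using x by (auto intro!: derivative_eq_intros dL)
    moreover have "L' x - K * ((1 - m) * x powr (1 - m - 1)) \<ge> 0"
      using L'_bounds(2)[OF x(2)] by (simp add: algebra_simps)
    ultimately show "\<exists>y. ((\<lambda>g. L g - K * g powr (1 - m)) has_real_derivative y) (at x) \<and> 0 \<le> y" by blast
  qed
  \<comment> \<open>\<open>L\<close> is the logarithm of the profile value, up to an additive constant; \<open>l\<close> is its limit at
    the centre, and subtracting it normalises the profile to the value \<open>1\<close> there.\<close>
  define l where "l = Inf (L ` {g1..})"
  have Kpow: "K * g powr (1 - m) \<ge> 0" for g using K by simp
  have low: "L g - K * g powr (1 - m) \<le> L h" if "g1 \<le> g" "g1 \<le> h" for g h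
  proof (cases "g \<le> h")
    case True
    then show ?thesis using L_inc[OF that(1) True] Kpow[of h] by linarith
  next
    case False
    then show ?thesis using L_dec[OF that(2), of g] Kpow[of g] by linarith
  qed
  have l_le: "l \<le> L g" if "g \<ge> g1" for g
    unfolding l_def using that low[of g1] by (intro cInf_lower) (auto simp: bdd_below_def)
  have l_ge: "L g - K * g powr (1 - m) \<le> l" if "g \<ge> g1" for g
    unfolding l_def using that low[OF that] by (intro cInf_greatest) auto
  define s where "s = (\<lambda>g. s0 g - l / \<theta>)"
  have s_L: "\<theta> * s g + ln g = L g - l" for g
    using \<theta>_pos by (simp add: s_def L_def right_diff_distrib)
  show thesis
  proof (rule that[OF K g1_1])
    show "(s has_real_derivative - (m * g powr (m - 1) / traj \<alpha> g)) (at g)" if "g > 0" for g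
      unfolding s_def using s0[OF that] by (auto intro!: derivative_eq_intros simp: v_def)
    show "0 \<le> \<theta> * s g + ln g \<and> \<theta> * s g + ln g \<le> K * g powr (1 - m)" if "g \<ge> g1" for g
      using l_le[OF that] l_ge[OF that] by (simp add: s_L)
  qed
qed

text \<open>
  The interface is reached at a finite position: above the nullcline the integrand of \<open>s\<close> is at most a
  multiple of \<open>g powr (- p)\<close>, which is integrable at \<open>0\<close> as \<open>p < 1\<close>.
\<close>
lemma clock_bounded_above:
  assumes \<alpha>: "\<alpha> > 0"
    and s: "\<And>g. g > 0 \<Longrightarrow> (s has_real_derivative - (m * g powr (m - 1) / traj \<alpha> g)) (at g)"
  obtains M where "\<And>g. g > 0 \<Longrightarrow> s g \<le> M"
proof -
  note T = traj[OF \<alpha>]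
  define A where "A = m * \<mu> + \<beta> \<alpha>"
  have A: "A > 0" using m \<mu>_pos \<beta>_pos[OF \<alpha>] by (simp add: A_def add_pos_pos)
  have bound: "m * g powr (m - 1) / traj \<alpha> g \<le> A * g powr (- p)" if g: "0 < g" "g \<le> 1" for g
  proof -
    have "g powr (m - 1) \<le> 1" using g m by (intro powr_le1) auto
    then have "m * \<mu> * g powr (m - 1) \<le> m * \<mu> * 1" using m \<mu>_pos by (intro mult_left_mono) auto
    then have A': "m * \<mu> * g powr (m - 1) + \<beta> \<alpha> \<le> A" by (simp add: A_def)
    have "m * g powr (m - 1) * g powr p / A \<le> forcing g / (m * \<mu> * g powr (m - 1) + \<beta> \<alpha>)"
      using A' damping_pos[OF \<alpha>, of g] m \<nu>_pos by (intro frac_le) (auto simp: forcing_def intro!: mult_left_mono)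
    also have "\<dots> \<le> traj \<alpha> g" using trajectory_bounds(1)[OF \<alpha> T g(1)] by (simp add: nullcline_def)
    finally have "m * g powr (m - 1) * g powr p / A \<le> traj \<alpha> g" .
    moreover have "m * g powr (m - 1) * g powr p / A > 0" using g m A by simp
    ultimately have "m * g powr (m - 1) / traj \<alpha> g \<le> m * g powr (m - 1) / (m * g powr (m - 1) * g powr p / A)"
      using g m A trajectoryD(1)[OF T g(1)] by (intro divide_left_mono mult_pos_pos divide_pos_pos) auto
    also have "\<dots> = A * g powr (- p)" using g m by (simp add: powr_minus field_simps)
    finally show ?thesis .
  qed
  have near: "s g \<le> s 1 + A / (1 - p)" if g: "0 < g" "g \<le> 1" for g
  proof -
    have "s g + A / (1 - p) * g powr (1 - p) \<le> s 1 + A / (1 - p) * 1 powr (1 - p)"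
    proof (rule DERIV_nonneg_imp_nondecreasing[where f = "\<lambda>g. s g + A / (1 - p) * g powr (1 - p)", OF g(2)])
      fix x assume "g \<le> x" "x \<le> 1"
      then have x: "0 < x" "x \<le> 1" using g by auto
      have "((\<lambda>g. s g + A / (1 - p) * g powr (1 - p)) has_real_derivative
          - (m * x powr (m - 1) / traj \<alpha> x) + A / (1 - p) * ((1 - p) * x powr (1 - p - 1))) (at x)"
        using x p1 by (auto intro!: derivative_eq_intros s)
      moreover have "A / (1 - p) * ((1 - p) * x powr (1 - p - 1)) = A * x powr (- p)" using p1 by simp
      ultimately show "\<exists>y. ((\<lambda>g. s g + A / (1 - p) * g powr (1 - p)) has_real_derivative y) (at x) \<and> 0 \<le> y"
        using bound[OF x] by (intro exI conjI) (assumption, simp)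
    qed
    moreover have "A / (1 - p) * g powr (1 - p) \<ge> 0" using A p1 by simp
    ultimately show ?thesis by simp
  qed
  have far: "s g \<le> s 1" if g: "1 \<le> g" for g
  proof (rule DERIV_nonpos_imp_nonincreasing[where f = s, OF g])
    fix x assume "1 \<le> x" "x \<le> g"
    then have x: "x > 0" by simp
    have "m * x powr (m - 1) / traj \<alpha> x \<ge> 0" using m trajectoryD(1)[OF T x] by simp
    then show "\<exists>y. (s has_real_derivative y) (at x) \<and> y \<le> 0" using s[OF x] by (intro exI conjI) auto
  qed
  show thesis
  proof (rule that[of "s 1 + A / (1 - p)"])
    fix g :: real assume "g > 0"
    moreover have "A / (1 - p) > 0" using A p1 by simp
    ultimately show "s g \<le> s 1 + A / (1 - p)" using near[of g] far[of g] by (cases "g \<le> 1") auto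
  qed
qed

text \<open>
  Since \<open>1 \<le> f x \<le> exp (K * g powr (1 - m))\<close> and \<open>g powr (1 - m) \<le> x\<^sup>2\<close> near the centre, the profile has
  value \<open>1\<close> and derivative \<open>0\<close> there.
\<close>
lemma parametrized_profile_exists:
  assumes \<alpha>: "\<alpha> > 0"
  obtains f \<xi>0 h G where "parametrizes \<alpha> f \<xi>0 h G" "\<xi>0 > 0" "f 0 = 1" "f \<xi>0 = 0"
    "(f has_real_derivative 0) (at_right 0)"
proof -
  obtain s K g1 where K: "K > 0" and g1: "g1 \<ge> 1"
    and ds: "\<And>g. g > 0 \<Longrightarrow> (s has_real_derivative - (m * g powr (m - 1) / traj \<alpha> g)) (at g)"
    and sL: "\<And>g. g \<ge> g1 \<Longrightarrow> 0 \<le> \<theta> * s g + ln g \<and> \<theta> * s g + ln g \<le> K * g powr (1 - m)"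
    by (rule trajectory_clock[OF \<alpha>]) (rule that)
  obtain M where M: "\<And>g. g > 0 \<Longrightarrow> s g \<le> M" by (rule clock_bounded_above[OF \<alpha> ds]) (auto intro: that)
  define h where "h = (\<lambda>g. exp (s g))"
  have hpos: "h g > 0" for g by (simp add: h_def)
  have dh: "(h has_real_derivative - (m * g powr (m - 1) * h g / traj \<alpha> g)) (at g)" if "g > 0" for g
    unfolding h_def using ds[OF that] by (auto intro!: derivative_eq_intros)
  have dec: "h y < h x" if "0 < x" "x < y" for x y
  proof (rule DERIV_neg_imp_decreasing[OF that(2)])
    fix z assume "x \<le> z" "z \<le> y"
    then have z: "z > 0" using that by simp
    have "m * z powr (m - 1) * h z / traj \<alpha> z > 0"
      using m z hpos trajectoryD(1)[OF traj[OF \<alpha>] z] by simp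
    then show "\<exists>d. (h has_real_derivative d) (at z) \<and> d < 0"
      using dh[OF z] by (intro exI conjI) auto
  qed
  have prod: "h g powr \<theta> * g = exp (\<theta> * s g + ln g)" if "g > 0" for g
    using that by (simp add: h_def powr_def exp_add)
  define \<xi>0 where "\<xi>0 = Sup (h ` {0<..})"
  have bdd: "bdd_above (h ` {0<..})"
    using M by (intro bdd_aboveI[of _ "exp M"]) (auto simp: h_def)
  have h_less: "h g < \<xi>0" if g: "g > 0" for g
  proof -
    have "h g < h (g / 2)" using dec[of "g / 2" g] g by simp
    also have "h (g / 2) \<le> \<xi>0" unfolding \<xi>0_def using g by (intro cSup_upper bdd) auto
    finally show ?thesis .
  qed
  have \<xi>0: "\<xi>0 > 0" using h_less[of 1] hpos[of 1] by simp
  have surj: "\<exists>g>0. h g = x" if x: "0 < x" "x < \<xi>0" for x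
  proof -
    obtain y where y: "y > 0" "x < h y"
      using x(2) bdd unfolding \<xi>0_def by (subst (asm) less_cSup_iff) auto
    \<comment> \<open>\<open>h\<close> falls below any \<open>x > 0\<close>, because \<open>h g powr \<theta> * g\<close> stays bounded as \<open>g\<close> grows.\<close>
  define z where "z = max (max g1 (y + 1)) (2 * exp K / x powr \<theta>)"
    have z: "z \<ge> g1" "z > y" "z \<ge> 1" "z > 0" using g1 by (auto simp: z_def)
    have "z powr (1 - m) \<le> 1" using z m powr_mono[of "1 - m" 0 z] by simp
    then have "K * z powr (1 - m) \<le> K * 1" using K by (intro mult_left_mono) auto
    then have "h z powr \<theta> * z \<le> exp K" using sL[OF z(1)] prod[OF z(4)] by simp
    also have "\<dots> < x powr \<theta> * z"
    proof -
      have "2 * exp K / x powr \<theta> \<le> z" by (simp add: z_def)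
      then have "2 * exp K \<le> x powr \<theta> * z" using x by (simp add: pos_divide_le_eq mult.commute)
      moreover have "exp K > 0" by simp
      ultimately show ?thesis by linarith
    qed
    finally have "h z powr \<theta> < x powr \<theta>" using z by simp
    then have "h z < x" using powr_mono2[of \<theta> x "h z"] \<theta>_pos x by (meson less_imp_le not_le)
    have "\<exists>g. y \<le> g \<and> g \<le> z \<and> h g = x"
    proof (rule IVT2)
      show "\<forall>g. y \<le> g \<and> g \<le> z \<longrightarrow> isCont h g"
        using y by (auto intro!: DERIV_isCont[OF dh])
    qed (use \<open>h z < x\<close> y z in auto)
    then obtain g where "y \<le> g" "h g = x" by blast
    then show ?thesis using y by (intro exI[of _ g]) auto
  qed
  define G where "G = inv_into {0<..} h"
  have "inj_on h {0<..}"
  proof (rule linorder_inj_onI)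
    show "h x \<noteq> h y" if "x < y" "x \<in> {0<..}" "y \<in> {0<..}" for x y
      using dec[of x y] that by simp
  qed auto
  then have Gh: "G (h g) = g" if "g > 0" for g using that by (simp add: G_def)
  have G: "G x > 0" "h (G x) = x" if x: "0 < x" "x < \<xi>0" for x
    using surj[OF x] Gh by auto
  define f where "f = (\<lambda>x. if 0 < x \<and> x < \<xi>0 then x powr \<theta> * G x else if x = 0 then 1 else 0)"
  have P: "parametrizes \<alpha> f \<xi>0 h G"
    unfolding parametrizes_def using hpos h_less Gh dh G by (auto simp: f_def)
  have near: "0 \<le> (f x - 1) / x \<and> (f x - 1) / x \<le> (exp (K * x\<^sup>2) - 1) / x" if x: "0 < x" "x < h g1" for x
  proof -
    have x': "x < \<xi>0" using x h_less[of g1] g1 by simp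
    define g where "g = G x"
    have g: "g > 0" "h g = x" using G[OF x(1) x'] by (auto simp: g_def)
    have gg1: "g \<ge> g1"
    proof (rule ccontr)
      assume "\<not> g \<ge> g1"
      then show False using dec[of g g1] g x by simp
    qed
    have fx: "f x = exp (\<theta> * s g + ln g)" using prod[OF g(1)] g x x' by (simp add: f_def g_def)
    have f1: "1 \<le> f x" using sL[OF gg1] by (simp add: fx)
    then have "1 \<le> x powr \<theta> * g" using x x' by (simp add: f_def g_def)
    then have "inverse g \<le> x powr \<theta>" using g by (simp add: field_simps)
    then have "inverse g powr (m - 1) \<le> (x powr \<theta>) powr (m - 1)" using g m by (intro powr_mono2) auto
    moreover have "(x powr \<theta>) powr (m - 1) = x\<^sup>2"
    proof -
      have "\<theta> * (m - 1) = 2" using m by (simp add: \<theta>_def field_simps)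
      then show ?thesis using x by (simp add: powr_powr)
    qed
    moreover have "inverse g powr (m - 1) = g powr (1 - m)"
      using g by (simp add: powr_diff powr_minus[symmetric] powr_def ln_inverse exp_diff[symmetric] algebra_simps)
    ultimately have "K * g powr (1 - m) \<le> K * x\<^sup>2" using K by simp
    then have "f x \<le> exp (K * x\<^sup>2)" using sL[OF gg1] by (simp add: fx)
    then show ?thesis using f1 x by (auto intro!: divide_right_mono)
  qed
  have "(f has_real_derivative 0) (at_right 0)"
    unfolding has_field_derivative_iff
  proof (rule tendsto_sandwich[where f = "\<lambda>_. 0" and h = "\<lambda>x. (exp (K * x\<^sup>2) - 1) / x"])
    show "\<forall>\<^sub>F x in at_right 0. 0 \<le> (f x - f 0) / (x - 0)"
      unfolding eventually_at_right_field using near hpos[of g1] by (intro exI[of _ "h g1"]) (auto simp: f_def)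
    show "\<forall>\<^sub>F x in at_right 0. (f x - f 0) / (x - 0) \<le> (exp (K * x\<^sup>2) - 1) / x"
      unfolding eventually_at_right_field using near hpos[of g1] by (intro exI[of _ "h g1"]) (auto simp: f_def)
    show "((\<lambda>x. (exp (K * x\<^sup>2) - 1) / x) \<longlongrightarrow> 0) (at_right 0)" using K by real_asymp
  qed simp
  then show thesis using P \<xi>0 by (intro that[of f \<xi>0 h G]) (auto simp: f_def)
qed

lemma parametrized_profile_deriv:
  assumes P: "parametrizes \<alpha> f \<xi>0 h G" and \<alpha>: "\<alpha> > 0" and x: "0 < x" "x < \<xi>0"
  shows "(G has_real_derivative - (traj \<alpha> (G x) / (m * G x powr (m - 1) * x))) (at x)"
    and "((\<lambda>x. f x powr m) has_real_derivative x powr (\<kappa> - 1) * (\<kappa> * G x powr m - traj \<alpha> (G x))) (at x)"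
proof -
  note D = parametrizesD[OF P]
  have g: "G x > 0" "h (G x) = x" using D(5,6)[OF x] by auto
  have v: "traj \<alpha> (G x) > 0" by (rule trajectoryD(1)[OF traj[OF \<alpha>] g(1)])
  have "(G has_real_derivative inverse (- (m * G x powr (m - 1) * h (G x) / traj \<alpha> (G x)))) (at (h (G x)))"
    by (rule has_real_derivative_left_inverse[where S = "{0<..}" and f = h
        and f' = "\<lambda>g. - (m * g powr (m - 1) * h g / traj \<alpha> g)"]) (use D(3,4) g v m x in auto)
  then show dG: "(G has_real_derivative - (traj \<alpha> (G x) / (m * G x powr (m - 1) * x))) (at x)"
    by (simp add: g)
  have "((\<lambda>x. x powr \<kappa> * G x powr m) has_real_derivative
      \<kappa> * x powr (\<kappa> - 1) * G x powr m + m * G x powr (m - 1) * g' * x powr \<kappa>) (at x)"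
    if "(G has_real_derivative g') (at x)" for g'
    using that g x by (auto intro!: derivative_eq_intros)
  from this[OF dG] have "((\<lambda>x. x powr \<kappa> * G x powr m) has_real_derivative
      \<kappa> * x powr (\<kappa> - 1) * G x powr m
       + m * G x powr (m - 1) * - (traj \<alpha> (G x) / (m * G x powr (m - 1) * x)) * x powr \<kappa>) (at x)" .
  moreover have "\<kappa> * x powr (\<kappa> - 1) * G x powr m
       + m * G x powr (m - 1) * - (traj \<alpha> (G x) / (m * G x powr (m - 1) * x)) * x powr \<kappa>
     = x powr (\<kappa> - 1) * (\<kappa> * G x powr m - traj \<alpha> (G x))"
    using x g m by (simp add: powr_diff field_simps)
  ultimately have "((\<lambda>x. x powr \<kappa> * G x powr m) has_real_derivative
      x powr (\<kappa> - 1) * (\<kappa> * G x powr m - traj \<alpha> (G x))) (at x)" by simp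
  then show "((\<lambda>x. f x powr m) has_real_derivative x powr (\<kappa> - 1) * (\<kappa> * G x powr m - traj \<alpha> (G x))) (at x)"
  proof (rule has_field_derivative_transform_within_open[where S = "{0<..<\<xi>0}"])
    fix y assume "y \<in> {0<..<\<xi>0}"
    then show "y powr \<kappa> * G y powr m = f y powr m"
      using D(5,7)[of y] by (simp add: powr_mult powr_powr \<kappa>_eq(2) mult.commute)
  qed (use x in auto)
qed

lemma parametrized_profile_ode:
  assumes P: "parametrizes \<alpha> f \<xi>0 h G" and \<alpha>: "\<alpha> > 0" and \<sigma>: "\<sigma> = 2 * (1 - p) / (m - 1)"
  shows "solves_profile_ode N m p \<sigma> \<alpha> f {0<..<\<xi>0}"
  unfolding solves_profile_ode_def Let_def
proof
  fix x assume "x \<in> {0<..<\<xi>0}"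
  then have x: "0 < x" "x < \<xi>0" by auto
  note D = parametrizesD[OF P]
  define F where "F = (\<lambda>x. f x powr m)"
  define F1 where "F1 = (\<lambda>x. x powr (\<kappa> - 1) * (\<kappa> * G x powr m - traj \<alpha> (G x)))"
  have dF: "(F has_real_derivative F1 y) (at y)" if "0 < y" "y < \<xi>0" for y
    unfolding F_def F1_def by (rule parametrized_profile_deriv(2)[OF P \<alpha> that])
  define g v e X where "g = G x" and "v = traj \<alpha> g" and "e = m * g powr (m - 1)" and "X = x powr \<theta>"
  have g: "g > 0" using D(5)[OF x] by (simp add: g_def)
  have v: "v > 0" using trajectoryD(1)[OF traj[OF \<alpha>] g] by (simp add: v_def)
  have e: "e > 0" using g m by (simp add: e_def)
  have X: "X > 0" using x by (simp add: X_def)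
  define g' where "g' = - (v / (e * x))"
  have dG: "(G has_real_derivative g') (at x)"
    using parametrized_profile_deriv(1)[OF P \<alpha> x] by (simp add: g'_def v_def e_def g_def)
  have Xs: "x powr (\<kappa> - 2) = X" "x powr (\<kappa> - 1) = X * x" "x powr (\<theta> - 1) = X / x"
    using x by (simp_all add: X_def \<kappa>_eq(1) powr_diff powr_add)
  have "((\<lambda>x. x powr \<theta> * G x) has_real_derivative (\<theta> * x powr (\<theta> - 1) * G x + g' * x powr \<theta>)) (at x)"
    using x by (auto intro!: derivative_eq_intros dG)
  then have df: "(f has_real_derivative (\<theta> * x powr (\<theta> - 1) * G x + g' * x powr \<theta>)) (at x)"
    by (rule has_field_derivative_transform_within_open[where S = "{0<..<\<xi>0}"]) (use x D(7) in auto)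
  have dv: "((\<lambda>x. traj \<alpha> (G x)) has_real_derivative slope \<alpha> g v * g') (at x)"
    using DERIV_chain2[OF _ dG, of "traj \<alpha>"] trajectoryD(2)[OF traj[OF \<alpha>] g] by (simp add: v_def g_def)
  have dF1: "(F1 has_real_derivative ((\<kappa> - 1) * x powr (\<kappa> - 1 - 1) * (\<kappa> * G x powr m - traj \<alpha> (G x))
      + (\<kappa> * (m * G x powr (m - 1) * g') - slope \<alpha> g v * g') * x powr (\<kappa> - 1))) (at x)"
    unfolding F1_def using x g by (auto intro!: derivative_eq_intros dG dv simp: g_def)
  have derivF: "deriv F y = F1 y" if "0 < y" "y < \<xi>0" for y using dF[OF that] by (rule DERIV_imp_deriv)
  have dF': "(deriv F has_real_derivative ((\<kappa> - 1) * x powr (\<kappa> - 1 - 1) * (\<kappa> * G x powr m - traj \<alpha> (G x))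
      + (\<kappa> * (m * G x powr (m - 1) * g') - slope \<alpha> g v * g') * x powr (\<kappa> - 1))) (at x)"
    using dF1 by (rule has_field_derivative_transform_within_open[where S = "{0<..<\<xi>0}"]) (use x derivF in auto)
  have fp: "x powr \<sigma> * f x powr p = X * g powr p"
  proof -
    have "f x powr p = X powr p * g powr p" using D(7)[OF x] X g by (simp add: X_def g_def powr_mult)
    moreover have "x powr \<sigma> * X powr p = X"
    proof -
      have "\<sigma> + \<theta> * p = \<theta> * (1 - p) + \<theta> * p" by (simp add: \<sigma> \<theta>_def)
      then have "\<sigma> + \<theta> * p = \<theta>" by (simp add: right_diff_distrib)
      then show ?thesis by (simp add: X_def powr_powr powr_add[symmetric])
    qed
    ultimately show ?thesis by (metis mult.assoc)
  qed
  have f1: "deriv f x = X * (\<theta> * g / x + g')"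
    using DERIV_imp_deriv[OF df] by (simp add: Xs g_def[symmetric] X_def[symmetric] algebra_simps)
  have fx: "f x = X * g" using D(7)[OF x] by (simp add: X_def g_def)
  have S1: "e * g' = - (v / x)" using e by (simp add: g'_def)
  have S2: "slope \<alpha> g v * g' = - (\<mu> * v + \<beta> \<alpha> * v / e - (\<nu> * g powr m + g powr p)) / x"
  proof -
    have "slope \<alpha> g v = e * \<mu> + \<beta> \<alpha> - e * (\<nu> * g powr m + g powr p) / v"
      by (simp add: slope_def forcing_def e_def mult_ac)
    then show ?thesis unfolding g'_def using e v x by (simp add: field_simps)
  qed
  have "deriv (deriv F) x = (\<kappa> - 1) * X * (\<kappa> * g powr m - v) + (\<kappa> * (e * g') - slope \<alpha> g v * g') * (X * x)"
    using DERIV_imp_deriv[OF dF'] by (simp add: Xs g_def[symmetric] e_def v_def)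
  also have "\<dots> = X * ((\<kappa> - 1) * (\<kappa> * g powr m - v) - \<kappa> * v
      + \<mu> * v + \<beta> \<alpha> * v / e - (\<nu> * g powr m + g powr p))"
    unfolding S1 S2 using x e by (simp add: field_simps)
  finally have f2: "deriv (deriv F) x = X * ((\<kappa> - 1) * (\<kappa> * g powr m - v) - \<kappa> * v
      + \<mu> * v + \<beta> \<alpha> * v / e - (\<nu> * g powr m + g powr p))" .
  have f3: "deriv F x = X * x * (\<kappa> * g powr m - v)"
    using derivF[OF x] by (simp add: F1_def Xs g_def v_def)
  have \<alpha>\<beta>: "\<alpha> = \<beta> \<alpha> * \<theta>" using m by (simp add: \<beta>_def \<theta>_def field_simps)
  have "deriv (deriv F) x + (real N - 1) / x * deriv F x - \<alpha> * f x + \<beta> \<alpha> * x * deriv f x + x powr \<sigma> * f x powr p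
    = X * ((\<kappa> - 1) * (\<kappa> * g powr m - v) - \<kappa> * v + \<mu> * v + \<beta> \<alpha> * v / e - (\<nu> * g powr m + g powr p)
      + (real N - 1) * (\<kappa> * g powr m - v) - \<alpha> * g + \<beta> \<alpha> * (\<theta> * g - v / e) + g powr p)"
  proof -
    have "x * (\<theta> * g / x + g') = \<theta> * g - v / e" using x e by (simp add: g'_def field_simps)
    then have b1: "\<beta> \<alpha> * x * deriv f x = X * (\<beta> \<alpha> * (\<theta> * g - v / e))"
      unfolding f1 by (metis mult.assoc mult.commute)
    have b3: "(real N - 1) / x * deriv F x = X * ((real N - 1) * (\<kappa> * g powr m - v))"
      unfolding f3 using x by simp
    show ?thesis unfolding f2 fp b1 b3 unfolding fx by (simp add: algebra_simps)
  qed
  also have "\<dots> = X * 0"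
  proof -
    have "\<theta> * \<beta> \<alpha> = \<alpha>" using \<alpha>\<beta> by (simp add: mult.commute)
    then show ?thesis by (simp add: \<mu>_def \<nu>_def algebra_simps)
  qed
  finally have ode: "deriv (deriv F) x + (real N - 1) / x * deriv F x - \<alpha> * f x + \<beta> \<alpha> * x * deriv f x
    + x powr \<sigma> * f x powr p = 0" by simp
  have "f differentiable (at x)" "F differentiable (at x)" "deriv F differentiable (at x)"
    using df dF[OF x] dF' by (auto simp: real_differentiable_def)
  with ode show "f differentiable (at x) \<and> (\<lambda>\<xi>. f \<xi> powr m) differentiable (at x) \<and>
      deriv (\<lambda>\<xi>. f \<xi> powr m) differentiable (at x) \<and>
      deriv (deriv (\<lambda>\<xi>. f \<xi> powr m)) x + (real N - 1) / x * deriv (\<lambda>\<xi>. f \<xi> powr m) x - \<alpha> * f x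
      + (m - 1) / 2 * \<alpha> * x * deriv f x + x powr \<sigma> * f x powr p = 0"
    unfolding F_def \<beta>_def by blast
qed

lemma profile_exists:
  assumes \<alpha>: "\<alpha> > 0" and \<sigma>: "\<sigma> = 2 * (1 - p) / (m - 1)" and van: "vanishing \<alpha>"
  obtains f \<xi>0 h G where "good_profile_with_interface N m p \<sigma> \<alpha> f \<xi>0" "f 0 = 1"
    "parametrizes \<alpha> f \<xi>0 h G" "\<xi>0 > 0"
proof -
  obtain f \<xi>0 h G where P: "parametrizes \<alpha> f \<xi>0 h G" and \<xi>0: "\<xi>0 > 0" and f0: "f 0 = 1" and f1: "f \<xi>0 = 0"
    and f': "(f has_real_derivative 0) (at_right 0)"
    by (rule parametrized_profile_exists[OF \<alpha>]) (rule that)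
  note D = parametrizesD[OF P] and lims = parametrizes_limits[OF P \<alpha> \<xi>0]
  have near: "\<forall>\<^sub>F x in at_left \<xi>0. 0 < x \<and> x < \<xi>0"
    unfolding eventually_at_left_field using \<xi>0 by (intro exI[of _ 0]) auto
  have Gm: "((\<lambda>x. G x powr m) \<longlongrightarrow> 0) (at_left \<xi>0)"
    by (rule filterlim_compose[OF tendsto_powr_at_right_0 lims(1)]) (use m in simp)
  have "((\<lambda>x. f x powr m / (x - \<xi>0)) \<longlongrightarrow> 0) (at_left \<xi>0)"
  proof (rule lhopital_left[where g' = "\<lambda>_. 1"
        and f' = "\<lambda>x. x powr (\<kappa> - 1) * (\<kappa> * G x powr m - traj \<alpha> (G x))"])
    have "((\<lambda>x. x powr \<kappa> * G x powr m) \<longlongrightarrow> \<xi>0 powr \<kappa> * 0) (at_left \<xi>0)"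
      using \<xi>0 by (intro tendsto_intros Gm) auto
    moreover have "\<forall>\<^sub>F x in at_left \<xi>0. x powr \<kappa> * G x powr m = f x powr m"
      using near
    proof eventually_elim
      case (elim x)
      then show ?case using D(5,7)[of x] by (simp add: powr_mult powr_powr \<kappa>_eq(2) mult.commute)
    qed
    ultimately show "((\<lambda>x. f x powr m) \<longlongrightarrow> 0) (at_left \<xi>0)" by (simp add: tendsto_cong)
    show "((\<lambda>x. x - \<xi>0) \<longlongrightarrow> 0) (at_left \<xi>0)" by (auto intro!: tendsto_eq_intros)
    show "\<forall>\<^sub>F x in at_left \<xi>0. x - \<xi>0 \<noteq> 0" using near by eventually_elim simp
    show "\<forall>\<^sub>F x in at_left \<xi>0. ((\<lambda>x. f x powr m) has_real_derivative
        x powr (\<kappa> - 1) * (\<kappa> * G x powr m - traj \<alpha> (G x))) (at x)"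
      using near by eventually_elim (rule parametrized_profile_deriv(2)[OF P \<alpha>]; simp)
    show "\<forall>\<^sub>F x in at_left \<xi>0. ((\<lambda>x. x - \<xi>0) has_real_derivative 1) (at x)"
      by (auto intro!: derivative_eq_intros always_eventually)
    have "((\<lambda>x. traj \<alpha> (G x)) \<longlongrightarrow> 0) (at_left \<xi>0)"
      using van unfolding vanishing_def by (rule filterlim_compose[OF _ lims(1)])
    then have "((\<lambda>x. x powr (\<kappa> - 1) * (\<kappa> * G x powr m - traj \<alpha> (G x))) \<longlongrightarrow> \<xi>0 powr (\<kappa> - 1) * (\<kappa> * 0 - 0)) (at_left \<xi>0)"
      using \<xi>0 by (intro tendsto_intros Gm) auto
    then show "((\<lambda>x. x powr (\<kappa> - 1) * (\<kappa> * G x powr m - traj \<alpha> (G x)) / 1) \<longlongrightarrow> 0) (at_left \<xi>0)" by simp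
  qed simp
  then have "((\<lambda>x. f x powr m) has_real_derivative 0) (at_left \<xi>0)"
    by (simp add: has_field_derivative_iff f1)
  moreover have "f x > 0" if "0 < x" "x < \<xi>0" for x using D(5,7)[OF that] that by simp
  ultimately have "good_profile_with_interface N m p \<sigma> \<alpha> f \<xi>0"
    unfolding good_profile_with_interface_def
    using f0 f1 f' \<xi>0 parametrized_profile_ode[OF P \<alpha> \<sigma>] by simp
  then show thesis using that f0 P \<xi>0 by blast
qed

lemma normalized_profileI:
  assumes "\<alpha> > 0" "\<sigma> = 2 * (1 - p) / (m - 1)" "good_profile_with_interface N m p \<sigma> \<alpha> f \<xi>0" "f 0 = 1"
  shows "normalized_profile N m p \<sigma> \<alpha> f \<xi>0"
  by unfold_locales (fact assms)+

lemma good_profile_iff_vanishing: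
  assumes "\<alpha> > 0" "\<sigma> = 2 * (1 - p) / (m - 1)"
  shows "(\<exists>f \<xi>0. good_profile_with_interface N m p \<sigma> \<alpha> f \<xi>0 \<and> f 0 = 1) \<longleftrightarrow> vanishing \<alpha>"
proof
  assume "\<exists>f \<xi>0. good_profile_with_interface N m p \<sigma> \<alpha> f \<xi>0 \<and> f 0 = 1"
  then show "vanishing \<alpha>"
    using normalized_profile.profile_vanishing[OF normalized_profileI[OF assms]] by blast
next
  assume "vanishing \<alpha>"
  from profile_exists[OF assms this]
  show "\<exists>f \<xi>0. good_profile_with_interface N m p \<sigma> \<alpha> f \<xi>0 \<and> f 0 = 1" by metis
qed

text \<open>
  Any two normalised profiles are parametrised by the same trajectory, so they agree; the end of that
  trajectory determines the interface behaviour.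
\<close>
lemma profile_exists_unique:
  assumes \<alpha>: "\<alpha> > 0" and \<sigma>: "\<sigma> = 2 * (1 - p) / (m - 1)" and van: "vanishing \<alpha>"
    and \<rho>: "\<rho> > 0" and K: "K > 0"
    and v: "((\<lambda>g. traj \<alpha> g / g powr (m - \<rho>)) \<longlongrightarrow> K) (at_right 0)"
  shows "exists_unique_profile (\<lambda>f \<xi>0. good_profile_with_interface N m p \<sigma> \<alpha> f \<xi>0 \<and> f 0 = 1 \<and>
    interface_behavior (1 / \<rho>) f \<xi>0)"
proof -
  obtain f \<xi>0 h G where good: "good_profile_with_interface N m p \<sigma> \<alpha> f \<xi>0" and f0: "f 0 = 1"
    and P: "parametrizes \<alpha> f \<xi>0 h G" and \<xi>0: "\<xi>0 > 0"
    by (rule profile_exists[OF \<alpha> \<sigma> van]) (rule that)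
  interpret f: normalized_profile N m p \<sigma> \<alpha> f \<xi>0 by (rule normalized_profileI[OF \<alpha> \<sigma> good f0])
  have "\<eta>0 = \<xi>0 \<and> (\<forall>x\<in>{0..\<xi>0}. g x = f x)"
    if good': "good_profile_with_interface N m p \<sigma> \<alpha> g \<eta>0" and g0: "g 0 = 1" for g \<eta>0
  proof -
    interpret g: normalized_profile N m p \<sigma> \<alpha> g \<eta>0 by (rule normalized_profileI[OF \<alpha> \<sigma> good' g0])
    note unique = parametrizes_unique[OF g.profile_parametrizes P \<alpha> g.\<xi>0 \<xi>0 g.f_tendsto_1 f.f_tendsto_1]
    have "g x = f x" if "x \<in> {0..\<xi>0}" for x
      using unique g.f_end f.f_end g0 f0 that by (cases "x = 0"; cases "x = \<xi>0") auto
    then show ?thesis using unique(1) by simp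
  qed
  then show ?thesis
    unfolding exists_unique_profile_def
    using good f0 parametrizes_interface[OF P \<alpha> \<xi>0 \<rho> K v] by (intro exI[of _ f] exI[of _ \<xi>0]) blast
qed

end

section \<open>The critical exponent and the two interface types\<close>

theorem theorem1p2:
  fixes N :: nat and m p \<sigma> :: real
  assumes "N \<ge> 1" and "m > 1" and "0 < p" and "p < 1"
    and "\<sigma> = 2 * (1 - p) / (m - 1)" and "m + p > 2"
  shows "\<exists>\<alpha>s. critical_exponent N m p \<sigma> \<alpha>s \<and>
     (\<forall>a. critical_exponent N m p \<sigma> a \<longrightarrow> a = \<alpha>s) \<and>
     exists_unique_profile (\<lambda>f \<xi>0. good_profile_with_interface N m p \<sigma> \<alpha>s f \<xi>0 \<and> f 0 = 1 \<and>
        interface_type_I m f \<xi>0) \<and>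
     (\<forall>\<alpha>>\<alpha>s. exists_unique_profile (\<lambda>f \<xi>0. good_profile_with_interface N m p \<sigma> \<alpha> f \<xi>0 \<and> f 0 = 1 \<and>
        interface_type_II p f \<xi>0))"
proof -
  interpret weighted_profile N m p by unfold_locales (use assms in auto)
  obtain \<alpha>s where pos: "\<alpha>s > 0" and above: "\<And>\<alpha>. \<alpha> \<ge> \<alpha>s \<Longrightarrow> vanishing \<alpha>"
    and below: "\<And>\<alpha>. 0 < \<alpha> \<Longrightarrow> \<alpha> < \<alpha>s \<Longrightarrow> \<not> vanishing \<alpha>"
    and lin: "linear_end \<alpha>s" and sub: "\<And>\<alpha>. \<alpha> > \<alpha>s \<Longrightarrow> sublinear_end \<alpha>"
    by (rule critical_trajectory[OF assms(6)]) (rule that)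
  note iff = good_profile_iff_vanishing[OF _ assms(5)]
  have crit: "critical_exponent N m p \<sigma> \<alpha>s"
    unfolding critical_exponent_def
  proof (intro conjI allI impI pos)
    fix \<alpha> assume "\<alpha>s \<le> \<alpha>"
    then show "\<exists>f \<xi>0. good_profile_with_interface N m p \<sigma> \<alpha> f \<xi>0 \<and> f 0 = 1"
      using iff[of \<alpha>] above[of \<alpha>] pos by simp
  next
    fix \<alpha> assume "0 < \<alpha> \<and> \<alpha> < \<alpha>s"
    then show "\<not> (\<exists>f \<xi>0. good_profile_with_interface N m p \<sigma> \<alpha> f \<xi>0 \<and> f 0 = 1)"
      using iff[of \<alpha>] below[of \<alpha>] by simp
  qed
  have unique: "a = \<alpha>s" if a: "critical_exponent N m p \<sigma> a" for a
  proof -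
    have "\<not> a < \<alpha>s"
    proof
      assume "a < \<alpha>s"
      then have "vanishing a" using a iff[of a] unfolding critical_exponent_def by blast
      then show False using below[of a] \<open>a < \<alpha>s\<close> a by (simp add: critical_exponent_def)
    qed
    moreover have "\<not> \<alpha>s < a"
    proof
      assume "\<alpha>s < a"
      then have "\<not> vanishing \<alpha>s" using a iff[OF pos] pos unfolding critical_exponent_def by blast
      then show False using above[of \<alpha>s] by simp
    qed
    ultimately show ?thesis by simp
  qed
  have typeI: "exists_unique_profile (\<lambda>f \<xi>0. good_profile_with_interface N m p \<sigma> \<alpha>s f \<xi>0 \<and> f 0 = 1 \<and>
        interface_type_I m f \<xi>0)"
    unfolding interface_type_I_def
  proof (rule profile_exists_unique[OF pos assms(5) above])
    have "\<forall>\<^sub>F g in at_right 0. traj \<alpha>s g / g powr (m - (m - 1)) = traj \<alpha>s g / g"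
      using eventually_at_right_less[of "0::real"] by eventually_elim simp
    then show "((\<lambda>g. traj \<alpha>s g / g powr (m - (m - 1))) \<longlongrightarrow> \<beta> \<alpha>s) (at_right 0)"
      using lin unfolding linear_end_def by (simp only: tendsto_cong)
  qed (use assms(2) \<beta>_pos[OF pos] in auto)
  have typeII: "exists_unique_profile (\<lambda>f \<xi>0. good_profile_with_interface N m p \<sigma> \<alpha> f \<xi>0 \<and> f 0 = 1 \<and>
        interface_type_II p f \<xi>0)" if \<alpha>: "\<alpha> > \<alpha>s" for \<alpha>
    unfolding interface_type_II_def
  proof (rule profile_exists_unique[OF _ assms(5) above])
    show "((\<lambda>g. traj \<alpha> g / g powr (m - (1 - p))) \<longlongrightarrow> m / \<beta> \<alpha>) (at_right 0)"
      using sub[OF \<alpha>] unfolding sublinear_end_def by (simp add: algebra_simps)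
    show "m / \<beta> \<alpha> > 0" using \<beta>_pos[of \<alpha>] \<alpha> pos assms(2) by simp
  qed (use assms \<alpha> pos in auto)
  show ?thesis using crit unique typeI typeII by blast
qed

end
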